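(* Let $X=\{X_t;\ t\in\mathbf{R}_+^N\}$ be a multiparameter Gaussian random field in $\mathbf{R}^d$, with i.i.d. coordinate processes $X^{(1)},\dots,X^{(d)}$. For $t\in\mathbf{R}_+^N$ let $\widetilde{\alpha}_{X^{(i)}}(t)$ be the deterministic local Hölder exponent and $\underline{\alpha}_{X^{(i)}}(t)$ the deterministic local sub-exponent of $X^{(i)}$ at $t$ (both independent of $1\le i\le d$). Let $I\subset\mathbf{R}_+^N$ be any open interval and assume that the quantities $\underline{\alpha}=\inf_{t\in I}\underline{\alpha}_{X^{(i)}}(t)$ and $\widetilde{\alpha}=\inf_{t\in I}\widetilde{\alpha}_{X^{(i)}}(t)$ satisfy $0<\widetilde{\alpha}\le\underline{\alpha}$. Then, with probability one, $$\dim_{\mathcal H}(\mathrm{Gr}_X(I))\ \ge\ \begin{cases} N/\underline{\alpha} & \text{if } N\le d\,\underline{\alpha},\\ N+d(1-\underline{\alpha}) & \text{if } N> d\,\underline{\alpha},\end{cases}\qquad \dim_{\mathcal H}(\mathrm{Gr}_X(I))\le\min\{N/\widetilde{\alpha}\,;\ N+d(1-\widetilde{\alpha})\},$$ and $$\dim_{\mathcal H}(\mathrm{Rg}_X(I))\ \ge\ \begin{cases} N/\underline{\alpha} & \text{if } N\le d\,\underline{\alpha},\\ d & \text{if } N> d\,\underline{\alpha},\end{cases}\qquad \dim_{\mathcal H}(\mathrm{Rg}_X(I))\le\min\{N/\widetilde{\alpha}\,;\ d\}.$$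
   Context: $\mathbf{R}_+=[0,\infty)$ and $\|\cdot\|$ is the Euclidean norm. A multiparameter Gaussian random field in $\mathbf{R}^d$ is a stochastic process $X=\{X_t;\ t\in\mathbf{R}_+^N\}$ with $X_t=(X^{(1)}_t,\dots,X^{(d)}_t)\in\mathbf{R}^d$, whose coordinate processes $X^{(i)}=\{X^{(i)}_t;\ t\in\mathbf{R}_+^N\}$ are independent real-valued Gaussian processes with the same law. $B(t_0,\rho)$ is the ball of $\mathbf{R}_+^N$ with center $t_0$ and radius $\rho$. An interval of $\mathbf{R}_+^N$ is a product of $N$ one-dimensional intervals. For a real-valued Gaussian process $Y=\{Y_t;\ t\in\mathbf{R}_+^N\}$ and $t_0\in\mathbf{R}_+^N$, the deterministic local Hölder exponent is $$\widetilde{\alpha}_Y(t_0)=\sup\Big\{\alpha>0:\ \lim_{\rho\to0}\sup_{s,t\in B(t_0,\rho)}\frac{\mathbf{E}[|Y_t-Y_s|^2]}{\|t-s\|^{2\alpha}}<+\infty\Big\}$$ and the deterministic local sub-exponent is $$\underline{\alpha}_Y(t_0)=\inf\Big\{\alpha>0:\ \lim_{\rho\to0}\inf_{s,t\in B(t_0,\rho)}\frac{\mathbf{E}[|Y_t-Y_s|^2]}{\|t-s\|^{2\alpha}}=+\infty\Big\}$$ (sup and inf over $s\ne t$; $\inf\emptyset=+\infty$, $N/(+\infty)=0$). $\mathrm{Rg}_X(A)=\{X_t;\ t\in A\}$ and $\mathrm{Gr}_X(A)=\{(t,X_t);\ t\in A\}$ are the range and the graph of $X$ over $A\subset\mathbf{R}_+^N$,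 and $\dim_{\mathcal H}$ is Hausdorff dimension.
   Formalization: X is assumed to have almost surely continuous paths on the nonempty interval I (otherwise a modification of X can violate the upper bounds), and the upper bound for the graph is claimed only when the infimum of the local Hölder exponents is finite. *)

theory Defs
  imports "HOL-Probability.Probability"
begin

section \<open>Hausdorff dimension\<close>

text \<open>
  Size-\<open>\<delta>\<close> Hausdorff content and Hausdorff measure of exponent \<open>s\<close>.  They are only used for
  \<open>s > 0\<close> (note \<open>0 powr 0 = 0\<close> in HOL); \<^const>\<open>diameter\<close> is meaningful on bounded sets only,
  hence the explicit boundedness of the covering sets.
\<close>

definition hausdorff_content :: "real \<Rightarrow> real \<Rightarrow> 'a::metric_space set \<Rightarrow> ennreal" where
  "hausdorff_content s \<delta> A =
     (INF U \<in> {U :: nat \<Rightarrow> 'a set. A \<subseteq> (\<Union>k. U k) \<and> (\<forall>k. bounded (U k) \<and> diameter (U k) \<le> \<delta>)}.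
        \<Sum>k. ennreal (diameter (U k) powr s))"

definition hausdorff_measure :: "real \<Rightarrow> 'a::metric_space set \<Rightarrow> ennreal" where
  "hausdorff_measure s A = (SUP \<delta> \<in> {0<..}. hausdorff_content s \<delta> A)"

definition hausdorff_dim :: "'a::metric_space set \<Rightarrow> ereal" where
  "hausdorff_dim A = Inf {ereal s | s. 0 < s \<and> hausdorff_measure s A = 0}"

section \<open>The parameter space\<close>

definition orthant :: "(real ^ 'n) set" where
  "orthant = {t. \<forall>i. 0 \<le> t $ i}"

text \<open>
  Intervals are products of (possibly unbounded) one-dimensional intervals.  Openness is relative
  to the orthant, so that the faces of the orthant may belong to an open interval.
\<close>

definition orthant_interval :: "(real ^ 'n) set \<Rightarrow> bool" where
  "orthant_interval I \<longleftrightarrow>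
     I \<subseteq> orthant \<and> (\<exists>J :: 'n \<Rightarrow> real set. (\<forall>i. is_interval (J i)) \<and> I = {t. \<forall>i. t $ i \<in> J i})"

definition open_orthant_interval :: "(real ^ 'n) set \<Rightarrow> bool" where
  "open_orthant_interval I \<longleftrightarrow>
     orthant_interval I \<and> openin (top_of_set orthant) I \<and> I \<noteq> {}"

section \<open>Gaussian fields\<close>

text \<open>Gaussian laws may be degenerate, i.e. Dirac masses; no centring is assumed.\<close>

definition gaussian_rv :: "'w measure \<Rightarrow> ('w \<Rightarrow> real) \<Rightarrow> bool" where
  "gaussian_rv M Z \<longleftrightarrow>
     Z \<in> borel_measurable M \<and>
     ((\<exists>\<mu>. AE \<omega> in M. Z \<omega> = \<mu>) \<or>
      (\<exists>\<mu> \<sigma>. 0 < \<sigma> \<and> distributed M lborel Z (\<lambda>x. ennreal (normal_density \<mu> \<sigma> x))))"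

definition gaussian_process :: "'w measure \<Rightarrow> 't set \<Rightarrow> ('t \<Rightarrow> 'w \<Rightarrow> real) \<Rightarrow> bool" where
  "gaussian_process M T Y \<longleftrightarrow>
     (\<forall>F c. finite F \<and> F \<subseteq> T \<longrightarrow> gaussian_rv M (\<lambda>\<omega>. \<Sum>t\<in>F. c t * Y t \<omega>))"

definition coord :: "(real ^ 'n \<Rightarrow> 'w \<Rightarrow> real ^ 'd) \<Rightarrow> 'd \<Rightarrow> real ^ 'n \<Rightarrow> 'w \<Rightarrow> real" where
  "coord X i t \<omega> = X t \<omega> $ i"

text \<open>
  Independence and equality in law of the coordinates are those of whole processes, seen as
  random elements of the product space of real functions on the orthant.
\<close>

definition gaussian_field :: "'w measure \<Rightarrow> (real ^ 'n \<Rightarrow> 'w \<Rightarrow> real ^ 'd) \<Rightarrow> bool" where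
  "gaussian_field M X \<longleftrightarrow>
     (\<forall>i. gaussian_process M orthant (coord X i)) \<and>
     prob_space.indep_vars M (\<lambda>_. PiM orthant (\<lambda>_. borel))
       (\<lambda>i \<omega>. \<lambda>t\<in>orthant. coord X i t \<omega>) UNIV \<and>
     (\<forall>i j. distr M (PiM orthant (\<lambda>_. borel)) (\<lambda>\<omega>. \<lambda>t\<in>orthant. coord X i t \<omega>) =
            distr M (PiM orthant (\<lambda>_. borel)) (\<lambda>\<omega>. \<lambda>t\<in>orthant. coord X j t \<omega>))"

definition range_on :: "(real ^ 'n \<Rightarrow> 'w \<Rightarrow> real ^ 'd) \<Rightarrow> 'w \<Rightarrow> (real ^ 'n) set \<Rightarrow> (real ^ 'd) set" where
  "range_on X \<omega> A = {X t \<omega> | t. t \<in> A}"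

definition graph_on ::
  "(real ^ 'n \<Rightarrow> 'w \<Rightarrow> real ^ 'd) \<Rightarrow> 'w \<Rightarrow> (real ^ 'n) set \<Rightarrow> ((real ^ 'n) \<times> (real ^ 'd)) set" where
  "graph_on X \<omega> A = {(t, X t \<omega>) | t. t \<in> A}"

section \<open>Deterministic local exponents\<close>

definition incr_quotient ::
  "'w measure \<Rightarrow> (real ^ 'n \<Rightarrow> 'w \<Rightarrow> real) \<Rightarrow> real \<Rightarrow> real ^ 'n \<Rightarrow> real ^ 'n \<Rightarrow> ereal" where
  "incr_quotient M Y \<alpha> s t =
     ereal (prob_space.expectation M (\<lambda>\<omega>. \<bar>Y t \<omega> - Y s \<omega>\<bar>\<^sup>2) / norm (t - s) powr (2 * \<alpha>))"

definition ball_pairs :: "real ^ 'n \<Rightarrow> real \<Rightarrow> ((real ^ 'n) \<times> (real ^ 'n)) set" where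
  "ball_pairs t0 \<rho> = {(s, t). s \<in> ball t0 \<rho> \<inter> orthant \<and> t \<in> ball t0 \<rho> \<inter> orthant \<and> s \<noteq> t}"

text \<open>
  The limits below exist because the supremum and the infimum are monotone in \<open>\<rho>\<close>.
  For an empty set of exponents, the Hoelder exponent is \<open>0\<close> and the sub-exponent is \<open>\<infinity>\<close>;
  in \<^typ>\<open>ereal\<close> the former needs the explicit \<open>max\<close>, since \<open>Sup {} = -\<infinity>\<close>.
\<close>

definition local_holder_exponent ::
  "'w measure \<Rightarrow> (real ^ 'n \<Rightarrow> 'w \<Rightarrow> real) \<Rightarrow> real ^ 'n \<Rightarrow> ereal" where
  "local_holder_exponent M Y t0 =
     max 0 (Sup {ereal \<alpha> | \<alpha>. 0 < \<alpha> \<and>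
       Lim (at_right 0) (\<lambda>\<rho>. SUP (s, t) \<in> ball_pairs t0 \<rho>. incr_quotient M Y \<alpha> s t) < \<infinity>})"

definition local_sub_exponent ::
  "'w measure \<Rightarrow> (real ^ 'n \<Rightarrow> 'w \<Rightarrow> real) \<Rightarrow> real ^ 'n \<Rightarrow> ereal" where
  "local_sub_exponent M Y t0 =
     Inf {ereal \<alpha> | \<alpha>. 0 < \<alpha> \<and>
       Lim (at_right 0) (\<lambda>\<rho>. INF (s, t) \<in> ball_pairs t0 \<rho>. incr_quotient M Y \<alpha> s t) = \<infinity>}"

end

theory Submission imports Defs begin

text \<open>
  Upper bounds: chaining along the dyadic approximations of a point, together with a high Gaussian
  moment and the Borel--Cantelli lemma, shows that almost surely a dyadic cube of side \<open>2\<^sup>-\<^sup>n\<close> is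
  mapped into a ball of radius \<open>C 2\<^sup>-\<^sup>n\<^sup>a\<close>, for every \<open>a\<close> below the Hoelder exponent. The range and
  the graph are then covered by the images of the \<open>2\<^sup>n\<^sup>N\<close> cubes, or, for the second graph bound, by
  the cubes of side \<open>2\<^sup>-\<^sup>n\<close> that fill these balls.

  Lower bounds: a Gaussian variable \<open>Z\<close>, centred or not, satisfies
  \<open>P(\<bar>Z\<bar> \<le> r) \<le> 16 r / (E Z\<^sup>2)\<^sup>1\<^sup>/\<^sup>2\<close>, so by independence of the coordinates
  \<open>P(\<bar>X\<^sub>t - X\<^sub>s\<bar> \<le> r) \<le> (16 r / \<bar>t - s\<bar>\<^sup>a)\<^sup>d\<close> near a point whose sub-exponent is below \<open>a\<close>. Integrating
  over \<open>s\<close> bounds the expected occupation measure of balls of radius \<open>2\<^sup>-\<^sup>n\<close>, and the mass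
  distribution principle applies to the image of Lebesgue measure.
\<close>

section \<open>Hausdorff dimension\<close>

text \<open>The exponents in the theorem are infima over I of pointwise quantities, and the two
  sides use them differently. A lower bound needs one point: near some u whose sub-exponent is below
  a, a single small cell already has a large image, and dimension is monotone. An upper bound needs
  every point: I splits into countably many cells on which the Hoelder estimate holds, and null
  Hausdorff measure is countably stable. Each bound is first proved almost surely for a fixed
  exponent strictly inside the limit; rational exponents then leave a single null set. The cells are
  half-open because rounding a point down at a finer level then stays in its cell, even at the faces
  of the orthant, so a local estimate applies to all approximations of a point. Covering the graph
  compares 2^-n with 2^(-n a) and works for a \<le> 1. This is no restriction: a Hoelder exponent
  above 1 is infinite.\<close>

lemma hausdorff_content_mono:
  assumes "A \<subseteq> B" shows "hausdorff_content s \<delta> A \<le> hausdorff_content s \<delta> B"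
  unfolding hausdorff_content_def by (rule INF_superset_mono) (use assms in auto)

lemma hausdorff_measure_mono:
  assumes "A \<subseteq> B" shows "hausdorff_measure s A \<le> hausdorff_measure s B"
  unfolding hausdorff_measure_def by (rule SUP_mono') (rule hausdorff_content_mono[OF assms])

lemma hausdorff_dim_mono:
  assumes "A \<subseteq> B" shows "hausdorff_dim A \<le> hausdorff_dim B"
proof -
  have "hausdorff_measure s A = 0" if "hausdorff_measure s B = 0" for s
    using hausdorff_measure_mono[OF assms, of s] that by simp
  then show ?thesis unfolding hausdorff_dim_def by (intro Inf_superset_mono) auto
qed

lemma hausdorff_dim_nonneg: "0 \<le> hausdorff_dim A"
  unfolding hausdorff_dim_def by (rule Inf_greatest) auto

lemma hausdorff_dim_le:
  assumes "0 \<le> s" "\<And>s'. s < s' \<Longrightarrow> hausdorff_measure s' A = 0"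
  shows "hausdorff_dim A \<le> ereal s"
proof (rule ereal_le_epsilon2)
  fix e :: real assume "0 < e"
  then have "hausdorff_dim A \<le> ereal (s + e)"
    unfolding hausdorff_dim_def using assms by (intro Inf_lower) auto
  then show "hausdorff_dim A \<le> ereal s + ereal e" by simp
qed

text \<open>\<open>hausdorff_dim\<close> only asks for which exponents the measure vanishes, so the
  proof works with null covers and never with the value of a Hausdorff measure.\<close>

lemma hausdorff_measure_zeroI:
  assumes "\<And>\<delta> e. 0 < \<delta> \<Longrightarrow> 0 < e \<Longrightarrow> \<exists>U :: nat \<Rightarrow> 'a::metric_space set. A \<subseteq> (\<Union>k. U k) \<and>
      (\<forall>k. bounded (U k) \<and> diameter (U k) \<le> \<delta>) \<and> (\<Sum>k. ennreal (diameter (U k) powr s)) \<le> ennreal e"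
  shows "hausdorff_measure s A = 0"
proof -
  have "hausdorff_content s \<delta> A \<le> 0" if d: "0 < \<delta>" for \<delta> :: real
  proof (rule ennreal_le_epsilon)
    fix e :: real assume "0 < e"
    obtain U :: "nat \<Rightarrow> 'a set" where U: "A \<subseteq> (\<Union>k. U k)" "\<forall>k. bounded (U k) \<and> diameter (U k) \<le> \<delta>"
      "(\<Sum>k. ennreal (diameter (U k) powr s)) \<le> ennreal e" using assms[OF d \<open>0 < e\<close>] by blast
    have "hausdorff_content s \<delta> A \<le> (\<Sum>k. ennreal (diameter (U k) powr s))"
      unfolding hausdorff_content_def by (rule INF_lower) (use U in auto)
    then show "hausdorff_content s \<delta> A \<le> 0 + ennreal e" using U(3) by simp
  qed
  then show ?thesis unfolding hausdorff_measure_def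
    by (intro antisym SUP_least) auto
qed

lemma hausdorff_measure_zeroD:
  assumes "hausdorff_measure s A = 0" "0 < \<delta>" "0 < e"
  shows "\<exists>U :: nat \<Rightarrow> 'a::metric_space set. A \<subseteq> (\<Union>k. U k) \<and>
      (\<forall>k. bounded (U k) \<and> diameter (U k) \<le> \<delta>) \<and> (\<Sum>k. ennreal (diameter (U k) powr s)) \<le> ennreal e"
proof -
  have "hausdorff_content s \<delta> A \<le> hausdorff_measure s A"
    unfolding hausdorff_measure_def using assms(2) by (intro SUP_upper) auto
  then have "hausdorff_content s \<delta> A < ennreal e" using assms by simp
  from this[unfolded hausdorff_content_def INF_less_iff] obtain U :: "nat \<Rightarrow> 'a set" where
    "U \<in> {U. A \<subseteq> (\<Union>k. U k) \<and> (\<forall>k. bounded (U k) \<and> diameter (U k) \<le> \<delta>)}"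
    "(\<Sum>k. ennreal (diameter (U k) powr s)) < ennreal e" by (rule bexE)
  then show ?thesis by (intro exI[of _ U]) (auto intro: less_imp_le)
qed

text \<open>Countable stability: the k-th set is covered at cost e / 2^(k+1), and the pairing
  function merges these covers into one sequence.\<close>

lemma hausdorff_measure_UN_zero:
  fixes A :: "nat \<Rightarrow> 'a::metric_space set"
  assumes "\<And>k. hausdorff_measure s (A k) = 0"
  shows "hausdorff_measure s (\<Union>k. A k) = 0"
proof (rule hausdorff_measure_zeroI)
  fix \<delta> e :: real assume pos: "0 < \<delta>" "0 < e"
  have "\<exists>U :: nat \<Rightarrow> 'a set. A k \<subseteq> (\<Union>j. U j) \<and> (\<forall>j. bounded (U j) \<and> diameter (U j) \<le> \<delta>) \<and>
      (\<Sum>j. ennreal (diameter (U j) powr s)) \<le> ennreal (e * (1/2)^Suc k)" for k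
    by (rule hausdorff_measure_zeroD[OF assms]) (use pos in auto)
  then have "\<forall>k. \<exists>U :: nat \<Rightarrow> 'a set. A k \<subseteq> (\<Union>j. U j) \<and> (\<forall>j. bounded (U j) \<and> diameter (U j) \<le> \<delta>) \<and>
      (\<Sum>j. ennreal (diameter (U j) powr s)) \<le> ennreal (e * (1/2)^Suc k)" ..
  from choice[OF this] obtain U :: "nat \<Rightarrow> nat \<Rightarrow> 'a set" where U: "\<And>k. A k \<subseteq> (\<Union>j. U k j)"
      "\<And>k j. bounded (U k j) \<and> diameter (U k j) \<le> \<delta>"
      "\<And>k. (\<Sum>j. ennreal (diameter (U k j) powr s)) \<le> ennreal (e * (1/2)^Suc k)" by blast
  define V where "V p = case_prod U (prod_decode p)" for p
  have "(\<Sum>p. ennreal (diameter (V p) powr s)) = (\<Sum>k. \<Sum>j. ennreal (diameter (U k j) powr s))"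
  proof -
    have "(\<Sum>p. (case prod_decode p of (k, j) \<Rightarrow> ennreal (diameter (U k j) powr s)))
        = (\<Sum>k. \<Sum>j. ennreal (diameter (U k j) powr s))"
      by (rule suminf_ennreal_2dimen) (simp only: prod.case)
    moreover have "ennreal (diameter (V p) powr s)
        = (case prod_decode p of (k, j) \<Rightarrow> ennreal (diameter (U k j) powr s))" for p
      by (simp only: V_def split_beta)
    ultimately show ?thesis by (simp only:)
  qed
  also have "\<dots> \<le> (\<Sum>k. ennreal (e * (1/2)^Suc k))" by (intro suminf_le U) auto
  also have "\<dots> = ennreal e"
    using sums_mult[OF power_half_series, of e] pos by (intro suminf_ennreal_eq) auto
  finally have sum: "(\<Sum>p. ennreal (diameter (V p) powr s)) \<le> ennreal e" .
  have "(\<Union>k. A k) \<subseteq> (\<Union>p. V p)"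
  proof
    fix x assume "x \<in> (\<Union>k. A k)"
    then obtain k j where "x \<in> U k j" using U(1) by blast
    then have "x \<in> V (prod_encode (k, j))" by (simp add: V_def)
    then show "x \<in> (\<Union>p. V p)" by blast
  qed
  moreover have "\<forall>p. bounded (V p) \<and> diameter (V p) \<le> \<delta>" using U(2) by (auto simp: V_def split: prod.split)
  ultimately show "\<exists>U :: nat \<Rightarrow> 'a set. (\<Union>k. A k) \<subseteq> (\<Union>k. U k) \<and>
      (\<forall>k. bounded (U k) \<and> diameter (U k) \<le> \<delta>) \<and> (\<Sum>k. ennreal (diameter (U k) powr s)) \<le> ennreal e"
    using sum by blast
qed

lemma hausdorff_measure_countable_UN_zero:
  assumes "countable J" "\<And>j. j \<in> J \<Longrightarrow> hausdorff_measure s (A j) = 0"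
  shows "hausdorff_measure s (\<Union>j\<in>J. A j) = 0"
proof (cases "J = {}")
  case True
  have "\<exists>U :: nat \<Rightarrow> 'b set. {} \<subseteq> (\<Union>k. U k) \<and>
      (\<forall>k. bounded (U k) \<and> diameter (U k) \<le> \<delta>) \<and> (\<Sum>k. ennreal (diameter (U k) powr s)) \<le> ennreal e"
    if "0 < \<delta>" for \<delta> e :: real using that by (intro exI[of _ "\<lambda>_. {}"]) auto
  then show ?thesis using True by (auto intro!: hausdorff_measure_zeroI)
next
  case False
  then have "(\<Union>j\<in>J. A j) = (\<Union>k. A (from_nat_into J k))"
    using range_from_nat_into[OF False assms(1)] by (metis (no_types) image_image)
  then show ?thesis using hausdorff_measure_UN_zero[of s "\<lambda>k. A (from_nat_into J k)"] assms False
    by (simp add: from_nat_into)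
qed

lemma hausdorff_measure_finite_covers_zero:
  fixes A :: "'a::metric_space set" and F :: "nat \<Rightarrow> 'a set set"
  assumes "0 < s" and D: "D \<longlonglongrightarrow> 0" and lim: "(\<lambda>n. real (card (F n)) * D n powr s) \<longlonglongrightarrow> 0"
    and cov: "\<And>n. n \<ge> n0 \<Longrightarrow> finite (F n) \<and> A \<subseteq> \<Union>(F n) \<and> (\<forall>U\<in>F n. bounded U \<and> diameter U \<le> D n)"
  shows "hausdorff_measure s A = 0"
proof (rule hausdorff_measure_zeroI)
  fix \<delta> e :: real assume pos: "0 < \<delta>" "0 < e"
  have "\<forall>\<^sub>F n in sequentially. n \<ge> n0 \<and> D n < \<delta> \<and> real (card (F n)) * D n powr s < e"
    using pos by (intro eventually_conj eventually_ge_at_top order_tendstoD[OF D] order_tendstoD[OF lim])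
  then obtain n where n: "n \<ge> n0" "D n < \<delta>" "real (card (F n)) * D n powr s < e"
    by (auto simp: eventually_sequentially)
  obtain h where h: "bij_betw h {..<card (F n)} (F n)"
    using cov[OF n(1)] ex_bij_betw_nat_finite by (metis atLeast0LessThan)
  \<comment> \<open>A cover in \<open>hausdorff_content\<close> is an infinite sequence. Padding
    with the empty set is free: its diameter is 0 and \<open>0 powr s = 0\<close>.\<close>
  define U where "U k = (if k < card (F n) then h k else {})" for k
  have hF: "h k \<in> F n" if "k < card (F n)" for k using h that by (auto simp: bij_betw_def)
  have "A \<subseteq> (\<Union>k. U k)"
  proof
    fix x assume "x \<in> A"
    then obtain B where "B \<in> F n" "x \<in> B" using cov[OF n(1)] by blast
    then obtain k where "k < card (F n)" "x \<in> h k" using h by (auto simp: bij_betw_def)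
    then show "x \<in> (\<Union>k. U k)" by (auto simp: U_def intro!: exI[of _ k])
  qed
  moreover have "\<forall>k. bounded (U k) \<and> diameter (U k) \<le> \<delta>"
    using cov[OF n(1)] n(2) hF pos by (fastforce simp: U_def)
  moreover have "(\<Sum>k. ennreal (diameter (U k) powr s)) \<le> ennreal e"
  proof -
    have "(\<Sum>k. ennreal (diameter (U k) powr s)) = (\<Sum>k<card (F n). ennreal (diameter (U k) powr s))"
      using \<open>0 < s\<close> by (intro suminf_finite) (auto simp: U_def)
    also have "\<dots> \<le> (\<Sum>k<card (F n). ennreal (D n powr s))"
      using cov[OF n(1)] hF \<open>0 < s\<close>
      by (intro sum_mono ennreal_leI powr_mono2) (auto simp: U_def diameter_ge_0)
    also have "\<dots> = ennreal (real (card (F n)) * D n powr s)"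
      by (simp add: ennreal_mult ennreal_of_nat_eq_real_of_nat)
    also have "\<dots> \<le> ennreal e" using n(3) by (intro ennreal_leI) auto
    finally show ?thesis .
  qed
  ultimately show "\<exists>U :: nat \<Rightarrow> 'a set. A \<subseteq> (\<Union>k. U k) \<and>
      (\<forall>k. bounded (U k) \<and> diameter (U k) \<le> \<delta>) \<and> (\<Sum>k. ennreal (diameter (U k) powr s)) \<le> ennreal e"
    by (intro exI[of _ U]) auto
qed

lemma diameter_le_metric:
  fixes S :: "'a::metric_space set"
  assumes "0 \<le> c" "\<And>x y. x \<in> S \<Longrightarrow> y \<in> S \<Longrightarrow> dist x y \<le> c"
  shows "bounded S" "diameter S \<le> c"
proof -
  show "bounded S" using assms(2) unfolding bounded_two_points by blast
  show "diameter S \<le> c"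
  proof (cases "S = {}")
    case False
    then show ?thesis unfolding diameter_def using assms by (auto intro!: cSUP_least)
  qed (use assms in simp)
qed

text \<open>Box counting: at scale n the cover costs at most K c^s 2^(n (a - s b)), a null sequence
  as soon as a < s b. The covers built below are all used through this lemma, with a the growth rate
  of the number of pieces and b the decay rate of their size.\<close>

lemma exponential_covers_null:
  fixes A :: "'a::metric_space set"
  assumes "0 < s" "0 < b" "a < s * b" "0 \<le> c" "0 \<le> K"
    and cov: "\<And>n. n \<ge> nmin \<Longrightarrow> \<exists>F. finite F \<and> real (card F) \<le> K * 2 powr (real n * a) \<and> A \<subseteq> \<Union>F \<and>
      (\<forall>U\<in>F. \<forall>x\<in>U. \<forall>y\<in>U. dist x y \<le> c * 2 powr (- (real n * b)))"
  shows "hausdorff_measure s A = 0"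
proof -
  define F where "F n = (SOME F. finite F \<and> real (card F) \<le> K * 2 powr (real n * a) \<and> A \<subseteq> \<Union>F \<and>
      (\<forall>U\<in>F. \<forall>x\<in>U. \<forall>y\<in>U. dist x y \<le> c * 2 powr (- (real n * b))))" for n
  have F: "finite (F n)" "real (card (F n)) \<le> K * 2 powr (real n * a)" "A \<subseteq> \<Union>(F n)"
      "\<And>U x y. U \<in> F n \<Longrightarrow> x \<in> U \<Longrightarrow> y \<in> U \<Longrightarrow> dist x y \<le> c * 2 powr (- (real n * b))" if "n \<ge> nmin" for n
    using someI_ex[OF cov[OF that]] unfolding F_def[symmetric] by auto
  define D where "D n = c * 2 powr (- (real n * b))" for n :: nat
  have pw: "2 powr (real n * e) = (2 powr e) ^ n" for n :: nat and e :: real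
    by (simp add: powr_realpow[symmetric] powr_powr mult.commute)
  have small: "2 powr e < (1::real)" if "e < 0" for e using powr_less_mono[of e 0 "2::real"] that by simp
  show ?thesis
  proof (rule hausdorff_measure_finite_covers_zero[OF \<open>0 < s\<close>])
    have "(\<lambda>n. c * (2 powr (- b)) ^ n) \<longlonglongrightarrow> c * 0"
      using small[of "- b"] \<open>0 < b\<close> by (intro tendsto_mult tendsto_const LIMSEQ_realpow_zero) auto
    then show "D \<longlonglongrightarrow> 0" unfolding D_def using pw[of _ "- b"] by simp
    define e where "e = a - s * b"
    have "(\<lambda>n. K * c powr s * (2 powr e) ^ n) \<longlonglongrightarrow> K * c powr s * 0"
      using small[of e] assms(3) by (intro tendsto_mult tendsto_const LIMSEQ_realpow_zero) (auto simp: e_def)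
    then have lim: "(\<lambda>n. K * c powr s * (2 powr e) ^ n) \<longlonglongrightarrow> 0" by simp
    show "(\<lambda>n. real (card (F n)) * D n powr s) \<longlonglongrightarrow> 0"
    proof (rule tendsto_sandwich[OF _ _ tendsto_const lim])
      show "\<forall>\<^sub>F n in sequentially. real (card (F n)) * D n powr s \<le> K * c powr s * (2 powr e) ^ n"
        using eventually_ge_at_top[of nmin]
      proof eventually_elim
        case (elim n)
        have D: "D n powr s = c powr s * 2 powr (- (real n * b) * s)"
          unfolding D_def using \<open>0 \<le> c\<close> by (simp add: powr_mult powr_powr)
        have e: "2 powr (real n * a) * 2 powr (- (real n * b) * s) = 2 powr (real n * e)"
          unfolding e_def by (simp add: powr_add[symmetric] algebra_simps)
        have "real (card (F n)) * D n powr s \<le> K * 2 powr (real n * a) * D n powr s"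
          using F(2)[OF elim] by (rule mult_right_mono) simp
        also have "\<dots> = K * c powr s * (2 powr (real n * a) * 2 powr (- (real n * b) * s))"
          unfolding D by simp
        also have "\<dots> = K * c powr s * (2 powr e) ^ n" unfolding e by (simp only: pw[of n e])
        finally show ?case .
      qed
    qed auto
    fix n assume n: "nmin \<le> n"
    have "0 \<le> D n" using \<open>0 \<le> c\<close> by (simp add: D_def)
    have "bounded U \<and> diameter U \<le> D n" if "U \<in> F n" for U
      using diameter_le_metric[OF \<open>0 \<le> D n\<close>, of U] F(4)[OF n that] by (auto simp: D_def)
    then show "finite (F n) \<and> A \<subseteq> \<Union>(F n) \<and> (\<forall>U\<in>F n. bounded U \<and> diameter U \<le> D n)"
      using F(1,3)[OF n] by blast
  qed
qed

text \<open>Meant for the projection of the graph onto the range, through which the graph inherits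
  lower bounds of the range.\<close>

lemma hausdorff_dim_image_le:
  fixes f :: "'a::metric_space \<Rightarrow> 'b::metric_space"
  assumes "\<And>x y. dist (f x) (f y) \<le> dist x y"
  shows "hausdorff_dim (f ` A) \<le> hausdorff_dim A"
proof -
  have "hausdorff_measure s (f ` A) = 0" if s: "0 < s" "hausdorff_measure s A = 0" for s
  proof (rule hausdorff_measure_zeroI)
    fix \<delta> e :: real assume "0 < \<delta>" "0 < e"
    obtain U :: "nat \<Rightarrow> 'a set" where U: "A \<subseteq> (\<Union>k. U k)" "\<forall>k. bounded (U k) \<and> diameter (U k) \<le> \<delta>"
      "(\<Sum>k. ennreal (diameter (U k) powr s)) \<le> ennreal e"
      using hausdorff_measure_zeroD[OF s(2) \<open>0 < \<delta>\<close> \<open>0 < e\<close>] by (elim exE conjE)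
    have V: "bounded (f ` U k)" "diameter (f ` U k) \<le> diameter (U k)" for k
    proof -
      have dist: "dist u v \<le> diameter (U k)" if "u \<in> f ` U k" "v \<in> f ` U k" for u v
      proof -
        obtain x y where "x \<in> U k" "y \<in> U k" "u = f x" "v = f y" using \<open>u \<in> f ` U k\<close> \<open>v \<in> f ` U k\<close> by auto
        then show ?thesis using assms[of x y] diameter_bounded_bound[of "U k" x y] U(2) by auto
      qed
      have "0 \<le> diameter (U k)" using U(2) by (simp add: diameter_ge_0)
      from diameter_le_metric[OF this dist] show "bounded (f ` U k)" "diameter (f ` U k) \<le> diameter (U k)" by blast+
    qed
    have "(\<Sum>k. ennreal (diameter (f ` U k) powr s)) \<le> (\<Sum>k. ennreal (diameter (U k) powr s))"
      using s(1) V by (intro suminf_le summableI ennreal_leI powr_mono2 diameter_ge_0) auto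
    moreover have "\<forall>k. bounded (f ` U k) \<and> diameter (f ` U k) \<le> \<delta>" using V U(2) order_trans by blast
    moreover have "f ` A \<subseteq> (\<Union>k. f ` U k)" using U(1) by blast
    ultimately show "\<exists>U :: nat \<Rightarrow> 'b set. f ` A \<subseteq> (\<Union>k. U k) \<and>
      (\<forall>k. bounded (U k) \<and> diameter (U k) \<le> \<delta>) \<and> (\<Sum>k. ennreal (diameter (U k) powr s)) \<le> ennreal e"
      using U(3) by (intro exI[of _ "\<lambda>k. f ` U k"]) auto
  qed
  then show ?thesis unfolding hausdorff_dim_def by (intro Inf_superset_mono) auto
qed

section \<open>Mass distribution principle\<close>

lemma dyadic_scale:
  fixes x :: real assumes "0 < x" "x \<le> 1"
  obtains n :: nat where "x \<le> (1/2)^n" "(1/2)^n < 2 * x"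
proof -
  define n where "n = (LEAST n. (1/2)^n < 2 * x)"
  have "\<exists>n. (1/2)^n < 2 * x" using real_arch_pow_inv[of "2*x" "1/2"] assms by auto
  then have 1: "(1/2)^n < 2 * x" unfolding n_def by (rule LeastI_ex)
  have "x \<le> (1/2)^n"
  proof (cases n)
    case 0 then show ?thesis using assms by simp
  next
    case (Suc m)
    then have "\<not> (1/2)^m < 2 * x" using not_less_Least[of m "\<lambda>n. (1/2)^n < 2 * x"] unfolding n_def by simp
    then show ?thesis using Suc by simp
  qed
  then show ?thesis using 1 that by blast
qed

lemma mass_distribution_principle:
  fixes f :: "'t \<Rightarrow> 'a::metric_space" and L :: "'t measure" and K g :: real
  assumes A: "A \<in> sets L" "emeasure L A > 0" and K: "0 < K"
    and sets: "\<And>t n. t \<in> A \<Longrightarrow> {u\<in>A. dist (f t) (f u) \<le> (1/2)^n} \<in> sets L"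
    and mass: "\<And>t n. t \<in> A \<Longrightarrow> emeasure L {u\<in>A. dist (f t) (f u) \<le> (1/2)^n} \<le> ennreal (K * ((1/2)^n) powr g)"
    and sub: "f ` A \<subseteq> S" and "0 < g"
  shows "ereal g \<le> hausdorff_dim S"
  unfolding hausdorff_dim_def
proof (rule Inf_greatest, safe)
  fix s :: real assume s: "0 < s" "hausdorff_measure s S = 0"
  show "ereal g \<le> ereal s"
  proof (rule ccontr)
    assume "\<not> ereal g \<le> ereal s"
    then have "s < g" by simp
    have bnd: "emeasure L A \<le> ennreal e" if "0 < e" for e :: real
    proof -
      \<comment> \<open>Chosen so that K 2^g e' = e; the factor 2^g pays for rounding a diameter up
        to a power of 1/2.\<close>
      define e' where "e' = e / (K * 2 powr g)"
      have e': "0 < e'" using that K by (simp add: e'_def)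
      obtain U :: "nat \<Rightarrow> 'a set" where U: "S \<subseteq> (\<Union>k. U k)" "\<And>k. bounded (U k)" "\<And>k. diameter (U k) \<le> 1"
        "(\<Sum>k. ennreal (diameter (U k) powr s)) \<le> ennreal e'"
        using hausdorff_measure_zeroD[OF s(2) zero_less_one e'] by auto
      \<comment> \<open>The preimage of \<open>U k\<close> may fail to be measurable, so it is
        enclosed in a measurable B.\<close>
      have "\<exists>B\<in>sets L. {t\<in>A. f t \<in> U k} \<subseteq> B \<and> emeasure L B \<le> ennreal (K * 2 powr g) * ennreal (diameter (U k) powr s)" for k
      proof (cases "\<exists>t\<in>A. f t \<in> U k")
        case False
        then show ?thesis by (intro bexI[of _ "{}"]) auto
      next
        case True
        then obtain t where t: "t \<in> A" "f t \<in> U k" by auto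
        have near: "dist (f t) (f u) \<le> diameter (U k)" if "f u \<in> U k" for u
          by (rule diameter_bounded_bound) (use U t that in auto)
        show ?thesis
        proof (cases "diameter (U k) = 0")
          \<comment> \<open>A set of diameter 0 cannot be rounded up to a comparable radius. The
            mass bounds at all scales force mass 0 instead, in agreement with
            \<open>0 powr s = 0\<close>.\<close>
          case True
          let ?C = "\<Inter>n. {u\<in>A. dist (f t) (f u) \<le> (1/2)^n}"
          have C: "?C \<in> sets L" using sets[OF t(1)] by (intro sets.countable_INT) auto
          have "emeasure L ?C \<le> 0"
          proof (rule tendsto_lowerbound)
            have "(1/2::real) powr g < 1 powr g" using \<open>0 < g\<close> by (intro powr_less_mono2) auto
            then have "(\<lambda>n. K * ((1/2) powr g) ^ n) \<longlonglongrightarrow> K * 0"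
              by (intro tendsto_mult tendsto_const LIMSEQ_realpow_zero) auto
            moreover have "((1/2::real)^n) powr g = ((1/2) powr g) ^ n" for n
            proof -
              have "((1/2::real)^n) powr g = ((1/2) powr real n) powr g" by (subst powr_realpow) auto
              also have "\<dots> = ((1/2) powr g) powr real n" by (simp only: powr_powr mult.commute)
              also have "\<dots> = ((1/2) powr g) ^ n" by (subst powr_realpow) auto
              finally show ?thesis .
            qed
            ultimately show "(\<lambda>n. ennreal (K * ((1/2)^n) powr g)) \<longlonglongrightarrow> 0"
              using tendsto_ennrealI[of "\<lambda>n. K * ((1/2)^n) powr g" 0] by simp
            show "\<forall>\<^sub>F n in sequentially. emeasure L ?C \<le> ennreal (K * ((1/2)^n) powr g)"
              using emeasure_mono[OF _ sets[OF t(1)]] mass[OF t(1)]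
              by (intro always_eventually allI) (meson INF_lower UNIV_I order_trans)
          qed simp
          moreover have "{t\<in>A. f t \<in> U k} \<subseteq> ?C" using near True by auto
          ultimately show ?thesis using C by (intro bexI[of _ ?C]) auto
        next
          case False
          then have pos: "0 < diameter (U k)" using diameter_ge_0[OF U(2), of k] by simp
          obtain n where n: "diameter (U k) \<le> (1/2)^n" "(1/2)^n < 2 * diameter (U k)"
            using dyadic_scale[OF pos U(3)] by blast
          let ?B = "{u\<in>A. dist (f t) (f u) \<le> (1/2)^n}"
          have "{t\<in>A. f t \<in> U k} \<subseteq> ?B" using near n(1) by fastforce
          moreover have "((1/2)^n) powr g \<le> (2 * diameter (U k)) powr g"
            using n \<open>0 < g\<close> by (intro powr_mono2) auto
          \<comment> \<open>A diameter of at most 1 lets the exponent g be replaced by the smaller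
            s; this is why the covers were taken with \<delta> = 1.\<close>
          moreover have "(2 * diameter (U k)) powr g \<le> 2 powr g * diameter (U k) powr s"
            using pos U(3) \<open>s < g\<close> by (simp add: powr_mult powr_mono')
          ultimately have "K * ((1/2)^n) powr g \<le> (K * 2 powr g) * diameter (U k) powr s"
            using K by (simp add: mult.assoc)
          then have "emeasure L ?B \<le> ennreal ((K * 2 powr g) * diameter (U k) powr s)"
            using mass[OF t(1), of n] by (meson ennreal_leI order_trans)
          then show ?thesis using \<open>{t\<in>A. f t \<in> U k} \<subseteq> ?B\<close> sets[OF t(1)] K
            by (intro bexI[of _ ?B]) (auto simp: ennreal_mult)
        qed
      qed
      then obtain B where B: "\<And>k. B k \<in> sets L" "\<And>k. {t\<in>A. f t \<in> U k} \<subseteq> B k"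
        "\<And>k. emeasure L (B k) \<le> ennreal (K * 2 powr g) * ennreal (diameter (U k) powr s)" by metis
      have "A \<subseteq> (\<Union>k. B k)"
      proof
        fix t assume "t \<in> A"
        then obtain k where "f t \<in> U k" using sub U(1) by blast
        then show "t \<in> (\<Union>k. B k)" using B(2)[of k] \<open>t \<in> A\<close> by auto
      qed
      then have "emeasure L A \<le> emeasure L (\<Union>k. B k)" using B by (intro emeasure_mono) auto
      also have "\<dots> \<le> (\<Sum>k. emeasure L (B k))" using B by (intro emeasure_subadditive_countably) auto
      also have "\<dots> \<le> (\<Sum>k. ennreal (K * 2 powr g) * ennreal (diameter (U k) powr s))" by (intro suminf_le B) auto
      also have "\<dots> = ennreal (K * 2 powr g) * (\<Sum>k. ennreal (diameter (U k) powr s))" by simp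
      also have "\<dots> \<le> ennreal (K * 2 powr g) * ennreal e'" by (intro mult_left_mono U) auto
      also have "\<dots> = ennreal e" using K that e' by (simp add: ennreal_mult[symmetric] e'_def)
      finally show ?thesis .
    qed
    have "emeasure L A \<le> 0" by (rule ennreal_le_epsilon) (use bnd in auto)
    with A(2) show False by simp
  qed
qed

section \<open>Gaussian random variables\<close>

lemma normal_density_le:
  assumes "0 < \<sigma>"
  shows "normal_density \<mu> \<sigma> x \<le> exp (- (x - \<mu>)\<^sup>2 / (2 * \<sigma>\<^sup>2)) / \<sigma>"
proof -
  have "\<sigma> = sqrt (\<sigma>\<^sup>2)" using assms by simp
  also have "\<dots> \<le> sqrt (2 * pi * \<sigma>\<^sup>2)"
  proof (rule real_sqrt_le_mono)
    have "1 * \<sigma>\<^sup>2 \<le> (2 * pi) * \<sigma>\<^sup>2" using pi_ge_two by (intro mult_right_mono) auto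
    then show "\<sigma>\<^sup>2 \<le> 2 * pi * \<sigma>\<^sup>2" by simp
  qed
  finally have "1 / sqrt (2 * pi * \<sigma>\<^sup>2) \<le> 1 / \<sigma>" using assms by (intro divide_left_mono) auto
  then have "1 / sqrt (2 * pi * \<sigma>\<^sup>2) * exp (- (x - \<mu>)\<^sup>2 / (2 * \<sigma>\<^sup>2)) \<le> 1 / \<sigma> * exp (- (x - \<mu>)\<^sup>2 / (2 * \<sigma>\<^sup>2))"
    by (intro mult_right_mono) auto
  then show ?thesis by (simp add: normal_density_def)
qed

context prob_space begin

lemma normal_second_moment:
  assumes Z: "distributed M lborel Z (\<lambda>x. ennreal (normal_density \<mu> \<sigma> x))" and "0 < \<sigma>"
  shows "integrable M (\<lambda>\<omega>. (Z \<omega>)\<^sup>2)" "expectation (\<lambda>\<omega>. (Z \<omega>)\<^sup>2) = \<mu>\<^sup>2 + \<sigma>\<^sup>2"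
proof -
  \<comment> \<open>x^2 is expanded about the mean, where the normal moments are explicit; the
    linear term contributes an odd moment, which is 0.\<close>
  have "has_bochner_integral lborel (\<lambda>x. normal_density \<mu> \<sigma> x * (x - \<mu>) ^ (2 * 1) +
      (2 * \<mu>) * (normal_density \<mu> \<sigma> x * (x - \<mu>) ^ (2 * 0 + 1)) +
      \<mu>\<^sup>2 * (normal_density \<mu> \<sigma> x * (x - \<mu>) ^ (2 * 0)))
      (fact (2 * 1) / ((2 / \<sigma>\<^sup>2) ^ 1 * fact 1) + (2 * \<mu>) * 0 + \<mu>\<^sup>2 * (fact (2 * 0) / ((2 / \<sigma>\<^sup>2) ^ 0 * fact 0)))"
    using \<open>0 < \<sigma>\<close>
    by (intro has_bochner_integral_add has_bochner_integral_mult_right normal_moment_even normal_moment_odd)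
  moreover have "(\<lambda>x. normal_density \<mu> \<sigma> x * (x - \<mu>) ^ (2 * 1) +
      (2 * \<mu>) * (normal_density \<mu> \<sigma> x * (x - \<mu>) ^ (2 * 0 + 1)) +
      \<mu>\<^sup>2 * (normal_density \<mu> \<sigma> x * (x - \<mu>) ^ (2 * 0))) = (\<lambda>x. normal_density \<mu> \<sigma> x * x\<^sup>2)"
    by (simp add: fun_eq_iff power2_eq_square algebra_simps)
  moreover have "fact (2 * 1) / ((2 / \<sigma>\<^sup>2) ^ 1 * fact 1) + (2 * \<mu>) * 0 + \<mu>\<^sup>2 * (fact (2 * 0) / ((2 / \<sigma>\<^sup>2) ^ 0 * fact 0))
     = \<mu>\<^sup>2 + \<sigma>\<^sup>2" by simp
  ultimately have bi: "has_bochner_integral lborel (\<lambda>x. normal_density \<mu> \<sigma> x * x\<^sup>2) (\<mu>\<^sup>2 + \<sigma>\<^sup>2)"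
    by (simp only:)
  show "integrable M (\<lambda>\<omega>. (Z \<omega>)\<^sup>2)"
    using distributed_integrable[OF Z, of "\<lambda>x. x\<^sup>2"] bi by (simp add: has_bochner_integral_iff)
  show "expectation (\<lambda>\<omega>. (Z \<omega>)\<^sup>2) = \<mu>\<^sup>2 + \<sigma>\<^sup>2"
    using distributed_integral[OF Z, of "\<lambda>x. x\<^sup>2"] bi by (simp add: has_bochner_integral_iff)
qed

lemma gaussian_rv_square_integrable:
  assumes "gaussian_rv M Z" shows "integrable M (\<lambda>\<omega>. (Z \<omega>)\<^sup>2)"
proof -
  have [measurable]: "Z \<in> borel_measurable M" using assms by (simp add: gaussian_rv_def)
  consider \<mu> where "AE \<omega> in M. Z \<omega> = \<mu>"
    | \<mu> \<sigma> where "0 < \<sigma>" "distributed M lborel Z (\<lambda>x. ennreal (normal_density \<mu> \<sigma> x))"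
    using assms by (auto simp: gaussian_rv_def)
  then show ?thesis
  proof cases
    case 1
    have "integrable M (\<lambda>\<omega>. (Z \<omega>)\<^sup>2) \<longleftrightarrow> integrable M (\<lambda>\<omega>. \<mu>\<^sup>2)"
      by (rule integrable_cong_AE) (use 1 in auto)
    then show ?thesis by simp
  next
    case 2
    then show ?thesis using normal_second_moment(1)[OF 2(2) 2(1)] by simp
  qed
qed

lemma AE_const_second_moment:
  fixes Z :: "'a \<Rightarrow> real"
  assumes "Z \<in> borel_measurable M" and "AE \<omega> in M. Z \<omega> = \<mu>"
  shows "expectation (\<lambda>\<omega>. (Z \<omega>)\<^sup>2) = \<mu>\<^sup>2"
proof -
  have "expectation (\<lambda>\<omega>. (Z \<omega>)\<^sup>2) = expectation (\<lambda>\<omega>. \<mu>\<^sup>2)"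
  proof (rule integral_cong_AE)
    show "AE \<omega> in M. (Z \<omega>)\<^sup>2 = \<mu>\<^sup>2" using assms(2) by auto
    show "(\<lambda>\<omega>. (Z \<omega>)\<^sup>2) \<in> borel_measurable M" using assms(1) by (rule borel_measurable_power)
  qed simp
  also have "\<dots> = \<mu>\<^sup>2" by (simp add: prob_space)
  finally show ?thesis .
qed

lemma normal_prob_le:
  assumes Z: "distributed M lborel Z (\<lambda>x. ennreal (normal_density \<mu> \<sigma> x))" and "0 \<le> r" "0 \<le> D"
    and D: "\<And>x. \<bar>x\<bar> \<le> r \<Longrightarrow> normal_density \<mu> \<sigma> x \<le> D"
  shows "prob {\<omega>\<in>space M. \<bar>Z \<omega>\<bar> \<le> r} \<le> 2 * r * D"
proof -
  have "{\<omega>\<in>space M. \<bar>Z \<omega>\<bar> \<le> r} = Z -` {-r..r} \<inter> space M" by auto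
  then have "emeasure M {\<omega>\<in>space M. \<bar>Z \<omega>\<bar> \<le> r} = (\<integral>\<^sup>+x. ennreal (normal_density \<mu> \<sigma> x) * indicator {-r..r} x \<partial>lborel)"
    using distributed_emeasure[OF Z, of "{-r..r}"] by simp
  also have "\<dots> \<le> (\<integral>\<^sup>+x. ennreal D * indicator {-r..r} x \<partial>lborel)"
    by (intro nn_integral_mono) (auto split: split_indicator intro!: ennreal_leI D)
  also have "\<dots> = ennreal D * ennreal (2 * r)" using \<open>0 \<le> r\<close> by (simp add: nn_integral_cmult_indicator)
  also have "\<dots> = ennreal (2 * r * D)" using assms by (simp add: ennreal_mult[symmetric] mult.commute)
  finally show ?thesis using assms by (simp add: emeasure_eq_measure)
qed

text \<open>Without centring, the second moment dominates both the squared mean and the variance.  When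
  the mean dominates the variance and \<open>r\<close> is small, the Gaussian factor \<open>exp (- \<mu>\<^sup>2 / 8\<sigma>\<^sup>2)\<close> makes up for
  the density bound \<open>1 / \<sigma>\<close>.\<close>

lemma gaussian_rv_small_ball:
  assumes Z: "gaussian_rv M Z" and "0 \<le> r"
  shows "prob {\<omega>\<in>space M. \<bar>Z \<omega>\<bar> \<le> r} * sqrt (expectation (\<lambda>\<omega>. (Z \<omega>)\<^sup>2)) \<le> 16 * r" (is "?P * _ \<le> _")
proof -
  have Zm[measurable]: "Z \<in> borel_measurable M" using Z by (simp add: gaussian_rv_def)
  consider (dirac) \<mu> where "AE \<omega> in M. Z \<omega> = \<mu>"
    | (normal) \<mu> \<sigma> where "0 < \<sigma>" "distributed M lborel Z (\<lambda>x. ennreal (normal_density \<mu> \<sigma> x))"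
    using Z by (auto simp: gaussian_rv_def)
  then show ?thesis
  proof cases
    case dirac
    have E: "expectation (\<lambda>\<omega>. (Z \<omega>)\<^sup>2) = \<mu>\<^sup>2" by (rule AE_const_second_moment[OF Zm dirac])
    show ?thesis
    proof (cases "\<bar>\<mu>\<bar> \<le> r")
      case True
      have "?P * \<bar>\<mu>\<bar> \<le> 1 * r" using True by (intro mult_mono) auto
      then show ?thesis using E \<open>0 \<le> r\<close> by simp
    next
      case False
      have "?P = prob {}" by (rule measure_eq_AE) (use dirac False in auto)
      then show ?thesis using \<open>0 \<le> r\<close> by simp
    qed
  next
    case normal
    have E: "expectation (\<lambda>\<omega>. (Z \<omega>)\<^sup>2) = \<mu>\<^sup>2 + \<sigma>\<^sup>2" by (rule normal_second_moment(2)[OF normal(2) normal(1)])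
    have "normal_density \<mu> \<sigma> x \<le> 1 / \<sigma>" for x
    proof (rule order_trans[OF normal_density_le[OF normal(1)]])
      have "exp (- (x - \<mu>)\<^sup>2 / (2 * \<sigma>\<^sup>2)) \<le> 1" by simp
      then show "exp (- (x - \<mu>)\<^sup>2 / (2 * \<sigma>\<^sup>2)) / \<sigma> \<le> 1 / \<sigma>" using normal(1) by (intro divide_right_mono) auto
    qed
    then have P1: "?P \<le> 2 * r * (1 / \<sigma>)"
      using normal \<open>0 \<le> r\<close> by (intro normal_prob_le[OF normal(2)]) auto
    have sq: "sqrt (\<mu>\<^sup>2 + \<sigma>\<^sup>2) \<le> \<bar>\<mu>\<bar> + \<sigma>"
      using normal(1) sqrt_sum_squares_le_sum_abs[of \<mu> \<sigma>] by simp
    show ?thesis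
    \<comment> \<open>Below the threshold 2 r the mean is itself of order r. Above it, every x with
      |x| \<le> r stays at distance at least |\<mu>| / 2 from the mean.\<close>
    proof (cases "\<bar>\<mu>\<bar> < 2 * r")
      case True
      have "?P * sqrt (\<mu>\<^sup>2 + \<sigma>\<^sup>2) \<le> ?P * \<bar>\<mu>\<bar> + ?P * \<sigma>"
        using sq by (simp add: distrib_left[symmetric] mult_left_mono)
      also have "?P * \<bar>\<mu>\<bar> \<le> 1 * (2 * r)" using True by (intro mult_mono) auto
      also have "?P * \<sigma> \<le> 2 * r * (1 / \<sigma>) * \<sigma>" using P1 normal(1) by (intro mult_right_mono) auto
      finally show ?thesis using E normal(1) \<open>0 \<le> r\<close> by simp
    next
      case False
      define y where "y = \<mu>\<^sup>2 / (8 * \<sigma>\<^sup>2)"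
      have "0 \<le> y" by (simp add: y_def)
      have "normal_density \<mu> \<sigma> x \<le> exp (- y) / \<sigma>" if "\<bar>x\<bar> \<le> r" for x
      proof (rule order_trans[OF normal_density_le[OF normal(1)]])
        have "\<bar>\<mu> / 2\<bar> \<le> \<bar>x - \<mu>\<bar>" using that False by linarith
        then have "(\<mu> / 2)\<^sup>2 \<le> (x - \<mu>)\<^sup>2" by (rule abs_le_square_iff[THEN iffD1])
        then have "(\<mu> / 2)\<^sup>2 / (2 * \<sigma>\<^sup>2) \<le> (x - \<mu>)\<^sup>2 / (2 * \<sigma>\<^sup>2)" by (intro divide_right_mono) auto
        then have "exp (- (x - \<mu>)\<^sup>2 / (2 * \<sigma>\<^sup>2)) \<le> exp (- y)" by (simp add: y_def power_divide)
        then show "exp (- (x - \<mu>)\<^sup>2 / (2 * \<sigma>\<^sup>2)) / \<sigma> \<le> exp (- y) / \<sigma>"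
          using normal(1) by (intro divide_right_mono) auto
      qed
      then have P2: "?P \<le> 2 * r * (exp (- y) / \<sigma>)"
        using normal \<open>0 \<le> r\<close> by (intro normal_prob_le[OF normal(2)]) auto
      \<comment> \<open>In terms of y the second moment is (8 y + 1) \<sigma>^2. The factor exp y
        here cancels the exp (- y) of the density bound, and 2 times 8 is the constant 16.\<close>
      have "sqrt (\<mu>\<^sup>2 + \<sigma>\<^sup>2) \<le> 8 * exp y * \<sigma>"
      proof (rule real_le_lsqrt)
        have "8 * y + 1 \<le> 8 * (1 + y)" by simp
        also have "\<dots> \<le> 8 * exp y" by (rule mult_left_mono) (use exp_ge_add_one_self[of y] in auto)
        finally have a: "8 * y + 1 \<le> 8 * exp y" .
        have "\<mu>\<^sup>2 + \<sigma>\<^sup>2 = (8 * y + 1) * \<sigma>\<^sup>2" using normal(1) by (simp add: y_def field_simps)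
        also have "\<dots> \<le> (8 * exp y)\<^sup>2 * \<sigma>\<^sup>2"
        proof (intro mult_right_mono)
          have "8 * exp y \<le> (8 * exp y)\<^sup>2" using \<open>0 \<le> y\<close> one_le_exp_iff[of y]
            by (intro self_le_power) (auto simp: order_trans[of 1 8])
          then show "8 * y + 1 \<le> (8 * exp y)\<^sup>2" using a by simp
        qed simp
        finally show "\<mu>\<^sup>2 + \<sigma>\<^sup>2 \<le> (8 * exp y * \<sigma>)\<^sup>2" by (simp add: power_mult_distrib)
      qed (use normal in auto)
      then have "?P * sqrt (\<mu>\<^sup>2 + \<sigma>\<^sup>2) \<le> (2 * r * (exp (- y) / \<sigma>)) * (8 * exp y * \<sigma>)"
        using P2 normal(1) \<open>0 \<le> r\<close> by (intro mult_mono) auto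
      also have "\<dots> = 16 * r" using normal(1) by (simp add: exp_minus field_simps)
      finally show ?thesis using E by simp
    qed
  qed
qed

text \<open>Markov's inequality for the 2k-th central moment, which for a normal law is (2k)! / (2^k
  k!) times \<sigma>^(2k). Without centring, either |\<mu>| \<ge> a / 2, and then 4 E Z^2 / a^2
  \<ge> 1 makes the bound trivial, or |Z| \<ge> a forces |Z - \<mu>| \<ge> a / 2; both cases produce
  the factor 4^k. The free k gives polynomial decay of any order, which chaining exploits.\<close>

lemma gaussian_rv_tail:
  assumes Z: "gaussian_rv M Z" and "0 < a"
  shows "prob {\<omega>\<in>space M. a \<le> \<bar>Z \<omega>\<bar>}
    \<le> 4 ^ k * (1 + fact (2 * k) / (2 ^ k * fact k)) * (expectation (\<lambda>\<omega>. (Z \<omega>)\<^sup>2) / a\<^sup>2) ^ k" (is "?P \<le> ?C * _")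
proof -
  have Zm[measurable]: "Z \<in> borel_measurable M" using Z by (simp add: gaussian_rv_def)
  have far: "?P \<le> ?C * (expectation (\<lambda>\<omega>. (Z \<omega>)\<^sup>2) / a\<^sup>2) ^ k" if "a\<^sup>2 / 4 \<le> expectation (\<lambda>\<omega>. (Z \<omega>)\<^sup>2)"
  proof -
    have "?P \<le> 1 * 1" by simp
    also have "1 * 1 \<le> (1 + fact (2 * k) / (2 ^ k * fact k)) * (4 * (expectation (\<lambda>\<omega>. (Z \<omega>)\<^sup>2) / a\<^sup>2)) ^ k"
      using that \<open>0 < a\<close> by (intro mult_mono one_le_power) (auto simp: field_simps)
    also have "\<dots> = ?C * (expectation (\<lambda>\<omega>. (Z \<omega>)\<^sup>2) / a\<^sup>2) ^ k" by (simp add: power_mult_distrib[symmetric])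
    finally show ?thesis .
  qed
  consider (dirac) \<mu> where "AE \<omega> in M. Z \<omega> = \<mu>"
    | (normal) \<mu> \<sigma> where "0 < \<sigma>" "distributed M lborel Z (\<lambda>x. ennreal (normal_density \<mu> \<sigma> x))"
    using Z by (auto simp: gaussian_rv_def)
  then show ?thesis
  proof cases
    case dirac
    have E: "expectation (\<lambda>\<omega>. (Z \<omega>)\<^sup>2) = \<mu>\<^sup>2" by (rule AE_const_second_moment[OF Zm dirac])
    show ?thesis
    proof (cases "a \<le> \<bar>\<mu>\<bar>")
      case True
      then have "a\<^sup>2 \<le> \<mu>\<^sup>2" using \<open>0 < a\<close> by (intro abs_le_square_iff[THEN iffD1]) auto
      then have "a\<^sup>2 / 4 \<le> \<mu>\<^sup>2" using zero_le_power2[of a] by linarith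
      then show ?thesis using E by (intro far) auto
    next
      case False
      have "?P = prob {}" by (rule measure_eq_AE) (use dirac False in auto)
      then show ?thesis by (simp add: E)
    qed
  next
    case normal
    have E: "expectation (\<lambda>\<omega>. (Z \<omega>)\<^sup>2) = \<mu>\<^sup>2 + \<sigma>\<^sup>2" by (rule normal_second_moment(2)[OF normal(2) normal(1)])
    show ?thesis
    proof (cases "a / 2 \<le> \<bar>\<mu>\<bar>")
      case True
      then have "(a / 2)\<^sup>2 \<le> \<mu>\<^sup>2" using \<open>0 < a\<close> by (intro abs_le_square_iff[THEN iffD1]) auto
      then show ?thesis using E by (intro far) (simp add: power_divide add_increasing2)
    next
      case False
      define c :: real where "c = fact (2 * k) / (2 ^ k * fact k)"
      have "0 \<le> c" by (simp add: c_def)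
      have mom: "integrable M (\<lambda>\<omega>. (Z \<omega> - \<mu>) ^ (2 * k))" "expectation (\<lambda>\<omega>. (Z \<omega> - \<mu>) ^ (2 * k)) = c * (\<sigma>\<^sup>2) ^ k"
        using normal_moment_even[OF normal(1), of \<mu> k]
          distributed_integrable[OF normal(2), of "\<lambda>x. (x - \<mu>) ^ (2 * k)"]
          distributed_integral[OF normal(2), of "\<lambda>x. (x - \<mu>) ^ (2 * k)"]
        by (auto simp: has_bochner_integral_iff c_def power_divide)
      have "?P \<le> prob {\<omega>\<in>space M. (a / 2) ^ (2 * k) \<le> (Z \<omega> - \<mu>) ^ (2 * k)}"
      proof (rule finite_measure_mono)
        have "(a / 2) ^ (2 * k) \<le> (Z \<omega> - \<mu>) ^ (2 * k)" if "a \<le> \<bar>Z \<omega>\<bar>" for \<omega>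
        proof -
          have "a / 2 \<le> \<bar>Z \<omega> - \<mu>\<bar>" using False that by linarith
          then have "(a / 2) ^ (2 * k) \<le> \<bar>Z \<omega> - \<mu>\<bar> ^ (2 * k)" using \<open>0 < a\<close> by (intro power_mono) auto
          then show ?thesis by (simp add: power_even_abs)
        qed
        then show "{\<omega>\<in>space M. a \<le> \<bar>Z \<omega>\<bar>} \<subseteq> {\<omega>\<in>space M. (a / 2) ^ (2 * k) \<le> (Z \<omega> - \<mu>) ^ (2 * k)}" by auto
      qed measurable
      also have "\<dots> \<le> expectation (\<lambda>\<omega>. (Z \<omega> - \<mu>) ^ (2 * k)) / (a / 2) ^ (2 * k)"
        using \<open>0 < a\<close> by (intro integral_Markov_inequality_measure[where A="space M"] mom) auto
      also have "\<dots> = 4 ^ k * c * (\<sigma>\<^sup>2 / a\<^sup>2) ^ k"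
      proof -
        have "(a / 2) ^ (2 * k) = (a\<^sup>2) ^ k / 4 ^ k" by (simp add: power_mult power_divide)
        then show ?thesis unfolding mom(2) using \<open>0 < a\<close> by (simp add: power_divide)
      qed
      also have "\<dots> \<le> 4 ^ k * (1 + c) * ((\<mu>\<^sup>2 + \<sigma>\<^sup>2) / a\<^sup>2) ^ k"
        using \<open>0 \<le> c\<close> by (intro mult_mono power_mono divide_right_mono) auto
      finally show ?thesis using E by (simp add: c_def)
    qed
  qed
qed

end

section \<open>Dyadic cells\<close>

definition dyadic :: "nat \<Rightarrow> real ^ 'n \<Rightarrow> real ^ 'n" where
  "dyadic m x = (\<chi> i. of_int \<lfloor>2 ^ m * x $ i\<rfloor> / 2 ^ m)"

text \<open>The half-open cube of side 2^-m that contains x, named by any of its points. As a fibre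
  of \<open>dyadic m\<close>, two cells of one level are equal or disjoint.\<close>

definition dyadic_cell :: "nat \<Rightarrow> real ^ 'n \<Rightarrow> (real ^ 'n) set" where
  "dyadic_cell m x = {y. dyadic m y = dyadic m x}"

lemma dyadic_eq_iff: "dyadic m y = dyadic m x \<longleftrightarrow> (\<forall>i. \<lfloor>2 ^ m * y $ i\<rfloor> = \<lfloor>2 ^ m * x $ i\<rfloor>)"
  by (simp add: dyadic_def vec_eq_iff)

lemma self_in_dyadic_cell: "x \<in> dyadic_cell m x"
  by (simp add: dyadic_cell_def)

text \<open>Floor commutes with division by the integer 2^(n-m), so the level-n index of a point
  determines its level-m index. Nestedness of the cells rests on this.\<close>

lemma floor_dyadic_mult:
  fixes x :: real assumes "m \<le> n"
  shows "\<lfloor>2 ^ m * (of_int \<lfloor>2 ^ n * x\<rfloor> / 2 ^ n :: real)\<rfloor> = \<lfloor>2 ^ m * x\<rfloor>"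
    and "\<lfloor>2 ^ n * x\<rfloor> div 2 ^ (n - m) = \<lfloor>2 ^ m * x\<rfloor>"
proof -
  have n: "(2::real) ^ n = 2 ^ m * 2 ^ (n - m)" using assms by (simp flip: power_add)
  have "\<lfloor>2 ^ m * x\<rfloor> = \<lfloor>2 ^ n * x / of_int (2 ^ (n - m))\<rfloor>" by (simp add: n)
  also have "\<dots> = \<lfloor>2 ^ n * x\<rfloor> div 2 ^ (n - m)" by (rule floor_divide_real_eq_div) simp
  finally show 1: "\<lfloor>2 ^ n * x\<rfloor> div 2 ^ (n - m) = \<lfloor>2 ^ m * x\<rfloor>" by simp
  have "2 ^ m * (of_int \<lfloor>2 ^ n * x\<rfloor> / 2 ^ n) = (of_int \<lfloor>2 ^ n * x\<rfloor> / of_int (2 ^ (n - m)) :: real)"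
    by (simp add: n)
  then show "\<lfloor>2 ^ m * (of_int \<lfloor>2 ^ n * x\<rfloor> / 2 ^ n :: real)\<rfloor> = \<lfloor>2 ^ m * x\<rfloor>"
    using 1 by (simp only: floor_divide_of_int_eq)
qed

lemma dyadic_dyadic: "m \<le> n \<Longrightarrow> dyadic m (dyadic n x) = dyadic m x"
  unfolding dyadic_eq_iff by (simp only: dyadic_def vec_lambda_beta floor_dyadic_mult) simp

text \<open>A half-open cell contains its lower corner, so rounding at a finer level never leaves
  it. Estimates valid on the cell thus cover the approximations of its points.\<close>

lemma dyadic_in_cell: "m \<le> n \<Longrightarrow> y \<in> dyadic_cell m x \<Longrightarrow> dyadic n y \<in> dyadic_cell m x"
  by (simp add: dyadic_cell_def dyadic_dyadic)

text \<open>The factor \<open>CARD('n)\<close> instead of its square root comes from bounding the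
  Euclidean norm by the l1 norm.\<close>

lemma norm_minus_dyadic:
  fixes x :: "real ^ 'n" shows "norm (x - dyadic m x) \<le> CARD('n) / 2 ^ m"
proof -
  have "\<bar>x $ i - of_int \<lfloor>2 ^ m * x $ i\<rfloor> / 2 ^ m\<bar> \<le> 1 / 2 ^ m" for i
  proof -
    have "x $ i - of_int \<lfloor>2 ^ m * x $ i\<rfloor> / 2 ^ m = (2 ^ m * x $ i - of_int \<lfloor>2 ^ m * x $ i\<rfloor>) / 2 ^ m"
      by (simp add: field_simps)
    moreover have "\<bar>2 ^ m * x $ i - of_int \<lfloor>2 ^ m * x $ i\<rfloor>\<bar> \<le> 1" by linarith
    ultimately show ?thesis by (simp add: divide_right_mono)
  qed
  then have "(\<Sum>i\<in>UNIV. \<bar>(x - dyadic m x) $ i\<bar>) \<le> (\<Sum>i\<in>(UNIV::'n set). 1 / 2 ^ m)"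
    by (intro sum_mono) (simp add: dyadic_def)
  then show ?thesis using norm_le_l1_cart[of "x - dyadic m x"] by simp
qed

lemma dist_dyadic_cell:
  fixes x :: "real ^ 'n"
  assumes "y \<in> dyadic_cell m x" "z \<in> dyadic_cell m x" shows "dist y z \<le> 2 * CARD('n) / 2 ^ m"
proof -
  have "dist y z \<le> dist y (dyadic m y) + dist z (dyadic m z)"
    using assms dist_triangle2[of y z "dyadic m y"] by (simp add: dyadic_cell_def)
  also have "\<dots> \<le> CARD('n) / 2 ^ m + CARD('n) / 2 ^ m"
    unfolding dist_norm by (intro add_mono norm_minus_dyadic)
  finally show ?thesis by simp
qed

lemma bounded_dyadic_cell: "bounded (dyadic_cell m x)"
  unfolding bounded_def using dist_dyadic_cell[OF self_in_dyadic_cell] by blast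

lemma half_power_tendsto_zero: "(\<lambda>n. c / 2 ^ n) \<longlonglongrightarrow> (0::real)"
  using tendsto_mult_right_zero[OF LIMSEQ_realpow_zero[of "1/2"], of c] by (simp add: power_divide)

lemma dyadic_tendsto: "(\<lambda>n. dyadic n x) \<longlonglongrightarrow> x"
  for x :: "real ^ 'n"
proof -
  have "(\<lambda>n. dyadic n x - x) \<longlonglongrightarrow> 0"
  proof (rule Lim_null_comparison)
    show "\<forall>\<^sub>F n in sequentially. norm (dyadic n x - x) \<le> CARD('n) / 2 ^ n"
      using norm_minus_dyadic[of x] by (simp add: norm_minus_commute)
  qed (rule half_power_tendsto_zero)
  then show ?thesis by (rule LIM_zero_cancel)
qed

lemma countable_range_dyadic: "countable (range (dyadic m :: real ^ 'n \<Rightarrow> real ^ 'n))"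
proof (rule countable_subset)
  show "range (dyadic m) \<subseteq> (\<lambda>k :: 'n \<Rightarrow> int. \<chi> i. of_int (k i) / 2 ^ m) ` UNIV"
    by (auto simp: dyadic_def image_iff)
qed simp

lemma countable_dyadic_cells: "countable (range (\<lambda>(m, x :: real ^ 'n). dyadic_cell m x))"
proof (rule countable_subset)
  show "range (\<lambda>(m, x :: real ^ 'n). dyadic_cell m x)
      \<subseteq> (\<lambda>(m, p). dyadic m -` {p}) ` (SIGMA m : UNIV. range (dyadic m))"
    by (force simp: dyadic_cell_def)
  show "countable ((\<lambda>(m, p). dyadic m -` {p :: real ^ 'n}) ` (SIGMA m : UNIV. range (dyadic m)))"
    by (intro countable_image countable_SIGMA countable_range_dyadic) simp
qed

text \<open>A real is nonnegative iff the floor of its multiple by 2^m is, so no cell straddles a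
  face of the orthant and boundary points of I need no separate argument.\<close>

lemma dyadic_cell_orthant:
  assumes "x \<in> orthant" shows "dyadic_cell m x \<subseteq> orthant"
proof -
  have "0 \<le> z \<longleftrightarrow> 0 \<le> \<lfloor>2 ^ m * z\<rfloor>" for z :: real
    using mult_le_cancel_left_pos[of "2 ^ m" 0 z] by simp
  from this have "0 \<le> y $ i \<longleftrightarrow> 0 \<le> x $ i" if "y \<in> dyadic_cell m x" for y i
    using that unfolding dyadic_cell_def dyadic_eq_iff by (metis (mono_tags) mem_Collect_eq)
  then show ?thesis using assms unfolding orthant_def by blast
qed

lemma exists_dyadic_cell_in_ball:
  fixes x :: "real ^ 'n"
  assumes "0 < \<rho>" shows "\<exists>m. dyadic_cell m x \<subseteq> ball x \<rho>"
proof -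
  have "\<forall>\<^sub>F m in sequentially. 2 * CARD('n) / 2 ^ m < \<rho>"
    by (rule order_tendstoD(2)[OF half_power_tendsto_zero assms])
  then obtain m where "2 * CARD('n) / 2 ^ m < \<rho>" by (auto simp: eventually_sequentially)
  then show ?thesis using dist_dyadic_cell[OF self_in_dyadic_cell, of _ m x]
    by (intro exI[of _ m]) (force simp: dist_commute)
qed

lemma card_dyadic_image_cell:
  fixes x :: "real ^ 'n"
  assumes "m \<le> n"
  shows "finite (dyadic n ` dyadic_cell m x)" "card (dyadic n ` dyadic_cell m x) \<le> (2 ^ n) ^ CARD('n)"
proof -
  define D :: int where "D = 2 ^ (n - m)"
  define J where "J i = {\<lfloor>2 ^ m * x $ i\<rfloor> * D ..< \<lfloor>2 ^ m * x $ i\<rfloor> * D + D}" for i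
  have "dyadic n y \<in> (\<lambda>j. \<chi> i. of_int (j i) / 2 ^ n) ` (PiE UNIV J)" if "y \<in> dyadic_cell m x" for y
  proof (rule image_eqI)
    show "dyadic n y = (\<chi> i. of_int ((\<lambda>i. \<lfloor>2 ^ n * y $ i\<rfloor>) i) / 2 ^ n)" by (simp add: dyadic_def)
    have "\<lfloor>2 ^ n * y $ i\<rfloor> \<in> J i" for i
    proof -
      have "\<lfloor>2 ^ n * y $ i\<rfloor> div D = \<lfloor>2 ^ m * x $ i\<rfloor>"
        using that floor_dyadic_mult(2)[OF assms, of "y $ i"]
        unfolding D_def dyadic_cell_def dyadic_eq_iff by simp
      moreover have "0 < D" by (simp add: D_def)
      then show ?thesis using calculation unfolding J_def
        using div_mult_mod_eq[of "\<lfloor>2 ^ n * y $ i\<rfloor>" D] pos_mod_bound[OF \<open>0 < D\<close>, of "\<lfloor>2 ^ n * y $ i\<rfloor>"]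
          pos_mod_sign[OF \<open>0 < D\<close>, of "\<lfloor>2 ^ n * y $ i\<rfloor>"] by (simp only: atLeastLessThan_iff) linarith
    qed
    then show "(\<lambda>i. \<lfloor>2 ^ n * y $ i\<rfloor>) \<in> PiE UNIV J" by auto
  qed
  then have sub: "dyadic n ` dyadic_cell m x \<subseteq> (\<lambda>j. \<chi> i. of_int (j i) / 2 ^ n) ` (PiE UNIV J)" by auto
  have fin: "finite (PiE UNIV J)" by (intro finite_PiE) (auto simp: J_def)
  show "finite (dyadic n ` dyadic_cell m x)" using finite_subset[OF sub] fin by simp
  have "card (dyadic n ` dyadic_cell m x) \<le> card (PiE UNIV J)"
    using card_mono[OF finite_imageI[OF fin] sub] card_image_le[OF fin] order_trans by blast
  also have "\<dots> = (nat D) ^ CARD('n)" by (simp add: card_PiE J_def)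
  \<comment> \<open>The count so far is (2^(n-m))^N with N = \<open>CARD('n)\<close>. Since m is
    fixed while n grows, dropping it costs only a constant factor.\<close>
  also have "\<dots> \<le> (2 ^ n) ^ CARD('n)" by (intro power_mono) (auto simp: D_def nat_power_eq)
  finally show "card (dyadic n ` dyadic_cell m x) \<le> (2 ^ n) ^ CARD('n)" .
qed

lemma dyadic_measurable: "dyadic m \<in> borel \<rightarrow>\<^sub>M (borel :: (real ^ 'n) measure)"
proof -
  have "(\<lambda>x :: real ^ 'n. of_int \<lfloor>2 ^ m * x $ i\<rfloor> / 2 ^ m :: real) \<in> borel_measurable borel" for i
    by measurable
  then show ?thesis
    unfolding dyadic_def by (subst borel_measurable_euclidean_space) (auto simp: Basis_vec_def inner_axis)
qed

lemma dyadic_cell_borel: "dyadic_cell m x \<in> sets borel"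
proof -
  have "dyadic_cell m x = dyadic m -` {dyadic m x} \<inter> space borel" by (auto simp: dyadic_cell_def)
  then show ?thesis using measurable_sets[OF dyadic_measurable, of "{dyadic m x}" m] by simp
qed

lemma emeasure_dyadic_cell_pos:
  fixes x :: "real ^ 'n" shows "0 < emeasure lborel (dyadic_cell m x)"
proof -
  define l u :: "real ^ 'n" where "l = dyadic m x" and "u = dyadic m x + (\<chi> i. 1 / 2 ^ m)"
  have lu: "l $ i < u $ i" for i by (simp add: l_def u_def)
  have "0 < (\<Prod>b\<in>Basis. (u - l) \<bullet> b)"
    by (rule prod_pos) (use lu in \<open>auto simp: Basis_vec_def inner_axis\<close>)
  moreover have "l \<bullet> b \<le> u \<bullet> b" if "b \<in> Basis" for b
    using that lu by (auto simp: Basis_vec_def inner_axis intro: less_imp_le)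
  ultimately have "0 < emeasure lborel (box l u)" by (simp add: emeasure_lborel_box)
  also have "\<dots> \<le> emeasure lborel (dyadic_cell m x)"
  proof (rule emeasure_mono)
    show "box l u \<subseteq> dyadic_cell m x"
    proof
      fix y assume "y \<in> box l u"
      then have "of_int \<lfloor>2 ^ m * x $ i\<rfloor> / 2 ^ m < y $ i \<and> y $ i < of_int \<lfloor>2 ^ m * x $ i\<rfloor> / 2 ^ m + 1 / 2 ^ m" for i
        by (simp add: mem_box_cart l_def u_def dyadic_def)
      then have "of_int \<lfloor>2 ^ m * x $ i\<rfloor> < 2 ^ m * y $ i \<and> 2 ^ m * y $ i < of_int \<lfloor>2 ^ m * x $ i\<rfloor> + 1" for i
        by (simp add: field_simps)
      then show "y \<in> dyadic_cell m x"
        unfolding dyadic_cell_def dyadic_eq_iff by (auto simp: floor_eq_iff intro: less_imp_le)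
    qed
  qed (simp add: dyadic_cell_borel)
  finally show ?thesis .
qed

lemma emeasure_dyadic_cell_finite: "emeasure lborel (dyadic_cell m x) < \<infinity>"
  by (intro emeasure_bounded_finite bounded_dyadic_cell)

lemma half_power_powr: "((1/2::real) ^ n) powr g = 2 powr (- (real n * g))"
proof -
  have "(1/2::real) ^ n = 2 powr (- real n)" by (simp add: powr_minus_divide powr_realpow power_one_over)
  then show ?thesis by (simp add: powr_powr)
qed

text \<open>On the shell 2^-(k+1) < |u - t| \<le> 2^-k the integrand is at most 2^((k+1) \<beta>),
  and the ball of radius 2^-k has volume V 2^(-k N). The resulting series is geometric with ratio q
  = 2^(\<beta> - N) < 1 and does not depend on t.\<close>

lemma nn_integral_norm_powr_bounded:
  fixes \<beta> :: real
  assumes "0 \<le> \<beta>" "\<beta> < real CARD('n)"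
  shows "\<exists>C\<ge>0. \<forall>t :: real ^ 'n.
    (\<integral>\<^sup>+u. ennreal (norm (u - t) powr (- \<beta>)) * indicator (cball t 1) u \<partial>lborel) \<le> ennreal C"
proof -
  define V where "V = unit_ball_vol (real CARD('n))"
  define q :: real where "q = 2 powr (\<beta> - CARD('n))"
  define a :: "nat \<Rightarrow> real" where "a k = 2 powr ((real k + 1) * \<beta>)" for k
  define C where "C = V * 2 powr \<beta> * (1 / (1 - q))"
  have V: "0 \<le> V" by (simp add: V_def)
  have "q < 2 powr 0" unfolding q_def by (intro powr_less_mono) (use assms in auto)
  then have q: "0 < q" "q < 1" by (auto simp: q_def)
  have "(\<integral>\<^sup>+u. ennreal (norm (u - t) powr (- \<beta>)) * indicator (cball t 1) u \<partial>lborel) \<le> ennreal C" for t :: "real ^ 'n"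
  proof -
    have shell: "ennreal (norm (u - t) powr (- \<beta>)) * indicator (cball t 1) u
        \<le> (\<Sum>k. ennreal (a k) * indicator (cball t ((1/2) ^ k)) u)" for u
    \<comment> \<open>At the centre the integrand is 0, since a power of 0 is 0 under
      \<open>powr\<close>.\<close>
    proof (cases "u = t \<or> u \<notin> cball t 1")
      case False
      then have "0 < norm (u - t)" "norm (u - t) \<le> 1" by (auto simp: dist_norm norm_minus_commute)
      then obtain n where n: "norm (u - t) \<le> (1/2) ^ n" "(1/2) ^ n < 2 * norm (u - t)"
        using dyadic_scale by blast
      have "norm (u - t) powr (- \<beta>) \<le> ((1/2) ^ Suc n) powr (- \<beta>)"
        using n assms by (intro powr_mono2') auto
      also have "\<dots> = a n" unfolding half_power_powr a_def by (simp add: mult.commute add.commute)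
      finally have "ennreal (norm (u - t) powr (- \<beta>)) * indicator (cball t 1) u
          \<le> ennreal (a n) * indicator (cball t ((1/2) ^ n)) u"
        using n(1) by (auto simp: dist_norm norm_minus_commute split: split_indicator intro: ennreal_leI)
      also have "F n \<le> suminf F" for F :: "nat \<Rightarrow> ennreal"
        using sum_le_suminf[OF summableI, of "{n}" F] by simp
      finally show ?thesis .
    qed auto
    have "(\<integral>\<^sup>+u. ennreal (norm (u - t) powr (- \<beta>)) * indicator (cball t 1) u \<partial>lborel)
        \<le> (\<integral>\<^sup>+u. (\<Sum>k. ennreal (a k) * indicator (cball t ((1/2) ^ k)) u) \<partial>lborel)"
      by (intro nn_integral_mono shell)
    also have "\<dots> = (\<Sum>k. \<integral>\<^sup>+u. ennreal (a k) * indicator (cball t ((1/2) ^ k)) u \<partial>lborel)"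
      by (intro nn_integral_suminf borel_measurable_times_ennreal borel_measurable_const borel_measurable_indicator)
        auto
    also have "\<dots> = (\<Sum>k. ennreal (V * 2 powr \<beta> * q ^ k))"
    proof (rule suminf_cong)
      fix k
      have "a k * (V * ((1/2) ^ k) ^ CARD('n)) = V * 2 powr \<beta> * q ^ k"
      proof -
        have "((1/2::real) ^ k) ^ CARD('n) = 2 powr (- (real k * CARD('n)))"
          by (subst half_power_powr[symmetric]) (simp add: powr_realpow)
        moreover have "q ^ k = 2 powr (real k * (\<beta> - CARD('n)))"
          by (simp add: q_def powr_realpow[symmetric] powr_powr mult.commute)
        moreover have "a k * 2 powr (- (real k * CARD('n))) = 2 powr \<beta> * 2 powr (real k * (\<beta> - CARD('n)))"
          unfolding a_def by (simp add: powr_add[symmetric] algebra_simps)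
        ultimately show ?thesis by (simp add: mult_ac)
      qed
      moreover have "(\<integral>\<^sup>+u. ennreal (a k) * indicator (cball t ((1/2) ^ k)) u \<partial>lborel)
          = ennreal (a k) * ennreal (V * ((1/2) ^ k) ^ CARD('n))"
        by (subst nn_integral_cmult_indicator) (auto simp: emeasure_cball V_def)
      moreover have "\<dots> = ennreal (a k * (V * ((1/2) ^ k) ^ CARD('n)))"
        by (rule ennreal_mult[symmetric]) (auto simp: a_def V)
      ultimately show "(\<integral>\<^sup>+u. ennreal (a k) * indicator (cball t ((1/2) ^ k)) u \<partial>lborel) = ennreal (V * 2 powr \<beta> * q ^ k)"
        by (simp only:)
    qed
    also have "\<dots> = ennreal C"
    proof (rule suminf_ennreal_eq)
      show "(\<lambda>k. V * 2 powr \<beta> * q ^ k) sums C" unfolding C_def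
        by (rule sums_mult[OF geometric_sums]) (use q in simp)
    qed (use q V in simp)
    finally show ?thesis .
  qed
  moreover have "0 \<le> C" using V q by (simp add: C_def)
  ultimately show ?thesis by blast
qed

section \<open>Lower bounds\<close>

text \<open>With \<open>\<phi>\<^sub>n(t) = L {s. dist (f t) (f s) \<le> 2\<^sup>-\<^sup>n}\<close>, the hypothesis makes the expectation of
  \<open>\<Sum>n. 2\<^sup>n\<^sup>g\<^sup>' \<phi>\<^sub>n(t)\<close> finite; the sets where this sum is at most \<open>K\<close> carry the mass distribution.\<close>

lemma AE_hausdorff_dim_ge:
  fixes f :: "'t \<Rightarrow> 'w \<Rightarrow> 'b::{second_countable_topology, metric_space}"
  assumes "prob_space M" "finite_measure L" and Lpos: "0 < emeasure L (space L)"
    and f[measurable]: "(\<lambda>(\<omega>, t). f t \<omega>) \<in> M \<Otimes>\<^sub>M L \<rightarrow>\<^sub>M borel"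
    and small: "\<And>t n. t \<in> space L \<Longrightarrow>
      (\<integral>\<^sup>+s. emeasure M {\<omega>\<in>space M. dist (f t \<omega>) (f s \<omega>) \<le> (1/2) ^ n} \<partial>L) \<le> ennreal (C * ((1/2) ^ n) powr g)"
    and g: "0 < g'" "g' < g" and "0 \<le> C"
  shows "AE \<omega> in M. ereal g' \<le> hausdorff_dim ((\<lambda>t. f t \<omega>) ` space L)"
proof -
  interpret M: prob_space M by fact
  interpret L: finite_measure L by fact
  interpret P: pair_sigma_finite M L ..
  have fc[measurable]: "f t \<in> M \<rightarrow>\<^sub>M borel" if "t \<in> space L" for t
    using measurable_compose[OF measurable_Pair[OF measurable_ident_sets[OF refl] measurable_const[OF that]] f] by simp
  have fd[measurable]: "(\<lambda>t. f t \<omega>) \<in> L \<rightarrow>\<^sub>M borel" if "\<omega> \<in> space M" for \<omega>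
    using measurable_compose[OF measurable_Pair[OF measurable_const[OF that] measurable_ident_sets[OF refl]] f] by simp
  \<comment> \<open>The occupation measure is written as an integral of indicators, so that Tonelli
    can exchange it with the expectation.\<close>
  define e where "e n \<omega> t s = (indicator {d. d \<le> (1/2::real) ^ n} (dist (f t \<omega>) (f s \<omega>)) :: ennreal)" for n \<omega> t s
  define \<phi> where "\<phi> n \<omega> t = (\<integral>\<^sup>+s. e n \<omega> t s \<partial>L)" for n \<omega> t
  define H where "H \<omega> t = (\<Sum>n. ennreal (2 powr (real n * g')) * \<phi> n \<omega> t)" for \<omega> t
  have f1: "(\<lambda>p. f (snd (fst p)) (fst (fst p))) \<in> (M \<Otimes>\<^sub>M L) \<Otimes>\<^sub>M L \<rightarrow>\<^sub>M borel"
    using measurable_compose[OF measurable_fst f] by (simp add: split_beta')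
  have f2: "(\<lambda>p. f (snd p) (fst (fst p))) \<in> (M \<Otimes>\<^sub>M L) \<Otimes>\<^sub>M L \<rightarrow>\<^sub>M borel"
  proof -
    have "(\<lambda>p. (fst (fst p), snd p)) \<in> (M \<Otimes>\<^sub>M L) \<Otimes>\<^sub>M L \<rightarrow>\<^sub>M M \<Otimes>\<^sub>M L" by measurable
    from measurable_compose[OF this f] show ?thesis by (simp add: split_beta')
  qed
  have e_meas: "(\<lambda>p. e n (fst (fst p)) (snd (fst p)) (snd p)) \<in> borel_measurable ((M \<Otimes>\<^sub>M L) \<Otimes>\<^sub>M L)" for n
  proof -
    have "(\<lambda>p. dist (f (snd (fst p)) (fst (fst p))) (f (snd p) (fst (fst p)))) \<in> borel_measurable ((M \<Otimes>\<^sub>M L) \<Otimes>\<^sub>M L)"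
      by (rule borel_measurable_dist[OF f1 f2])
    then show ?thesis unfolding e_def by measurable
  qed
  have \<phi>_meas: "(\<lambda>p. \<phi> n (fst p) (snd p)) \<in> borel_measurable (M \<Otimes>\<^sub>M L)" for n
    unfolding \<phi>_def using L.borel_measurable_nn_integral[of "\<lambda>p s. e n (fst p) (snd p) s"] e_meas[of n]
    by (simp add: split_beta')
  have H_meas: "(\<lambda>p. H (fst p) (snd p)) \<in> borel_measurable (M \<Otimes>\<^sub>M L)"
    unfolding H_def using \<phi>_meas by measurable
  have \<phi>_meas1: "(\<lambda>\<omega>. \<phi> n \<omega> t) \<in> borel_measurable M" if "t \<in> space L" for n t
    using measurable_compose[OF measurable_Pair[OF measurable_ident_sets[OF refl] measurable_const[OF that]] \<phi>_meas] by simp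
  have H_meas1: "(\<lambda>t. H \<omega> t) \<in> borel_measurable L" if "\<omega> \<in> space M" for \<omega>
    using measurable_compose[OF measurable_Pair[OF measurable_const[OF that] measurable_ident_sets[OF refl]] H_meas] by simp
  have \<phi>_int: "(\<integral>\<^sup>+\<omega>. \<phi> n \<omega> t \<partial>M) \<le> ennreal (C * ((1/2) ^ n) powr g)" if t: "t \<in> space L" for n t
  proof -
    have "(\<lambda>p. ((fst p, t), snd p)) \<in> M \<Otimes>\<^sub>M L \<rightarrow>\<^sub>M (M \<Otimes>\<^sub>M L) \<Otimes>\<^sub>M L" using t by measurable
    from measurable_compose[OF this e_meas[of n]]
    have "case_prod (\<lambda>\<omega> s. e n \<omega> t s) \<in> borel_measurable (M \<Otimes>\<^sub>M L)" by (simp add: split_beta')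
    then have "(\<integral>\<^sup>+\<omega>. \<phi> n \<omega> t \<partial>M) = (\<integral>\<^sup>+s. \<integral>\<^sup>+\<omega>. e n \<omega> t s \<partial>M \<partial>L)"
      unfolding \<phi>_def by (rule P.Fubini'[symmetric])
    also have "\<dots> = (\<integral>\<^sup>+s. emeasure M {\<omega>\<in>space M. dist (f t \<omega>) (f s \<omega>) \<le> (1/2) ^ n} \<partial>L)"
    proof (rule nn_integral_cong)
      fix s assume s: "s \<in> space L"
      have "(\<integral>\<^sup>+\<omega>. e n \<omega> t s \<partial>M) = (\<integral>\<^sup>+\<omega>. indicator {\<omega>\<in>space M. dist (f t \<omega>) (f s \<omega>) \<le> (1/2) ^ n} \<omega> \<partial>M)"
        by (rule nn_integral_cong) (auto simp: e_def split: split_indicator)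
      also have "\<dots> = emeasure M {\<omega>\<in>space M. dist (f t \<omega>) (f s \<omega>) \<le> (1/2) ^ n}"
        by (rule nn_integral_indicator[OF borel_measurable_le[OF borel_measurable_dist[OF fc[OF t] fc[OF s]] borel_measurable_const]])
      finally show "(\<integral>\<^sup>+\<omega>. e n \<omega> t s \<partial>M) = emeasure M {\<omega>\<in>space M. dist (f t \<omega>) (f s \<omega>) \<le> (1/2) ^ n}" .
    qed
    finally show ?thesis using small[OF t, of n] by simp
  qed
  \<comment> \<open>The ratio 2^(g' - g) < 1 makes the sum over n converge: this is what the loss
    from g to g' buys.\<close>
  define q :: real where "q = 2 powr (g' - g)"
  have "q < 2 powr 0" unfolding q_def using g by (intro powr_less_mono) auto
  then have q: "0 < q" "q < 1" by (auto simp: q_def)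
  have "(\<integral>\<^sup>+\<omega>. H \<omega> t \<partial>M) \<le> ennreal (C * (1 / (1 - q)))" if t: "t \<in> space L" for t
  proof -
    have "(\<integral>\<^sup>+\<omega>. H \<omega> t \<partial>M) = (\<Sum>n. \<integral>\<^sup>+\<omega>. ennreal (2 powr (real n * g')) * \<phi> n \<omega> t \<partial>M)"
      unfolding H_def using \<phi>_meas1[OF t] by (intro nn_integral_suminf) measurable
    also have "\<dots> \<le> (\<Sum>n. ennreal (C * q ^ n))"
    proof (intro suminf_le summableI)
      fix n
      have "(\<integral>\<^sup>+\<omega>. ennreal (2 powr (real n * g')) * \<phi> n \<omega> t \<partial>M) = ennreal (2 powr (real n * g')) * (\<integral>\<^sup>+\<omega>. \<phi> n \<omega> t \<partial>M)"
        by (rule nn_integral_cmult[OF \<phi>_meas1[OF t]])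
      also have "\<dots> \<le> ennreal (2 powr (real n * g')) * ennreal (C * ((1/2) ^ n) powr g)"
        by (intro mult_left_mono \<phi>_int t) simp
      also have "\<dots> = ennreal (2 powr (real n * g') * (C * ((1/2) ^ n) powr g))"
        using \<open>0 \<le> C\<close> by (simp add: ennreal_mult)
      also have "2 powr (real n * g') * (C * ((1/2) ^ n) powr g) = C * (2 powr (real n * g') * 2 powr (- (real n * g)))"
        unfolding half_power_powr by simp
      also have "2 powr (real n * g') * 2 powr (- (real n * g)) = 2 powr (real n * (g' - g))"
        by (simp add: powr_add[symmetric] algebra_simps)
      also have "\<dots> = q ^ n" unfolding q_def by (simp add: powr_realpow[symmetric] powr_powr mult.commute)
      finally show "(\<integral>\<^sup>+\<omega>. ennreal (2 powr (real n * g')) * \<phi> n \<omega> t \<partial>M) \<le> ennreal (C * q ^ n)" .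
    qed
    also have "\<dots> = ennreal (C * (1 / (1 - q)))"
    proof (rule suminf_ennreal_eq)
      show "(\<lambda>n. C * q ^ n) sums (C * (1 / (1 - q)))"
        by (rule sums_mult[OF geometric_sums]) (use q in simp)
    qed (use q \<open>0 \<le> C\<close> in simp)
    finally show ?thesis .
  qed
  then have "(\<integral>\<^sup>+t. \<integral>\<^sup>+\<omega>. H \<omega> t \<partial>M \<partial>L) \<le> (\<integral>\<^sup>+t. ennreal (C * (1 / (1 - q))) \<partial>L)"
    by (rule nn_integral_mono)
  also have "\<dots> < \<infinity>"
  proof -
    have "emeasure L (space L) < top" by (simp add: less_top[symmetric])
    then show ?thesis by (simp add: ennreal_mult_less_top)
  qed
  also have "(\<integral>\<^sup>+t. \<integral>\<^sup>+\<omega>. H \<omega> t \<partial>M \<partial>L) = (\<integral>\<^sup>+\<omega>. \<integral>\<^sup>+t. H \<omega> t \<partial>L \<partial>M)"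
    by (rule P.Fubini') (use H_meas in \<open>simp add: split_beta'\<close>)
  finally have "AE \<omega> in M. (\<integral>\<^sup>+t. H \<omega> t \<partial>L) \<noteq> \<infinity>"
    using L.borel_measurable_nn_integral[of H M] H_meas
    by (intro nn_integral_PInf_AE) (auto simp: split_beta')
  then show ?thesis
  proof (rule AE_mp, intro AE_I2 impI)
    fix \<omega> assume \<omega>: "\<omega> \<in> space M" and fin: "(\<integral>\<^sup>+t. H \<omega> t \<partial>L) \<noteq> \<infinity>"
    note Hm[measurable] = H_meas1[OF \<omega>]
    note fm[measurable] = fd[OF \<omega>]
    have fin_t: "AE t in L. H \<omega> t \<noteq> \<infinity>" by (rule nn_integral_PInf_AE[OF Hm fin])
    \<comment> \<open>H is finite almost everywhere, so these level sets exhaust L up to a null set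
      and one of them has positive mass.\<close>
    define A where "A K = {t\<in>space L. H \<omega> t \<le> of_nat K}" for K :: nat
    have A_sets: "A K \<in> sets L" for K unfolding A_def by measurable
    have "\<exists>K. 0 < emeasure L (A K)"
    proof (rule ccontr)
      assume "\<nexists>K. 0 < emeasure L (A K)"
      then have "A K \<in> null_sets L" for K using A_sets by (auto simp: null_sets_def zero_less_iff_neq_zero)
      then have "(\<Union>K. A K) \<in> null_sets L" by (rule null_sets_UN)
      then have "AE t in L. t \<notin> (\<Union>K. A K)" by (rule AE_not_in)
      with fin_t have "AE t in L. False"
        using AE_space
      proof (eventually_elim)
        case (elim t)
        then obtain K where "H \<omega> t < of_nat K" using ennreal_Ex_less_of_nat[of "H \<omega> t"] by (auto simp: less_top)
        then show ?case using elim by (auto simp: A_def intro: less_imp_le)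
      qed
      then show False using Lpos ae_filter_eq_bot_iff[of L] by (simp add: trivial_limit_def)
    qed
    then obtain K where K: "0 < emeasure L (A K)" by blast
    have dm: "{u\<in>space L. dist (f t \<omega>) (f u \<omega>) \<le> (1/2) ^ n} \<in> sets L" if "t \<in> space L" for t n
      using borel_measurable_dist[OF borel_measurable_const[of "f t \<omega>"] fm] by measurable
    \<comment> \<open>The constant is K + 1 because K may be 0, and the principle asks for a
      positive one.\<close>
    show "ereal g' \<le> hausdorff_dim ((\<lambda>t. f t \<omega>) ` space L)"
    proof (rule mass_distribution_principle[where A="A K" and L=L and K="real K + 1" and f="\<lambda>t. f t \<omega>"])
      fix t n assume t: "t \<in> A K"
      then have tL: "t \<in> space L" by (simp add: A_def)
      have eq: "{u \<in> A K. dist (f t \<omega>) (f u \<omega>) \<le> (1/2) ^ n} = A K \<inter> {u\<in>space L. dist (f t \<omega>) (f u \<omega>) \<le> (1/2) ^ n}"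
        by (auto simp: A_def)
      show "{u \<in> A K. dist (f t \<omega>) (f u \<omega>) \<le> (1/2) ^ n} \<in> sets L"
        unfolding eq using A_sets dm[OF tL] by (rule sets.Int)
      have "emeasure L {u \<in> A K. dist (f t \<omega>) (f u \<omega>) \<le> (1/2) ^ n} \<le> emeasure L {u\<in>space L. dist (f t \<omega>) (f u \<omega>) \<le> (1/2) ^ n}"
        unfolding eq by (rule emeasure_mono) (use dm[OF tL] in auto)
      also have "\<dots> = \<phi> n \<omega> t"
      proof -
        have "\<phi> n \<omega> t = (\<integral>\<^sup>+u. indicator {u\<in>space L. dist (f t \<omega>) (f u \<omega>) \<le> (1/2) ^ n} u \<partial>L)"
          unfolding \<phi>_def by (rule nn_integral_cong) (auto simp: e_def split: split_indicator)
        then show ?thesis using nn_integral_indicator[OF dm[OF tL]] by simp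
      qed
      also have "\<dots> \<le> ennreal ((real K + 1) * ((1/2) ^ n) powr g')"
      proof -
        \<comment> \<open>A single term of the series already gives the mass bound at radius
          2^-n.\<close>
        have "F n \<le> suminf F" for F :: "nat \<Rightarrow> ennreal"
          using sum_le_suminf[OF summableI, of "{n}" F] by simp
        then have "ennreal (2 powr (real n * g')) * \<phi> n \<omega> t \<le> H \<omega> t" unfolding H_def .
        also have "\<dots> \<le> of_nat K" using t by (simp add: A_def)
        finally have "ennreal (2 powr (- (real n * g'))) * (ennreal (2 powr (real n * g')) * \<phi> n \<omega> t)
            \<le> ennreal (2 powr (- (real n * g'))) * ennreal (real K)"
          by (intro mult_left_mono) (auto simp: ennreal_of_nat_eq_real_of_nat)
        also have "\<dots> = ennreal (real K * ((1/2) ^ n) powr g')"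
          by (simp add: half_power_powr ennreal_mult mult.commute)
        also have "\<dots> \<le> ennreal ((real K + 1) * ((1/2) ^ n) powr g')"
          by (intro ennreal_leI mult_right_mono) auto
        also have "ennreal (2 powr (- (real n * g'))) * (ennreal (2 powr (real n * g')) * \<phi> n \<omega> t) = \<phi> n \<omega> t"
          by (simp add: mult.assoc[symmetric] ennreal_mult[symmetric] powr_add[symmetric])
        finally show ?thesis .
      qed
      finally show "emeasure L {u \<in> A K. dist (f t \<omega>) (f u \<omega>) \<le> (1/2) ^ n} \<le> ennreal ((real K + 1) * ((1/2) ^ n) powr g')" .
    qed (use A_sets K g in \<open>auto simp: A_def\<close>)
  qed
qed

text \<open>At each level t is replaced by \<open>dyadic (m + n) t\<close>, which takes countably
  many values, so measurability in \<omega> at fixed times is enough; path continuity handles the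
  limit. Starting from level m keeps the approximations inside the cell.\<close>

lemma joint_measurable_dyadic_cell:
  fixes X :: "real ^ 'n \<Rightarrow> 'w \<Rightarrow> 'b::{metric_space}"
  assumes X: "\<And>t. t \<in> dyadic_cell m x \<Longrightarrow> X t \<in> M \<rightarrow>\<^sub>M borel"
    and cont: "\<And>\<omega>. \<omega> \<in> space M \<Longrightarrow> continuous_on (dyadic_cell m x) (\<lambda>t. X t \<omega>)"
  shows "(\<lambda>(\<omega>, t). X t \<omega>) \<in> M \<Otimes>\<^sub>M restrict_space lborel (dyadic_cell m x) \<rightarrow>\<^sub>M borel"
proof -
  let ?Q = "dyadic_cell m x"
  let ?L = "restrict_space lborel ?Q"
  have space_L: "space ?L = ?Q" by (simp add: space_restrict_space)
  show ?thesis
  proof (rule borel_measurable_LIMSEQ_metric)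
    fix n
    let ?I = "dyadic (m + n) ` ?Q"
    have I: "?I \<subseteq> ?Q" by (auto intro: dyadic_in_cell)
    have d: "dyadic (m + n) \<in> ?L \<rightarrow>\<^sub>M borel"
      using dyadic_measurable by (intro measurable_restrict_space1) simp
    have "dyadic (m + n) \<in> ?L \<rightarrow>\<^sub>M count_space ?I"
    proof (subst measurable_count_space_eq_countable)
      show "countable ?I" by (rule countable_subset[OF image_mono countable_range_dyadic]) auto
      show "dyadic (m + n) \<in> space ?L \<rightarrow> ?I \<and> (\<forall>a\<in>?I. dyadic (m + n) -` {a} \<inter> space ?L \<in> sets ?L)"
      proof safe
        fix a assume "a \<in> ?Q"
        show "dyadic (m + n) -` {dyadic (m + n) a} \<inter> space ?L \<in> sets ?L"
          by (rule measurable_sets[OF d]) simp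
      qed (simp add: space_L)
    qed
    from measurable_compose[OF measurable_snd this]
    have g: "(\<lambda>p. dyadic (m + n) (snd p)) \<in> M \<Otimes>\<^sub>M ?L \<rightarrow>\<^sub>M count_space ?I" .
    have "(\<lambda>p. X (dyadic (m + n) (snd p)) (fst p)) \<in> M \<Otimes>\<^sub>M ?L \<rightarrow>\<^sub>M borel"
    proof (rule measurable_compose_countable'[OF _ g])
      show "countable ?I" by (rule countable_subset[OF image_mono countable_range_dyadic]) auto
      fix i assume "i \<in> ?I"
      then show "(\<lambda>p. X i (fst p)) \<in> M \<Otimes>\<^sub>M ?L \<rightarrow>\<^sub>M borel"
        using I by (intro measurable_compose[OF measurable_fst X]) auto
    qed
    then show "(\<lambda>(\<omega>, t). X (dyadic (m + n) t) \<omega>) \<in> M \<Otimes>\<^sub>M ?L \<rightarrow>\<^sub>M borel" by (simp add: split_beta')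
  next
    fix p assume "p \<in> space (M \<Otimes>\<^sub>M ?L)"
    then obtain \<omega> t where p: "p = (\<omega>, t)" "\<omega> \<in> space M" "t \<in> ?Q"
      using space_L by (auto simp: space_pair_measure)
    have "(\<lambda>n. X (dyadic (n + m) t) \<omega>) \<longlonglongrightarrow> X t \<omega>"
    proof (rule continuous_on_tendsto_compose[OF cont[OF p(2)]])
      show "(\<lambda>n. dyadic (n + m) t) \<longlonglongrightarrow> t" using dyadic_tendsto by (rule LIMSEQ_ignore_initial_segment)
      show "t \<in> ?Q" by fact
      show "\<forall>\<^sub>F n in sequentially. dyadic (n + m) t \<in> ?Q"
        using p(3) by (intro always_eventually allI dyadic_in_cell) auto
    qed
    then show "(\<lambda>n. (case p of (\<omega>, t) \<Rightarrow> X (dyadic (m + n) t) \<omega>)) \<longlonglongrightarrow> (case p of (\<omega>, t) \<Rightarrow> X t \<omega>)"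
      by (simp add: p(1) add.commute)
  qed
qed

section \<open>Small-ball estimates for the increments and lower bounds on one cell\<close>

context prob_space begin

lemma gaussian_field_coord_measurable:
  assumes "gaussian_field M X" "t \<in> orthant" shows "coord X j t \<in> borel_measurable M"
proof -
  have "\<forall>F c. finite F \<and> F \<subseteq> orthant \<longrightarrow> gaussian_rv M (\<lambda>\<omega>. \<Sum>t\<in>F. c t * coord X j t \<omega>)"
    using assms(1) by (simp add: gaussian_field_def gaussian_process_def)
  from this[rule_format, of "{t}" "\<lambda>_. 1"] show ?thesis using assms(2) by (simp add: gaussian_rv_def)
qed

lemma gaussian_field_measurable:
  assumes "gaussian_field M X" "t \<in> orthant" shows "X t \<in> M \<rightarrow>\<^sub>M borel"
  using gaussian_field_coord_measurable[OF assms]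
  by (subst borel_measurable_euclidean_space) (auto simp: Basis_vec_def inner_axis coord_def[abs_def])

lemma gaussian_field_increment:
  assumes "gaussian_field M X" "s \<in> orthant" "t \<in> orthant"
  shows "gaussian_rv M (\<lambda>\<omega>. coord X j t \<omega> - coord X j s \<omega>)"
\<comment> \<open>For s = t the index set {t, s} is a singleton and the coefficients do not give a
  difference; the increment is then constantly 0, a Dirac mass.\<close>
proof (cases "s = t")
  case False
  have "\<forall>F c. finite F \<and> F \<subseteq> orthant \<longrightarrow> gaussian_rv M (\<lambda>\<omega>. \<Sum>t\<in>F. c t * coord X j t \<omega>)"
    using assms(1) by (simp add: gaussian_field_def gaussian_process_def)
  from this[rule_format, of "{t, s}" "\<lambda>u. if u = t then 1 else -1"] show ?thesis using assms False by simp
qed (simp add: gaussian_rv_def)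

lemma gaussian_field_process_measurable:
  assumes "gaussian_field M X"
  shows "(\<lambda>\<omega>. \<lambda>t\<in>orthant. coord X j t \<omega>) \<in> M \<rightarrow>\<^sub>M PiM orthant (\<lambda>_. borel)"
  by (intro measurable_restrict gaussian_field_coord_measurable[OF assms])

text \<open>The exponents constrain one coordinate i, while the estimates for the norm involve all
  coordinates. Equality in law of the processes transfers second moments between them.\<close>

lemma gaussian_field_second_moment_eq:
  assumes X: "gaussian_field M X" and st: "s \<in> orthant" "t \<in> orthant"
  shows "expectation (\<lambda>\<omega>. (coord X j t \<omega> - coord X j s \<omega>)\<^sup>2) = expectation (\<lambda>\<omega>. (coord X i t \<omega> - coord X i s \<omega>)\<^sup>2)"
proof -
  let ?P = "PiM orthant (\<lambda>_. borel) :: ((real ^ 'b) \<Rightarrow> real) measure"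
  let ?R = "\<lambda>j \<omega>. \<lambda>t\<in>orthant. coord X j t \<omega>"
  have g: "(\<lambda>x. (x t - x s)\<^sup>2) \<in> borel_measurable ?P"
    using measurable_component_singleton[OF st(1), of "\<lambda>_. borel"] measurable_component_singleton[OF st(2), of "\<lambda>_. borel"]
    by (intro borel_measurable_power borel_measurable_diff)
  have "expectation (\<lambda>\<omega>. (coord X j t \<omega> - coord X j s \<omega>)\<^sup>2) = (\<integral>x. (x t - x s)\<^sup>2 \<partial>distr M ?P (?R j))" for j
    by (subst integral_distr[OF gaussian_field_process_measurable[OF X] g]) (simp add: st)
  moreover have "distr M ?P (?R j) = distr M ?P (?R i)" using X unfolding gaussian_field_def by blast
  ultimately show ?thesis by (simp only:)
qed

text \<open>The Euclidean ball lies in a cube, whose probability factorizes by independence. The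
  product form of the estimate stays meaningful when the second moment is 0.\<close>

lemma gaussian_field_small_ball:
  fixes X :: "real ^ 'n \<Rightarrow> 'a \<Rightarrow> real ^ 'd"
  assumes X: "gaussian_field M X" and st: "s \<in> orthant" "t \<in> orthant" and "0 \<le> r"
  shows "prob {\<omega>\<in>space M. norm (X t \<omega> - X s \<omega>) \<le> r} *
    sqrt (expectation (\<lambda>\<omega>. (coord X i t \<omega> - coord X i s \<omega>)\<^sup>2)) ^ CARD('d) \<le> (16 * r) ^ CARD('d)"
proof -
  let ?P = "PiM orthant (\<lambda>_. borel) :: ((real ^ 'n) \<Rightarrow> real) measure"
  let ?R = "\<lambda>j \<omega>. \<lambda>t\<in>orthant. coord X j t \<omega>"
  let ?v = "expectation (\<lambda>\<omega>. (coord X i t \<omega> - coord X i s \<omega>)\<^sup>2)"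
  define A where "A = {x\<in>space ?P. \<bar>x t - x s\<bar> \<le> r}"
  have c: "(\<lambda>x. x u) \<in> borel_measurable ?P" if "u \<in> orthant" for u
    using measurable_component_singleton[OF that, of "\<lambda>_. borel"] by simp
  have A: "A \<in> sets ?P" unfolding A_def
    by (intro borel_measurable_le borel_measurable_abs borel_measurable_diff c st borel_measurable_const)
  define E where "E j = {\<omega>\<in>space M. \<bar>coord X j t \<omega> - coord X j s \<omega>\<bar> \<le> r}" for j
  have RA: "?R j -` A \<inter> space M = E j" for j
    using measurable_space[OF gaussian_field_process_measurable[OF X, of j]] st by (auto simp: A_def E_def)
  have E_sets: "E j \<in> sets M" for j unfolding E_def
    using gaussian_field_coord_measurable[OF X]
    by (intro borel_measurable_le borel_measurable_abs borel_measurable_diff st borel_measurable_const) (auto simp: st)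
  have iv: "indep_vars (\<lambda>_. ?P) ?R UNIV"
    using X unfolding gaussian_field_def by blast
  have "prob (\<Inter>j\<in>UNIV. ?R j -` A \<inter> space M) = (\<Prod>j\<in>UNIV. prob (?R j -` A \<inter> space M))"
    by (rule indep_varsD_finite[OF iv]) (use A in auto)
  then have prod: "prob (\<Inter>j. E j) = (\<Prod>j\<in>UNIV. prob (E j))" by (simp only: RA)
  have "{\<omega>\<in>space M. norm (X t \<omega> - X s \<omega>) \<le> r} \<subseteq> (\<Inter>j. E j)"
    using component_le_norm_cart[of "X t _ - X s _"] by (auto simp: E_def coord_def intro: order_trans)
  then have "prob {\<omega>\<in>space M. norm (X t \<omega> - X s \<omega>) \<le> r} \<le> (\<Prod>j\<in>UNIV. prob (E j))"
    unfolding prod[symmetric] by (rule finite_measure_mono) (use E_sets in auto)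
  then have "prob {\<omega>\<in>space M. norm (X t \<omega> - X s \<omega>) \<le> r} * sqrt ?v ^ CARD('d) \<le> (\<Prod>j\<in>UNIV. prob (E j)) * sqrt ?v ^ CARD('d)"
    by (intro mult_right_mono) auto
  also have "\<dots> = (\<Prod>j\<in>(UNIV :: 'd set). prob (E j) * sqrt ?v)" by (simp add: prod.distrib)
  also have "\<dots> \<le> (\<Prod>j\<in>(UNIV :: 'd set). 16 * r)"
  proof (rule prod_mono, safe)
    fix j
    have "prob (E j) * sqrt (expectation (\<lambda>\<omega>. (coord X j t \<omega> - coord X j s \<omega>)\<^sup>2)) \<le> 16 * r"
      unfolding E_def by (rule gaussian_rv_small_ball[OF gaussian_field_increment[OF X st] \<open>0 \<le> r\<close>])
    then show "prob (E j) * sqrt ?v \<le> 16 * r"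
      using gaussian_field_second_moment_eq[OF X st, of j i] by simp
  qed (simp add: Bochner_Integration.integral_nonneg)
  also have "\<dots> = (16 * r) ^ CARD('d)" by simp
  finally show ?thesis .
qed

text \<open>With z = 16 r / |t - s|^\<alpha> the probability is at most the minimum of 1 and z^d,
  hence at most z^g for every g between 0 and d. Lowering the exponent from d to g is what can make
  the singularity |t - s|^(-\<alpha> g) integrable.\<close>

lemma gaussian_field_small_ball_powr:
  fixes X :: "real ^ 'n \<Rightarrow> 'a \<Rightarrow> real ^ 'd"
    and \<alpha> g :: real
  assumes X: "gaussian_field M X" and st: "s \<in> orthant" "t \<in> orthant" "s \<noteq> t" and "0 < r"
    and sub: "norm (t - s) powr (2 * \<alpha>) \<le> expectation (\<lambda>\<omega>. (coord X i t \<omega> - coord X i s \<omega>)\<^sup>2)"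
    and g: "0 \<le> g" "g \<le> CARD('d)"
  shows "prob {\<omega>\<in>space M. norm (X t \<omega> - X s \<omega>) \<le> r} \<le> 16 powr g * r powr g * norm (t - s) powr (- (\<alpha> * g))"
    (is "?P \<le> _")
proof -
  define y where "y = norm (t - s) powr \<alpha>"
  define z where "z = 16 * r / y"
  have "0 < y" using st by (simp add: y_def)
  then have "0 < z" using \<open>0 < r\<close> by (simp add: z_def)
  have "y\<^sup>2 = norm (t - s) powr (2 * \<alpha>)" by (simp add: y_def power2_eq_square powr_add[symmetric])
  then have "y \<le> sqrt (expectation (\<lambda>\<omega>. (coord X i t \<omega> - coord X i s \<omega>)\<^sup>2))"
    using sub by (intro real_le_rsqrt) simp
  then have "?P * y ^ CARD('d) \<le> ?P * sqrt (expectation (\<lambda>\<omega>. (coord X i t \<omega> - coord X i s \<omega>)\<^sup>2)) ^ CARD('d)"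
    using \<open>0 < y\<close> by (intro mult_left_mono power_mono) auto
  also have "\<dots> \<le> (16 * r) ^ CARD('d)"
    using \<open>0 < r\<close> by (intro gaussian_field_small_ball X st) auto
  finally have "?P \<le> z ^ CARD('d)" using \<open>0 < y\<close> by (simp add: z_def power_divide field_simps)
  also have "\<dots> = z powr CARD('d)" using \<open>0 < z\<close> by (simp add: powr_realpow)
  finally have 1: "?P \<le> z powr CARD('d)" .
  have "?P \<le> z powr g"
  proof (cases "z \<le> 1")
    case True
    then have "z powr CARD('d) \<le> z powr g" using \<open>0 < z\<close> g by (intro powr_mono') auto
    then show ?thesis using 1 by linarith
  next
    case False
    have "?P \<le> 1" by simp
    also have "1 \<le> z powr g" using False g by (intro ge_one_powr_ge_zero) auto
    finally show ?thesis .
  qed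
  also have "z powr g = 16 powr g * r powr g * norm (t - s) powr (- (\<alpha> * g))"
    using \<open>0 < r\<close> \<open>0 < y\<close> by (simp add: z_def y_def powr_divide powr_mult powr_powr powr_minus_divide)
  finally show ?thesis .
qed

text \<open>The map h serves both targets: h t y = y yields the range and h t y = (t, y) the graph.
  The condition on \<beta> is local integrability of the singularity in the increment bound.\<close>

lemma AE_dim_ge_of_increment_bound:
  fixes X :: "real ^ 'n \<Rightarrow> 'a \<Rightarrow> real ^ 'd"
    and h :: "real ^ 'n \<Rightarrow> real ^ 'd \<Rightarrow> 'b::{second_countable_topology, metric_space}"
    and C \<beta> g g' :: real
  assumes X: "gaussian_field M X" and x: "x \<in> orthant"
    and small: "\<And>t. t \<in> dyadic_cell m x \<Longrightarrow> dyadic_cell m x \<subseteq> cball t 1"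
    and cont: "AE \<omega> in M. continuous_on (dyadic_cell m x) (\<lambda>t. X t \<omega>)"
    and h: "(\<lambda>(t, y). h t y) \<in> borel \<Otimes>\<^sub>M borel \<rightarrow>\<^sub>M borel"
    and bound: "\<And>s t n. s \<in> dyadic_cell m x \<Longrightarrow> t \<in> dyadic_cell m x \<Longrightarrow> s \<noteq> t \<Longrightarrow>
      prob {\<omega>\<in>space M. dist (h t (X t \<omega>)) (h s (X s \<omega>)) \<le> (1/2) ^ n} \<le> C * ((1/2) ^ n) powr g * norm (t - s) powr (- \<beta>)"
    and \<beta>: "0 \<le> \<beta>" "\<beta> < CARD('n)" and g: "0 < g'" "g' < g" and "0 \<le> C"
  shows "AE \<omega> in M. ereal g' \<le> hausdorff_dim ((\<lambda>t. h t (X t \<omega>)) ` dyadic_cell m x)"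
proof -
  let ?Q = "dyadic_cell m x"
  let ?L = "restrict_space lborel ?Q"
  obtain Z where Z: "\<And>\<omega>. \<omega> \<in> space M - Z \<Longrightarrow> continuous_on ?Q (\<lambda>t. X t \<omega>)" "Z \<in> null_sets M"
    by (rule AE_E3[OF cont]) blast
  \<comment> \<open>Joint measurability is available when every path is continuous, so the paths in
    the null set Z are replaced by 0; no probability changes.\<close>
  define X' where "X' t \<omega> = (if \<omega> \<in> Z then 0 else X t \<omega>)" for t \<omega>
  have Z_sets: "Z \<in> sets M" using Z(2) by auto
  have AE_Z: "AE \<omega> in M. \<omega> \<notin> Z" by (rule AE_not_in[OF Z(2)])
  have Q_orthant: "?Q \<subseteq> orthant" by (rule dyadic_cell_orthant[OF x])
  have Q_sets: "?Q \<in> sets lborel" using dyadic_cell_borel by simp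
  have X'_meas: "X' t \<in> M \<rightarrow>\<^sub>M borel" if "t \<in> ?Q" for t
    unfolding X'_def using that Q_orthant Z_sets
    by (intro measurable_If_set borel_measurable_const gaussian_field_measurable[OF X]) auto
  have X'_cont: "continuous_on ?Q (\<lambda>t. X' t \<omega>)" if "\<omega> \<in> space M" for \<omega>
    using Z(1)[of \<omega>] that by (cases "\<omega> \<in> Z") (auto simp: X'_def)
  have joint: "(\<lambda>(\<omega>, t). X' t \<omega>) \<in> M \<Otimes>\<^sub>M ?L \<rightarrow>\<^sub>M borel"
    by (rule joint_measurable_dyadic_cell[OF X'_meas X'_cont])
  have snd_meas: "(\<lambda>p. snd p) \<in> M \<Otimes>\<^sub>M ?L \<rightarrow>\<^sub>M borel"
    by (rule measurable_compose[OF measurable_snd]) (intro measurable_restrict_space1, simp)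
  have f_meas: "(\<lambda>(\<omega>, t). h t (X' t \<omega>)) \<in> M \<Otimes>\<^sub>M ?L \<rightarrow>\<^sub>M borel"
    using measurable_compose[OF measurable_Pair[OF snd_meas joint] h] by (simp add: split_beta')
  have space_L: "space ?L = ?Q" by (simp add: space_restrict_space)
  have L_fin: "finite_measure ?L"
    using emeasure_dyadic_cell_finite[of m x] Q_sets
    by (intro finite_measureI) (simp add: space_L emeasure_restrict_space)
  have L_pos: "0 < emeasure ?L (space ?L)"
    using emeasure_dyadic_cell_pos[of m x] Q_sets by (simp add: space_L emeasure_restrict_space)
  obtain K where K: "0 \<le> K" "\<And>t :: real ^ 'n.
      (\<integral>\<^sup>+u. ennreal (norm (u - t) powr (- \<beta>)) * indicator (cball t 1) u \<partial>lborel) \<le> ennreal K"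
    using nn_integral_norm_powr_bounded[OF \<beta>] by blast
  have "AE \<omega> in M. ereal g' \<le> hausdorff_dim ((\<lambda>t. h t (X' t \<omega>)) ` space ?L)"
  proof (rule AE_hausdorff_dim_ge[OF prob_space_axioms L_fin L_pos f_meas _ g])
    show "0 \<le> C * K" using \<open>0 \<le> C\<close> K(1) by simp
    fix t n assume "t \<in> space ?L"
    then have t: "t \<in> ?Q" by (simp add: space_L)
    define c where "c = C * ((1/2) ^ n) powr g"
    have c: "0 \<le> c" using \<open>0 \<le> C\<close> by (simp add: c_def)
    have "(\<integral>\<^sup>+s. emeasure M {\<omega>\<in>space M. dist (h t (X' t \<omega>)) (h s (X' s \<omega>)) \<le> (1/2) ^ n} \<partial>?L)
      = (\<integral>\<^sup>+s. emeasure M {\<omega>\<in>space M. dist (h t (X' t \<omega>)) (h s (X' s \<omega>)) \<le> (1/2) ^ n} * indicator ?Q s \<partial>lborel)"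
      using Q_sets by (intro nn_integral_restrict_space) simp
    also have "\<dots> \<le> (\<integral>\<^sup>+s. ennreal c * (ennreal (norm (s - t) powr (- \<beta>)) * indicator (cball t 1) s) \<partial>lborel)"
    proof (rule nn_integral_mono_AE)
      show "AE s in lborel. emeasure M {\<omega>\<in>space M. dist (h t (X' t \<omega>)) (h s (X' s \<omega>)) \<le> (1/2) ^ n} * indicator ?Q s
        \<le> ennreal c * (ennreal (norm (s - t) powr (- \<beta>)) * indicator (cball t 1) s)"
        \<comment> \<open>The increment bound excludes s = t, a single point of Lebesgue measure
          0.\<close>
        using AE_lborel_singleton[of t]
      proof eventually_elim
        case (elim s)
        show ?case
        proof (cases "s \<in> ?Q")
          case True
          have "emeasure M {\<omega>\<in>space M. dist (h t (X' t \<omega>)) (h s (X' s \<omega>)) \<le> (1/2) ^ n}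
              = prob {\<omega>\<in>space M. dist (h t (X' t \<omega>)) (h s (X' s \<omega>)) \<le> (1/2) ^ n}"
            by (simp add: emeasure_eq_measure)
          also have "\<dots> = prob {\<omega>\<in>space M. dist (h t (X t \<omega>)) (h s (X s \<omega>)) \<le> (1/2) ^ n}"
          proof -
            have hm: "(\<lambda>\<omega>. h u (Y \<omega>)) \<in> M \<rightarrow>\<^sub>M borel" if "Y \<in> M \<rightarrow>\<^sub>M borel" for u Y
              using measurable_compose[OF measurable_Pair[OF measurable_const that] h, of u] by simp
            have dm: "{\<omega>\<in>space M. dist (h t (Y t \<omega>)) (h s (Y s \<omega>)) \<le> (1/2) ^ n} \<in> sets M"
              if "\<And>u. u \<in> ?Q \<Longrightarrow> Y u \<in> M \<rightarrow>\<^sub>M borel" for Y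
              by (intro borel_measurable_le borel_measurable_dist hm that t True borel_measurable_const)
            show ?thesis
            proof (intro arg_cong[where f=ennreal] measure_eq_AE)
              show "AE \<omega> in M. (\<omega> \<in> {\<omega>\<in>space M. dist (h t (X' t \<omega>)) (h s (X' s \<omega>)) \<le> (1/2) ^ n})
                = (\<omega> \<in> {\<omega>\<in>space M. dist (h t (X t \<omega>)) (h s (X s \<omega>)) \<le> (1/2) ^ n})"
                using AE_Z by eventually_elim (simp add: X'_def)
              show "{\<omega>\<in>space M. dist (h t (X' t \<omega>)) (h s (X' s \<omega>)) \<le> (1/2) ^ n} \<in> sets M"
                by (rule dm[OF X'_meas])
              show "{\<omega>\<in>space M. dist (h t (X t \<omega>)) (h s (X s \<omega>)) \<le> (1/2) ^ n} \<in> sets M"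
                using Q_orthant by (intro dm gaussian_field_measurable[OF X]) auto
            qed
          qed
          also have "\<dots> \<le> ennreal (c * norm (t - s) powr (- \<beta>))"
            unfolding c_def using elim by (intro ennreal_leI bound True t) simp
          finally show ?thesis using True small[OF t] c
            by (auto simp: ennreal_mult norm_minus_commute)
        qed simp
      qed
    qed
    also have "\<dots> = ennreal c * (\<integral>\<^sup>+s. ennreal (norm (s - t) powr (- \<beta>)) * indicator (cball t 1) s \<partial>lborel)"
    proof (rule nn_integral_cmult)
      have "(\<lambda>s. norm (s - t) powr (- \<beta>)) \<in> borel_measurable lborel" by measurable
      then show "(\<lambda>s. ennreal (norm (s - t) powr (- \<beta>)) * indicator (cball t 1) s) \<in> borel_measurable lborel"
        by (intro borel_measurable_times_ennreal measurable_compose[OF _ measurable_ennreal]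
            borel_measurable_indicator) auto
    qed
    also have "\<dots> \<le> ennreal c * ennreal K" by (intro mult_left_mono K) simp
    also have "\<dots> = ennreal (C * K * ((1/2) ^ n) powr g)"
      using c K(1) by (simp add: ennreal_mult[symmetric] c_def mult_ac)
    finally show "(\<integral>\<^sup>+s. emeasure M {\<omega>\<in>space M. dist (h t (X' t \<omega>)) (h s (X' s \<omega>)) \<le> (1/2) ^ n} \<partial>?L)
      \<le> ennreal (C * K * ((1/2) ^ n) powr g)" .
  qed
  then show ?thesis using AE_Z
  proof eventually_elim
    case (elim \<omega>)
    then show ?case by (simp add: space_L X'_def)
  qed
qed

text \<open>The limits on g are g \<le> d, from the small-ball estimate, and \<alpha> g < N, from
  integrability; together they reach every positive g' below the minimum of N / \<alpha> and
  d.\<close>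

lemma AE_range_dim_ge_cell:
  fixes X :: "real ^ 'n \<Rightarrow> 'a \<Rightarrow> real ^ 'd"
    and \<alpha> g g' :: real
  assumes X: "gaussian_field M X" and x: "x \<in> orthant"
    and small: "\<And>t. t \<in> dyadic_cell m x \<Longrightarrow> dyadic_cell m x \<subseteq> cball t 1"
    and cont: "AE \<omega> in M. continuous_on (dyadic_cell m x) (\<lambda>t. X t \<omega>)"
    and sub: "\<And>s t. s \<in> dyadic_cell m x \<Longrightarrow> t \<in> dyadic_cell m x \<Longrightarrow> s \<noteq> t \<Longrightarrow>
      norm (t - s) powr (2 * \<alpha>) \<le> expectation (\<lambda>\<omega>. (coord X i t \<omega> - coord X i s \<omega>)\<^sup>2)"
    and "0 < \<alpha>" and g: "0 < g'" "g' < g" "g \<le> CARD('d)" "\<alpha> * g < CARD('n)"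
  shows "AE \<omega> in M. ereal g' \<le> hausdorff_dim ((\<lambda>t. X t \<omega>) ` dyadic_cell m x)"
proof (rule AE_dim_ge_of_increment_bound[OF X x small cont, where \<beta>="\<alpha> * g" and g=g and C="16 powr g"])
  show "(\<lambda>(t :: real ^ 'n, y :: real ^ 'd). y) \<in> borel \<Otimes>\<^sub>M borel \<rightarrow>\<^sub>M borel" by measurable
  fix s t n assume st: "s \<in> dyadic_cell m x" "t \<in> dyadic_cell m x" "s \<noteq> t"
  then have "s \<in> orthant" "t \<in> orthant" using dyadic_cell_orthant[OF x] by auto
  then show "prob {\<omega>\<in>space M. dist (X t \<omega>) (X s \<omega>) \<le> (1/2) ^ n}
      \<le> 16 powr g * ((1/2) ^ n) powr g * norm (t - s) powr (- (\<alpha> * g))"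
    unfolding dist_norm using st g by (intro gaussian_field_small_ball_powr[where i=i, OF X] sub) auto
qed (use g \<open>0 < \<alpha>\<close> in auto)

text \<open>Graph points at distance at most r have parameters at distance at most r, so |t -
  s|^(-\<alpha> d) \<le> r^(\<beta> - \<alpha> d) |t - s|^(-\<beta>). Any \<beta> < N keeps the
  singularity integrable, while the exponent of r rises to d + \<beta> - \<alpha> d, which tends to
  N + d (1 - \<alpha>) as \<beta> tends to N.\<close>

lemma AE_graph_dim_ge_cell:
  fixes X :: "real ^ 'n \<Rightarrow> 'a \<Rightarrow> real ^ 'd"
    and \<alpha> \<beta> g' :: real
  assumes X: "gaussian_field M X" and x: "x \<in> orthant"
    and small: "\<And>t. t \<in> dyadic_cell m x \<Longrightarrow> dyadic_cell m x \<subseteq> cball t 1"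
    and cont: "AE \<omega> in M. continuous_on (dyadic_cell m x) (\<lambda>t. X t \<omega>)"
    and sub: "\<And>s t. s \<in> dyadic_cell m x \<Longrightarrow> t \<in> dyadic_cell m x \<Longrightarrow> s \<noteq> t \<Longrightarrow>
      norm (t - s) powr (2 * \<alpha>) \<le> expectation (\<lambda>\<omega>. (coord X i t \<omega> - coord X i s \<omega>)\<^sup>2)"
    and "0 < \<alpha>" and \<beta>: "\<alpha> * CARD('d) \<le> \<beta>" "\<beta> < CARD('n)"
    and g: "0 < g'" "g' < CARD('d) + \<beta> - \<alpha> * CARD('d)"
  shows "AE \<omega> in M. ereal g' \<le> hausdorff_dim ((\<lambda>t. (t, X t \<omega>)) ` dyadic_cell m x)"
proof (rule AE_dim_ge_of_increment_bound[OF X x small cont, where \<beta>=\<beta> and g="CARD('d) + \<beta> - \<alpha> * CARD('d)"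
      and C="16 powr CARD('d)"])
  show "(\<lambda>(t :: real ^ 'n, y :: real ^ 'd). (t, y)) \<in> borel \<Otimes>\<^sub>M borel \<rightarrow>\<^sub>M borel"
    by (simp add: borel_prod)
  let ?d = "real CARD('d)"
  fix s t n assume st: "s \<in> dyadic_cell m x" "t \<in> dyadic_cell m x" "s \<noteq> t"
  then have o: "s \<in> orthant" "t \<in> orthant" using dyadic_cell_orthant[OF x] by auto
  show "prob {\<omega>\<in>space M. dist (t, X t \<omega>) (s, X s \<omega>) \<le> (1/2) ^ n}
      \<le> 16 powr ?d * ((1/2) ^ n) powr (?d + \<beta> - \<alpha> * ?d) * norm (t - s) powr (- \<beta>)"
  proof (cases "dist t s \<le> (1/2) ^ n")
    case True
    have "{\<omega>\<in>space M. norm (X t \<omega> - X s \<omega>) \<le> (1/2) ^ n} \<in> sets M"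
      unfolding dist_norm[symmetric]
      by (intro borel_measurable_le borel_measurable_dist gaussian_field_measurable[OF X] o borel_measurable_const)
    then have "prob {\<omega>\<in>space M. dist (t, X t \<omega>) (s, X s \<omega>) \<le> (1/2) ^ n}
      \<le> prob {\<omega>\<in>space M. norm (X t \<omega> - X s \<omega>) \<le> (1/2) ^ n}"
    proof (rule finite_measure_mono[rotated])
      have "dist (X t \<omega>) (X s \<omega>) \<le> dist (t, X t \<omega>) (s, X s \<omega>)" for \<omega>
        using dist_snd_le[of "(t, X t \<omega>)" "(s, X s \<omega>)"] by simp
      then show "{\<omega>\<in>space M. dist (t, X t \<omega>) (s, X s \<omega>) \<le> (1/2) ^ n} \<subseteq> {\<omega>\<in>space M. norm (X t \<omega> - X s \<omega>) \<le> (1/2) ^ n}"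
        unfolding dist_norm[symmetric] by (auto intro: order_trans)
    qed
    also have "\<dots> \<le> 16 powr ?d * ((1/2) ^ n) powr ?d * norm (t - s) powr (- (\<alpha> * ?d))"
      using st o by (intro gaussian_field_small_ball_powr[where i=i, OF X] sub) auto
    also have "\<dots> = 16 powr ?d * (((1/2) ^ n) powr ?d * norm (t - s) powr (\<beta> - \<alpha> * ?d)) * norm (t - s) powr (- \<beta>)"
      using st(3) by (simp add: powr_add[symmetric])
    also have "\<dots> \<le> 16 powr ?d * (((1/2) ^ n) powr ?d * ((1/2) ^ n) powr (\<beta> - \<alpha> * ?d)) * norm (t - s) powr (- \<beta>)"
      using \<beta>(1) True by (intro mult_right_mono mult_left_mono powr_mono2) (auto simp: dist_norm)
    also have "((1/2) ^ n) powr ?d * ((1/2) ^ n) powr (\<beta> - \<alpha> * ?d) = ((1/2) ^ n) powr (?d + \<beta> - \<alpha> * ?d)"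
      by (simp add: powr_add[symmetric] add_diff_eq)
    finally show ?thesis .
  next
    \<comment> \<open>The event is empty: the parameters alone are too far apart.\<close>
    case False
    have "dist t s \<le> dist (t, X t \<omega>) (s, X s \<omega>)" for \<omega> using dist_fst_le[of "(t, X t \<omega>)" "(s, X s \<omega>)"] by simp
    then have "{\<omega>\<in>space M. dist (t, X t \<omega>) (s, X s \<omega>) \<le> (1/2) ^ n} = {}" using False by (auto intro: order_trans)
    then show ?thesis by (simp only: measure_empty) simp
  qed
next
  show "0 \<le> \<beta>" using \<open>0 < \<alpha>\<close> by (intro order_trans[OF _ \<beta>(1)]) simp
qed (use g \<beta> in auto)

end

section \<open>Upper bounds\<close>

lemma two_powr_nat: "(2::real) powr (real n * real k) = (2 ^ n) ^ k"
proof -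
  have "(2 ^ n) ^ k = (2::real) ^ (n * k)" by (rule power_mult[symmetric])
  also have "\<dots> = 2 powr real (n * k)" by (rule powr_realpow[symmetric]) simp
  finally show ?thesis by simp
qed

lemma two_powr_minus_nat: "(2::real) powr (- real n) = 1 / 2 ^ n"
  by (simp add: powr_minus_divide powr_realpow)

text \<open>Source of the bound d for the range: a unit cell splits into at most 2^(n d) cells of
  level n, and countably many unit cells fill the space.\<close>

lemma hausdorff_measure_UNIV_zero:
  fixes s :: real
  assumes "CARD('d) < s" shows "hausdorff_measure s (UNIV :: (real ^ 'd) set) = 0"
proof -
  have cell: "hausdorff_measure s (dyadic_cell 0 x) = 0" for x :: "real ^ 'd"
  proof (rule exponential_covers_null[where nmin=0 and a="CARD('d)" and b=1 and c="2 * CARD('d)" and K=1])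
    fix n :: nat
    let ?F = "dyadic_cell n ` dyadic n ` dyadic_cell 0 x"
    have "card ?F \<le> (2 ^ n) ^ CARD('d)"
      using card_image_le[of "dyadic n ` dyadic_cell 0 x" "dyadic_cell n"] card_dyadic_image_cell[of 0 n x] by simp
    then have "real (card ?F) \<le> 1 * 2 powr (real n * real CARD('d))"
      unfolding two_powr_nat by (metis mult_1 of_nat_le_iff of_nat_numeral of_nat_power)
    moreover have "dyadic_cell 0 x \<subseteq> \<Union> ?F"
      by (auto simp: dyadic_cell_def dyadic_dyadic)
    moreover have "\<forall>U\<in>?F. \<forall>y\<in>U. \<forall>z\<in>U. dist y z \<le> 2 * CARD('d) * 2 powr (- (real n * 1))"
      using dist_dyadic_cell by (auto simp: two_powr_minus_nat)
    ultimately show "\<exists>F. finite F \<and> real (card F) \<le> 1 * 2 powr (real n * real CARD('d)) \<and> dyadic_cell 0 x \<subseteq> \<Union>F \<and>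
      (\<forall>U\<in>F. \<forall>y\<in>U. \<forall>z\<in>U. dist y z \<le> 2 * CARD('d) * 2 powr (- (real n * 1)))"
      using card_dyadic_image_cell(1)[of 0 n x] by (intro exI[of _ ?F]) auto
  qed (use assms in auto)
  have "(UNIV :: (real ^ 'd) set) = (\<Union>U\<in>range (dyadic_cell 0). U)"
    using self_in_dyadic_cell by fastforce
  moreover have "hausdorff_measure s (\<Union>U\<in>range (dyadic_cell 0 :: real ^ 'd \<Rightarrow> _). U) = 0"
  proof (rule hausdorff_measure_countable_UN_zero)
    show "countable (range (dyadic_cell 0 :: real ^ 'd \<Rightarrow> _))"
      by (rule countable_subset[OF _ countable_dyadic_cells]) auto
  qed (use cell in auto)
  ultimately show ?thesis by (simp only:)
qed

lemma cball_cover: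
  fixes z :: "real ^ 'd" and h R :: real
  assumes "0 < h" "0 \<le> R"
  shows "\<exists>F. finite F \<and> real (card F) \<le> (2 * (R / h) + 3) ^ CARD('d) \<and> cball z R \<subseteq> \<Union>F \<and>
    (\<forall>U\<in>F. \<forall>x\<in>U. \<forall>y\<in>U. dist x y \<le> CARD('d) * h)"
proof -
  \<comment> \<open>Around z each coordinate needs the 2 M + 1 grid intervals of length h with
    indices from -M to M, and M \<le> R / h + 1 explains the 2 (R / h) + 3.\<close>
  define M where "M = \<lceil>R / h\<rceil>"
  define B where "B k = {y. \<forall>i. \<lfloor>(y $ i - z $ i) / h\<rfloor> = k i}" for k :: "'d \<Rightarrow> int"
  define J where "J = PiE (UNIV :: 'd set) (\<lambda>_. {- M..M})"
  have "0 \<le> R / h" using assms by simp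
  then have M: "0 \<le> M" "of_int M \<le> R / h + 1" unfolding M_def by linarith+
  have fin: "finite J" unfolding J_def by (intro finite_PiE) auto
  have "real (card (B ` J)) \<le> real (card J)" using card_image_le[OF fin] by simp
  also have "\<dots> = of_int (2 * M + 1) ^ CARD('d)" using M(1) by (simp add: J_def card_PiE)
  also have "\<dots> \<le> (2 * (R / h) + 3) ^ CARD('d)" using M by (intro power_mono) auto
  finally have card: "real (card (B ` J)) \<le> (2 * (R / h) + 3) ^ CARD('d)" .
  have "cball z R \<subseteq> \<Union>(B ` J)"
  proof
    fix y assume "y \<in> cball z R"
    then have y: "\<bar>y $ i - z $ i\<bar> \<le> R" for i
      using component_le_norm_cart[of "y - z" i] by (simp add: dist_norm norm_minus_commute)
    define k where "k i = \<lfloor>(y $ i - z $ i) / h\<rfloor>" for i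
    have "k i \<in> {- M..M}" for i
    proof -
      have "\<bar>(y $ i - z $ i) / h\<bar> \<le> R / h"
        using y[of i] \<open>0 < h\<close> by (simp add: abs_divide divide_right_mono)
      then have "- (R / h) \<le> (y $ i - z $ i) / h" "(y $ i - z $ i) / h \<le> R / h" by linarith+
      then show ?thesis unfolding k_def M_def by (simp add: le_floor_iff floor_le_iff) linarith
    qed
    then have "k \<in> J" by (auto simp: J_def)
    moreover have "y \<in> B k" by (simp add: B_def k_def)
    ultimately show "y \<in> \<Union>(B ` J)" by blast
  qed
  moreover have "dist x y \<le> CARD('d) * h" if "x \<in> B k" "y \<in> B k" for x y k
  proof -
    have "\<bar>(x - y) $ i\<bar> \<le> h" for i
    proof -
      have "\<lfloor>(x $ i - z $ i) / h\<rfloor> = \<lfloor>(y $ i - z $ i) / h\<rfloor>" using that by (simp add: B_def)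
      then have "\<bar>(x $ i - z $ i) / h - (y $ i - z $ i) / h\<bar> \<le> 1" by linarith
      then have "\<bar>(x $ i - y $ i) / h\<bar> \<le> 1" by (simp add: diff_divide_distrib)
      then show ?thesis using \<open>0 < h\<close> by (simp add: abs_divide)
    qed
    then have "(\<Sum>i\<in>UNIV. \<bar>(x - y) $ i\<bar>) \<le> (\<Sum>i\<in>(UNIV::'d set). h)" by (intro sum_mono) auto
    then show ?thesis using norm_le_l1_cart[of "x - y"] by (simp add: dist_norm)
  qed
  ultimately show ?thesis using fin card by (intro exI[of _ "B ` J"]) auto
qed

text \<open>The deterministic property that almost every path has on a suitable cell; n0 may depend
  on the path. It compares a point only with its own roundings, which is what chaining yields, and
  so bounds the oscillation on each small cell without comparing neighbouring cells. The covers
  below are built from this alone.\<close>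

locale dyadic_modulus =
  fixes f :: "real ^ 'n \<Rightarrow> real ^ 'd" and m :: nat and x :: "real ^ 'n" and C \<alpha> :: real and n0 :: nat
  assumes C: "0 < C" and \<alpha>: "0 < \<alpha>" and n0: "m \<le> n0"
    and modulus: "\<And>n y. n0 \<le> n \<Longrightarrow> y \<in> dyadic_cell m x \<Longrightarrow> dist (f y) (f (dyadic n y)) \<le> C * 2 powr (- (real n * \<alpha>))"
begin

lemma dist_same_cell:
  assumes "n0 \<le> n" "y \<in> dyadic_cell m x" "z \<in> dyadic_cell m x" "dyadic n y = dyadic n z"
  shows "dist (f y) (f z) \<le> 2 * C * 2 powr (- (real n * \<alpha>))"
  using modulus[OF assms(1,2)] modulus[OF assms(1,3)] dist_triangle2[of "f y" "f z" "f (dyadic n y)"] assms(4) by simp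

lemma card_cells_le:
  assumes "n0 \<le> n" shows "real (card (g ` dyadic n ` dyadic_cell m x)) \<le> 1 * 2 powr (real n * real CARD('n))"
proof -
  have "card (g ` dyadic n ` dyadic_cell m x) \<le> (2 ^ n) ^ CARD('n)"
    using card_image_le[of "dyadic n ` dyadic_cell m x" g] card_dyadic_image_cell[of m n x] assms n0 by simp
  then show ?thesis unfolding two_powr_nat by (metis mult_1 of_nat_le_iff of_nat_numeral of_nat_power)
qed

lemma range_null:
  assumes "CARD('n) / \<alpha> < s" shows "hausdorff_measure s (f ` dyadic_cell m x) = 0"
proof (rule exponential_covers_null[where nmin=n0 and a="CARD('n)" and b=\<alpha> and c="2 * C" and K=1])
  have "0 < CARD('n) / \<alpha>" using \<alpha> by simp
  then show "0 < s" using assms by simp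
  show "CARD('n) < s * \<alpha>" using assms \<alpha> by (simp add: field_simps)
next
  fix n assume n: "n0 \<le> n"
  let ?g = "\<lambda>p. f ` {y\<in>dyadic_cell m x. dyadic n y = p}"
  let ?F = "?g ` dyadic n ` dyadic_cell m x"
  have "\<forall>U\<in>?F. \<forall>y\<in>U. \<forall>z\<in>U. dist y z \<le> 2 * C * 2 powr (- (real n * \<alpha>))"
    using dist_same_cell[OF n] by auto
  then show "\<exists>F. finite F \<and> real (card F) \<le> 1 * 2 powr (real n * real CARD('n)) \<and> f ` dyadic_cell m x \<subseteq> \<Union>F \<and>
      (\<forall>U\<in>F. \<forall>x\<in>U. \<forall>y\<in>U. dist x y \<le> 2 * C * 2 powr (- (real n * \<alpha>)))"
    using card_cells_le[OF n, of ?g] card_dyadic_image_cell(1)[of m n x] n n0 by (intro exI[of _ ?F]) auto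
qed (use \<alpha> C in auto)

text \<open>For \<alpha> \<le> 1 the side 2^-n of a cell is at most 2^(-n \<alpha>), so the graph
  over a cell obeys the same size bound as the image, up to a constant.\<close>

lemma graph_null_of_images:
  assumes "CARD('n) / \<alpha> < s" "\<alpha> \<le> 1" shows "hausdorff_measure s ((\<lambda>t. (t, f t)) ` dyadic_cell m x) = 0"
proof (rule exponential_covers_null[where nmin=n0 and a="CARD('n)" and b=\<alpha> and c="2 * CARD('n) + 2 * C" and K=1])
  have "0 < CARD('n) / \<alpha>" using \<alpha> by simp
  then show "0 < s" using assms by simp
  show "CARD('n) < s * \<alpha>" using assms \<alpha> by (simp add: field_simps)
next
  fix n assume n: "n0 \<le> n"
  let ?g = "\<lambda>p. (\<lambda>t. (t, f t)) ` {y\<in>dyadic_cell m x. dyadic n y = p}"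
  let ?F = "?g ` dyadic n ` dyadic_cell m x"
  have "dist (y, f y) (z, f z) \<le> (2 * CARD('n) + 2 * C) * 2 powr (- (real n * \<alpha>))"
    if "y \<in> dyadic_cell m x" "z \<in> dyadic_cell m x" "dyadic n y = dyadic n z" for y z
  proof -
    have "dist (y, f y) (z, f z) \<le> dist y z + dist (f y) (f z)" by (simp add: dist_Pair_Pair sqrt_sum_squares_le_sum)
    also have "dist y z \<le> 2 * CARD('n) / 2 ^ n"
      by (rule dist_dyadic_cell[of _ n z]) (use that in \<open>auto simp: dyadic_cell_def\<close>)
    also have "2 * CARD('n) / 2 ^ n = 2 * CARD('n) * 2 powr (- real n)" by (simp add: two_powr_minus_nat)
    also have "\<dots> \<le> 2 * CARD('n) * 2 powr (- (real n * \<alpha>))"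
      using assms(2) by (intro mult_left_mono powr_mono) (auto simp: mult_left_le)
    also have "dist (f y) (f z) \<le> 2 * C * 2 powr (- (real n * \<alpha>))" by (rule dist_same_cell[OF n that])
    finally show ?thesis by (simp add: algebra_simps)
  qed
  then have "\<forall>U\<in>?F. \<forall>y\<in>U. \<forall>z\<in>U. dist y z \<le> (2 * CARD('n) + 2 * C) * 2 powr (- (real n * \<alpha>))" by auto
  then show "\<exists>F. finite F \<and> real (card F) \<le> 1 * 2 powr (real n * real CARD('n)) \<and> (\<lambda>t. (t, f t)) ` dyadic_cell m x \<subseteq> \<Union>F \<and>
      (\<forall>U\<in>F. \<forall>x\<in>U. \<forall>y\<in>U. dist x y \<le> (2 * CARD('n) + 2 * C) * 2 powr (- (real n * \<alpha>)))"
    using card_cells_le[OF n, of ?g] card_dyadic_image_cell(1)[of m n x] n n0 by (intro exI[of _ ?F]) auto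
qed (use \<alpha> C in auto)

text \<open>The image of one cell fits in a ball of radius C 2^(-n \<alpha>), which for \<alpha>
  \<le> 1 is covered by a constant times 2^(n d (1 - \<alpha>)) cubes of side 2^-n. Together with
  the 2^(n N) cells this is box counting with a = N + d (1 - \<alpha>) and b = 1.\<close>

lemma graph_null_of_boxes:
  assumes "CARD('n) + CARD('d) * (1 - \<alpha>) < s" "\<alpha> \<le> 1"
  shows "hausdorff_measure s ((\<lambda>t. (t, f t)) ` dyadic_cell m x) = 0"
proof (rule exponential_covers_null[where nmin=n0 and a="CARD('n) + CARD('d) * (1 - \<alpha>)" and b=1
      and c="2 * CARD('n) + CARD('d)" and K="(2 * C + 3) ^ CARD('d)"])
  have "0 \<le> CARD('d) * (1 - \<alpha>)" using assms(2) by simp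
  then have "0 < CARD('n) + CARD('d) * (1 - \<alpha>)" by (simp add: add_pos_nonneg)
  then show "0 < s" using assms(1) by linarith
  show "CARD('n) + CARD('d) * (1 - \<alpha>) < s * 1" using assms by simp
next
  fix n assume n: "n0 \<le> n"
  let ?P = "dyadic n ` dyadic_cell m x"
  let ?K = "((2 * C + 3) * 2 powr (real n * (1 - \<alpha>))) ^ CARD('d)"
  have ex: "\<exists>G. finite G \<and> real (card G) \<le> ?K \<and> cball (f p) (C * 2 powr (- (real n * \<alpha>))) \<subseteq> \<Union>G \<and>
    (\<forall>U\<in>G. \<forall>x\<in>U. \<forall>y\<in>U. dist x y \<le> CARD('d) * 2 powr (- real n))" for p
  proof -
    have w: "2 powr (- (real n * \<alpha>)) / 2 powr (- real n) = 2 powr (real n * (1 - \<alpha>))"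
      by (simp add: powr_diff[symmetric] algebra_simps)
    have w1: "1 \<le> 2 powr (real n * (1 - \<alpha>))" by (rule ge_one_powr_ge_zero) (use assms(2) in auto)
    have "2 * (C * 2 powr (- (real n * \<alpha>)) / 2 powr (- real n)) + 3
        = 2 * C * 2 powr (real n * (1 - \<alpha>)) + 3"
      unfolding w[symmetric] by simp
    \<comment> \<open>The additive 3 is absorbed because 2^(n (1 - \<alpha>)) \<ge> 1.\<close>
    also have "\<dots> \<le> (2 * C + 3) * 2 powr (real n * (1 - \<alpha>))"
      using w1 by (simp add: distrib_right)
    finally have "(2 * (C * 2 powr (- (real n * \<alpha>)) / 2 powr (- real n)) + 3) ^ CARD('d) \<le> ?K"
      using C by (intro power_mono) auto
    moreover obtain G where "finite G" "cball (f p) (C * 2 powr (- (real n * \<alpha>))) \<subseteq> \<Union>G"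
      "real (card G) \<le> (2 * (C * 2 powr (- (real n * \<alpha>)) / 2 powr (- real n)) + 3) ^ CARD('d)"
      "\<forall>U\<in>G. \<forall>x\<in>U. \<forall>y\<in>U. dist x y \<le> CARD('d) * 2 powr (- real n)"
      using cball_cover[of "2 powr (- real n)" "C * 2 powr (- (real n * \<alpha>))" "f p"] C by auto
    ultimately show ?thesis by (intro exI[of _ G] conjI) auto
  qed
  define G where "G p = (SOME G. finite G \<and> real (card G) \<le> ?K \<and> cball (f p) (C * 2 powr (- (real n * \<alpha>))) \<subseteq> \<Union>G \<and>
    (\<forall>U\<in>G. \<forall>x\<in>U. \<forall>y\<in>U. dist x y \<le> CARD('d) * 2 powr (- real n)))" for p
  have G: "finite (G p)" "real (card (G p)) \<le> ?K"
    "cball (f p) (C * 2 powr (- (real n * \<alpha>))) \<subseteq> \<Union>(G p)"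
    "\<And>U x y. U \<in> G p \<Longrightarrow> x \<in> U \<Longrightarrow> y \<in> U \<Longrightarrow> dist x y \<le> CARD('d) * 2 powr (- real n)" for p
    using someI_ex[OF ex[of p]] unfolding G_def[symmetric] by auto
  let ?F = "(\<lambda>(p, U). dyadic_cell n p \<times> U) ` (SIGMA p : ?P. G p)"
  have P: "finite ?P" using card_dyadic_image_cell(1)[of m n x] n n0 by simp
  have fin: "finite ?F" using P G(1) by auto
  have "real (card ?F) \<le> real (card (SIGMA p : ?P. G p))"
    by (rule of_nat_mono[OF card_image_le[OF finite_SigmaI[OF P G(1)]]])
  also have "\<dots> = (\<Sum>p\<in>?P. real (card (G p)))" using P G(1) by simp
  also have "\<dots> \<le> (\<Sum>p\<in>?P. ?K)" by (intro sum_mono G)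
  also have "\<dots> = real (card ?P) * ?K" by simp
  also have "\<dots> \<le> 2 powr (real n * real CARD('n)) * ?K"
    using card_cells_le[OF n, of id] C by (intro mult_right_mono) auto
  also have "\<dots> = (2 * C + 3) ^ CARD('d) * 2 powr (real n * (CARD('n) + CARD('d) * (1 - \<alpha>)))"
  proof -
    have "(2 powr (real n * (1 - \<alpha>))) ^ CARD('d) = 2 powr (real n * (CARD('d) * (1 - \<alpha>)))"
      by (subst powr_realpow[symmetric]) (simp_all add: powr_powr mult_ac)
    then show ?thesis by (simp add: power_mult_distrib powr_add distrib_left)
  qed
  finally have card: "real (card ?F) \<le> (2 * C + 3) ^ CARD('d) * 2 powr (real n * (CARD('n) + CARD('d) * (1 - \<alpha>)))" .
  have "(t, f t) \<in> \<Union>?F" if "t \<in> dyadic_cell m x" for t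
  proof -
    have "f t \<in> \<Union>(G (dyadic n t))" using modulus[OF n that] G(3)[of "dyadic n t"] by (auto simp: dist_commute)
    moreover have "t \<in> dyadic_cell n (dyadic n t)" by (simp add: dyadic_cell_def dyadic_dyadic)
    ultimately show ?thesis using that by force
  qed
  then have cov: "(\<lambda>t. (t, f t)) ` dyadic_cell m x \<subseteq> \<Union>?F" by blast
  have "dist u v \<le> (2 * CARD('n) + CARD('d)) * 2 powr (- (real n * 1))" if UV: "U \<in> ?F" "u \<in> U" "v \<in> U" for U u v
  proof -
    obtain p W where pW: "W \<in> G p" "U = dyadic_cell n p \<times> W" using UV(1) by auto
    then have 1: "dist (fst u) (fst v) \<le> 2 * CARD('n) * 2 powr (- real n)" "dist (snd u) (snd v) \<le> CARD('d) * 2 powr (- real n)"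
      using dist_dyadic_cell[of "fst u" n p "fst v"] G(4)[OF pW(1)] UV by (auto simp: two_powr_minus_nat)
    have "dist u v \<le> dist (fst u) (fst v) + dist (snd u) (snd v)"
      using sqrt_sum_squares_le_sum by (simp add: dist_prod_def)
    then show ?thesis using 1 by (simp add: algebra_simps)
  qed
  then show "\<exists>F. finite F \<and> real (card F) \<le> (2 * C + 3) ^ CARD('d) * 2 powr (real n * (CARD('n) + CARD('d) * (1 - \<alpha>))) \<and>
      (\<lambda>t. (t, f t)) ` dyadic_cell m x \<subseteq> \<Union>F \<and>
      (\<forall>U\<in>F. \<forall>x\<in>U. \<forall>y\<in>U. dist x y \<le> (2 * CARD('n) + CARD('d)) * 2 powr (- (real n * 1)))"
    using fin card cov by (intro exI[of _ ?F]) blast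
qed (use \<alpha> C in auto)

end

section \<open>Chaining and the almost sure upper bounds\<close>

context prob_space begin

text \<open>If every coordinate of the increment were below a in absolute value, the l1 bound would
  put its norm below d a; so some coordinate is large, and a union bound applies.\<close>

lemma gaussian_field_tail:
  fixes X :: "real ^ 'n \<Rightarrow> 'a \<Rightarrow> real ^ 'd" and a v :: real
  assumes X: "gaussian_field M X" and st: "s \<in> orthant" "t \<in> orthant" and "0 < a"
    and E: "expectation (\<lambda>\<omega>. (coord X i t \<omega> - coord X i s \<omega>)\<^sup>2) \<le> v"
  shows "prob {\<omega>\<in>space M. CARD('d) * a \<le> norm (X t \<omega> - X s \<omega>)}
    \<le> CARD('d) * (4 ^ k * (1 + fact (2 * k) / (2 ^ k * fact k)) * (v / a\<^sup>2) ^ k)"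
proof -
  let ?C = "4 ^ k * (1 + fact (2 * k) / (2 ^ k * fact k)) :: real"
  define T where "T j = {\<omega>\<in>space M. a \<le> \<bar>coord X j t \<omega> - coord X j s \<omega>\<bar>}" for j
  have T_sets: "T j \<in> sets M" for j unfolding T_def
    using gaussian_field_coord_measurable[OF X]
    by (intro borel_measurable_le borel_measurable_abs borel_measurable_diff st borel_measurable_const) (auto simp: st)
  have T_prob: "prob (T j) \<le> ?C * (v / a\<^sup>2) ^ k" for j
  proof -
    have "prob (T j) \<le> ?C * (expectation (\<lambda>\<omega>. (coord X j t \<omega> - coord X j s \<omega>)\<^sup>2) / a\<^sup>2) ^ k"
      unfolding T_def by (rule gaussian_rv_tail[OF gaussian_field_increment[OF X st] \<open>0 < a\<close>])
    also have "\<dots> \<le> ?C * (v / a\<^sup>2) ^ k"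
      using E unfolding gaussian_field_second_moment_eq[OF X st, of j i]
      by (intro mult_left_mono power_mono divide_right_mono) (auto simp: add_nonneg_nonneg)
    finally show ?thesis .
  qed
  have "{\<omega>\<in>space M. CARD('d) * a \<le> norm (X t \<omega> - X s \<omega>)} \<subseteq> (\<Union>j. T j)"
  proof
    fix \<omega> assume \<omega>: "\<omega> \<in> {\<omega>\<in>space M. CARD('d) * a \<le> norm (X t \<omega> - X s \<omega>)}"
    show "\<omega> \<in> (\<Union>j. T j)"
    proof (rule ccontr)
      assume "\<omega> \<notin> (\<Union>j. T j)"
      then have "\<bar>(X t \<omega> - X s \<omega>) $ j\<bar> < a" for j using \<omega> by (auto simp: T_def coord_def not_le)
      then have "(\<Sum>j\<in>UNIV. \<bar>(X t \<omega> - X s \<omega>) $ j\<bar>) < (\<Sum>j\<in>(UNIV :: 'd set). a)"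
        by (intro sum_strict_mono) auto
      then show False using \<omega> norm_le_l1_cart[of "X t \<omega> - X s \<omega>"] by simp
    qed
  qed
  then have "prob {\<omega>\<in>space M. CARD('d) * a \<le> norm (X t \<omega> - X s \<omega>)} \<le> prob (\<Union>j. T j)"
    by (rule finite_measure_mono) (use T_sets in auto)
  also have "\<dots> \<le> (\<Sum>j\<in>UNIV. prob (T j))"
    by (rule finite_measure_subadditive_finite) (use T_sets in auto)
  also have "\<dots> \<le> (\<Sum>j\<in>(UNIV :: 'd set). ?C * (v / a\<^sup>2) ^ k)" by (intro sum_mono T_prob)
  also have "\<dots> = CARD('d) * (?C * (v / a\<^sup>2) ^ k)" by simp
  finally show ?thesis .
qed

text \<open>Chaining along \<open>dyadic n y \<rightarrow> y\<close>: level-\<open>n+1\<close> grid points determine their level-\<open>n\<close>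
  predecessors, so only \<open>2\<^sup>(\<^sup>n\<^sup>+\<^sup>1\<^sup>)\<^sup>N\<close> increments occur at each level, and a high Gaussian moment makes
  the bad events summable.\<close>

lemma AE_dyadic_modulus:
  fixes X :: "real ^ 'n \<Rightarrow> 'a \<Rightarrow> real ^ 'd" and \<alpha> \<alpha>' B :: real
  assumes X: "gaussian_field M X" and x: "x \<in> orthant"
    and cont: "AE \<omega> in M. continuous_on (dyadic_cell m x) (\<lambda>t. X t \<omega>)"
    and hol: "\<And>s t. s \<in> dyadic_cell m x \<Longrightarrow> t \<in> dyadic_cell m x \<Longrightarrow>
      expectation (\<lambda>\<omega>. (coord X i t \<omega> - coord X i s \<omega>)\<^sup>2) \<le> B * norm (t - s) powr (2 * \<alpha>)"
    and \<alpha>: "0 < \<alpha>'" "\<alpha>' < \<alpha>" and "0 \<le> B"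
  shows "AE \<omega> in M. \<exists>C n0. dyadic_modulus (\<lambda>t. X t \<omega>) m x C \<alpha>' n0"
proof -
  let ?Q = "dyadic_cell m x"
  have Q_orthant: "?Q \<subseteq> orthant" by (rule dyadic_cell_orthant[OF x])
  define N d :: real where "N = CARD('n)" and "d = CARD('d)"
  have N: "0 < N" and d: "0 < d" by (auto simp: N_def d_def)
  \<comment> \<open>The moment order: an increment at level n is too large with probability of order
    2^(-2 n k (\<alpha> - \<alpha>')), which has to beat the number 2^(n N) of increments.\<close>
  obtain k :: nat where "N / (2 * (\<alpha> - \<alpha>')) < k" using reals_Archimedean2 by blast
  then have k: "N < k * (2 * (\<alpha> - \<alpha>'))" using \<alpha> by (simp add: field_simps)
  define q where "q = 2 powr (N - k * (2 * (\<alpha> - \<alpha>')))"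
  have "q < 2 powr 0" unfolding q_def using k by (intro powr_less_mono) auto
  then have q: "0 < q" "q < 1" by (auto simp: q_def)
  define \<rho> where "\<rho> = 2 powr (- \<alpha>')"
  have "\<rho> < 2 powr 0" unfolding \<rho>_def using \<alpha> by (intro powr_less_mono) auto
  then have \<rho>: "0 < \<rho>" "\<rho> < 1" by (auto simp: \<rho>_def)
  have \<rho>_pow: "\<rho> ^ n = 2 powr (- (real n * \<alpha>'))" for n
    by (simp add: \<rho>_def powr_realpow[symmetric] powr_powr mult.commute)
  define P where "P n = dyadic (Suc n) ` ?Q" for n
  define bad where "bad n v = {\<omega>\<in>space M. d * \<rho> ^ n \<le> norm (X v \<omega> - X (dyadic n v) \<omega>)}" for n v
  \<comment> \<open>Levels are shifted by m, since roundings coarser than level m may leave the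
    cell.\<close>
  define A where "A n = (\<Union>v\<in>P (n + m). bad (n + m) v)" for n
  define V where "V = d * (4 ^ k * (1 + fact (2 * k) / (2 ^ k * fact k)) * (B * N powr (2 * \<alpha>)) ^ k)"
  have V: "0 \<le> V" using \<open>0 \<le> B\<close> d by (simp add: V_def)
  have P_Q: "v \<in> ?Q" "dyadic n v \<in> ?Q" if "v \<in> P n" "m \<le> n" for v n
    using that by (auto simp: P_def intro!: dyadic_in_cell)
  have fin: "finite (P (n + m))" for n unfolding P_def by (rule card_dyadic_image_cell) simp
  have bad_sets: "bad n v \<in> sets M" if "v \<in> P n" "m \<le> n" for n v
    unfolding bad_def dist_norm[symmetric] using P_Q[OF that] Q_orthant
    by (intro borel_measurable_le borel_measurable_dist gaussian_field_measurable[OF X] borel_measurable_const) auto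
  have bad_prob: "prob (bad n v) \<le> V * 2 powr (- (real n * (k * (2 * (\<alpha> - \<alpha>')))))" if v: "v \<in> P n" "m \<le> n" for n v
  proof -
    have "expectation (\<lambda>\<omega>. (coord X i v \<omega> - coord X i (dyadic n v) \<omega>)\<^sup>2) \<le> B * norm (v - dyadic n v) powr (2 * \<alpha>)"
      using P_Q[OF v] by (intro hol) auto
    also have "\<dots> \<le> B * (N * 2 powr (- real n)) powr (2 * \<alpha>)"
      using norm_minus_dyadic[of v n] \<alpha> \<open>0 \<le> B\<close>
      by (intro mult_left_mono powr_mono2) (auto simp: two_powr_minus_nat N_def)
    finally have "prob (bad n v) \<le> d * (4 ^ k * (1 + fact (2 * k) / (2 ^ k * fact k)) *
        (B * (N * 2 powr (- real n)) powr (2 * \<alpha>) / (\<rho> ^ n)\<^sup>2) ^ k)"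
      unfolding bad_def d_def using P_Q[OF v] Q_orthant \<rho>
      by (intro gaussian_field_tail[where i=i, OF X]) auto
    also have "B * (N * 2 powr (- real n)) powr (2 * \<alpha>) / (\<rho> ^ n)\<^sup>2
        = (B * N powr (2 * \<alpha>)) * 2 powr (- (real n * (2 * (\<alpha> - \<alpha>'))))"
    proof -
      have "(N * 2 powr (- real n)) powr (2 * \<alpha>) = N powr (2 * \<alpha>) * 2 powr (- (real n * (2 * \<alpha>)))"
        using N by (simp add: powr_mult powr_powr)
      moreover have "(\<rho> ^ n)\<^sup>2 = 2 powr (- (real n * (2 * \<alpha>')))"
        unfolding \<rho>_pow by (simp add: power2_eq_square powr_add[symmetric] mult_ac)
      moreover have "2 powr (- (real n * (2 * \<alpha>))) / 2 powr (- (real n * (2 * \<alpha>'))) = 2 powr (- (real n * (2 * (\<alpha> - \<alpha>'))))"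
        by (simp add: powr_diff[symmetric] algebra_simps)
      ultimately show ?thesis by (simp only: times_divide_eq_right[symmetric] mult.assoc)
    qed
    also have "((B * N powr (2 * \<alpha>)) * 2 powr (- (real n * (2 * (\<alpha> - \<alpha>'))))) ^ k
        = (B * N powr (2 * \<alpha>)) ^ k * 2 powr (- (real n * (k * (2 * (\<alpha> - \<alpha>')))))"
      unfolding power_mult_distrib by (simp add: powr_realpow[symmetric] powr_powr mult_ac)
    finally show ?thesis by (simp add: V_def mult_ac)
  qed
  have A_prob: "prob (A n) \<le> 2 powr N * V * q ^ m * q ^ n" for n
  proof -
    have "prob (A n) \<le> (\<Sum>v\<in>P (n + m). prob (bad (n + m) v))"
      unfolding A_def by (rule finite_measure_subadditive_finite[OF fin]) (use bad_sets in auto)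
    also have "\<dots> \<le> (\<Sum>v\<in>P (n + m). V * 2 powr (- (real (n + m) * (k * (2 * (\<alpha> - \<alpha>'))))))"
      by (intro sum_mono bad_prob) auto
    also have "\<dots> = real (card (P (n + m))) * (V * 2 powr (- (real (n + m) * (k * (2 * (\<alpha> - \<alpha>'))))))" by simp
    also have "\<dots> \<le> 2 powr (real (Suc (n + m)) * N) * (V * 2 powr (- (real (n + m) * (k * (2 * (\<alpha> - \<alpha>'))))))"
    proof (rule mult_right_mono)
      have "card (P (n + m)) \<le> (2 ^ Suc (n + m)) ^ CARD('n)" unfolding P_def by (rule card_dyadic_image_cell) simp
      then show "real (card (P (n + m))) \<le> 2 powr (real (Suc (n + m)) * N)"
        unfolding N_def two_powr_nat by (metis of_nat_le_iff of_nat_numeral of_nat_power)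
    qed (use V in simp)
    also have "\<dots> = 2 powr N * V * (2 powr (real (n + m) * N) * 2 powr (- (real (n + m) * (k * (2 * (\<alpha> - \<alpha>'))))))"
      by (simp add: distrib_right powr_add)
    also have "2 powr (real (n + m) * N) * 2 powr (- (real (n + m) * (k * (2 * (\<alpha> - \<alpha>'))))) = q ^ (n + m)"
      unfolding q_def by (simp add: powr_realpow[symmetric] powr_powr powr_add[symmetric] algebra_simps)
    finally show ?thesis by (simp add: power_add mult_ac)
  qed
  have "AE \<omega> in M. \<forall>\<^sub>F n in sequentially. \<omega> \<in> space M - A n"
  proof (rule borel_cantelli_AE1)
    show "A n \<in> sets M" for n unfolding A_def using fin bad_sets by (intro sets.finite_UN) auto
    show "summable (\<lambda>n. prob (A n))"
    proof (rule summable_comparison_test')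
      show "summable (\<lambda>n. 2 powr N * V * q ^ m * q ^ n)" using q by (intro summable_mult summable_geometric) auto
      show "norm (prob (A n)) \<le> 2 powr N * V * q ^ m * q ^ n" for n using A_prob by simp
    qed
  qed (simp add: emeasure_eq_measure)
  with cont show ?thesis
  proof eventually_elim
    case (elim \<omega>)
    then obtain n1 where n1: "\<And>n. n \<ge> n1 \<Longrightarrow> \<omega> \<in> space M - A n" by (auto simp: eventually_sequentially)
    have step: "dist (X (dyadic (Suc n) y) \<omega>) (X (dyadic n y) \<omega>) \<le> d * \<rho> ^ n" if "n1 + m \<le> n" "y \<in> ?Q" for n y
    proof -
      have "\<omega> \<in> space M" "\<omega> \<notin> A (n - m)" using n1[of "n - m"] that(1) by auto
      moreover have "dyadic (Suc n) y \<in> P (n - m + m)" using that by (auto simp: P_def)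
      ultimately have "\<omega> \<notin> bad n (dyadic (Suc n) y)" using that(1) by (auto simp: A_def)
      then show ?thesis using \<open>\<omega> \<in> space M\<close> by (simp add: bad_def dyadic_dyadic dist_norm)
    qed
    \<comment> \<open>The sum of the geometric series with terms d \<rho>^j.\<close>
    define C where "C = d / (1 - \<rho>)"
    have C: "0 < C" "d = C * (1 - \<rho>)" using d \<rho> by (auto simp: C_def)
    have "dyadic_modulus (\<lambda>t. X t \<omega>) m x C \<alpha>' (n1 + m)"
    proof
      show "0 < C" by (rule C)
      fix n y assume n: "n1 + m \<le> n" and y: "y \<in> ?Q"
      \<comment> \<open>The factor 1 - \<rho>^j is what closes the induction, through d = C (1 -
        \<rho>).\<close>
      have chain: "dist (X (dyadic (n + j) y) \<omega>) (X (dyadic n y) \<omega>) \<le> C * \<rho> ^ n * (1 - \<rho> ^ j)" for j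
      proof (induction j)
        case (Suc j)
        have "dist (X (dyadic (n + Suc j) y) \<omega>) (X (dyadic n y) \<omega>)
          \<le> dist (X (dyadic (Suc (n + j)) y) \<omega>) (X (dyadic (n + j) y) \<omega>) + dist (X (dyadic (n + j) y) \<omega>) (X (dyadic n y) \<omega>)"
          using dist_triangle by simp
        also have "\<dots> \<le> d * \<rho> ^ (n + j) + C * \<rho> ^ n * (1 - \<rho> ^ j)"
          using add_mono[OF step[OF trans_le_add1[OF n] y] Suc.IH] .
        also have "\<dots> = C * \<rho> ^ n * (1 - \<rho> ^ Suc j)"
          unfolding C(2) by (simp add: power_add algebra_simps)
        finally show ?case .
      qed simp
      \<comment> \<open>Path continuity lets the chain reach y itself, not only its
        roundings.\<close>
      have "(\<lambda>j. X (dyadic (j + n) y) \<omega>) \<longlonglongrightarrow> X y \<omega>"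
      proof (rule continuous_on_tendsto_compose[OF elim(1)])
        show "(\<lambda>j. dyadic (j + n) y) \<longlonglongrightarrow> y" using dyadic_tendsto by (rule LIMSEQ_ignore_initial_segment)
        show "\<forall>\<^sub>F j in sequentially. dyadic (j + n) y \<in> ?Q"
          using n y by (intro always_eventually allI dyadic_in_cell) auto
      qed fact
      then have lim: "(\<lambda>j. dist (X (dyadic (n + j) y) \<omega>) (X (dyadic n y) \<omega>)) \<longlonglongrightarrow> dist (X y \<omega>) (X (dyadic n y) \<omega>)"
        by (intro tendsto_dist tendsto_const) (simp add: add.commute)
      have "dist (X y \<omega>) (X (dyadic n y) \<omega>) \<le> C * \<rho> ^ n"
      proof (rule tendsto_upperbound[OF lim])
        have "C * \<rho> ^ n * (1 - \<rho> ^ j) \<le> C * \<rho> ^ n * 1" for j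
          using C(1) \<rho> by (intro mult_left_mono) auto
        then have "dist (X (dyadic (n + j) y) \<omega>) (X (dyadic n y) \<omega>) \<le> C * \<rho> ^ n" for j
          using order_trans[OF chain[of j]] by simp
        then show "\<forall>\<^sub>F j in sequentially. dist (X (dyadic (n + j) y) \<omega>) (X (dyadic n y) \<omega>) \<le> C * \<rho> ^ n"
          by (intro always_eventually allI)
      qed simp
      then show "dist (X y \<omega>) (X (dyadic n y) \<omega>) \<le> C * 2 powr (- (real n * \<alpha>'))"
        by (simp add: \<rho>_pow)
    qed (use \<alpha> in auto)
    then show ?case by blast
  qed
qed

text \<open>Every point of I has a cell on which the Hoelder estimate holds with one constant. These
  cells are countably many, so one null set serves them all, and countable stability of null
  Hausdorff measure passes from the cells to I.\<close>

lemma AE_dim_le_local: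
  fixes X :: "real ^ 'n \<Rightarrow> 'a \<Rightarrow> real ^ 'd" and a :: real
  assumes X: "gaussian_field M X" and I: "open_orthant_interval I"
    and cont: "AE \<omega> in M. continuous_on I (\<lambda>t. X t \<omega>)" and "0 < a" "a < \<alpha>"
    and hol: "\<And>u. u \<in> I \<Longrightarrow> \<exists>\<rho>>0. \<exists>B\<ge>0. \<forall>s\<in>ball u \<rho> \<inter> orthant. \<forall>t\<in>ball u \<rho> \<inter> orthant.
      expectation (\<lambda>\<omega>. (coord X i t \<omega> - coord X i s \<omega>)\<^sup>2) \<le> B * norm (t - s) powr (2 * \<alpha>)"
  shows "AE \<omega> in M. hausdorff_dim (range_on X \<omega> I) \<le> ereal (CARD('n) / a) \<and>
    (a \<le> 1 \<longrightarrow> hausdorff_dim (graph_on X \<omega> I) \<le> ereal (CARD('n) / a) \<and>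
      hausdorff_dim (graph_on X \<omega> I) \<le> ereal (CARD('n) + CARD('d) * (1 - a)))"
proof -
  have I_orthant: "I \<subseteq> orthant" and I_open: "openin (top_of_set orthant) I"
    using I by (auto simp: open_orthant_interval_def orthant_interval_def)
  define good where "good Q \<longleftrightarrow> Q \<subseteq> I \<and> (\<exists>B\<ge>0. \<forall>s\<in>Q. \<forall>t\<in>Q.
      expectation (\<lambda>\<omega>. (coord X i t \<omega> - coord X i s \<omega>)\<^sup>2) \<le> B * norm (t - s) powr (2 * \<alpha>))" for Q
  define \<Q> where "\<Q> = {Q. \<exists>m x. Q = dyadic_cell m x \<and> x \<in> I \<and> good Q}"
  have "\<Q> \<subseteq> range (\<lambda>(m, x). dyadic_cell m x)" by (auto simp: \<Q>_def)
  then have count: "countable \<Q>" by (rule countable_subset[OF _ countable_dyadic_cells])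
  have cover: "I = (\<Union>Q\<in>\<Q>. Q)"
  proof
    show "I \<subseteq> (\<Union>Q\<in>\<Q>. Q)"
    proof
      fix u assume u: "u \<in> I"
      obtain r where r: "0 < r" "ball u r \<inter> orthant \<subseteq> I"
        using I_open u unfolding openin_contains_ball by blast
      obtain \<rho> B where \<rho>: "0 < \<rho>" "0 \<le> B" "\<forall>s\<in>ball u \<rho> \<inter> orthant. \<forall>t\<in>ball u \<rho> \<inter> orthant.
        expectation (\<lambda>\<omega>. (coord X i t \<omega> - coord X i s \<omega>)\<^sup>2) \<le> B * norm (t - s) powr (2 * \<alpha>)"
        using hol[OF u] by blast
      \<comment> \<open>The radius r keeps the cell inside I, the radius \<rho> inside the region of
        the estimate.\<close>
      obtain m where m: "dyadic_cell m u \<subseteq> ball u (min r \<rho>)"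
        using exists_dyadic_cell_in_ball[of "min r \<rho>" u] r \<rho> by auto
      have "dyadic_cell m u \<subseteq> ball u r \<inter> orthant" "dyadic_cell m u \<subseteq> ball u \<rho> \<inter> orthant"
        using m dyadic_cell_orthant[of u m] I_orthant u by auto
      then have "good (dyadic_cell m u)" unfolding good_def using r \<rho>(2,3) by blast
      then show "u \<in> (\<Union>Q\<in>\<Q>. Q)" using u self_in_dyadic_cell[of u m] by (auto simp: \<Q>_def)
    qed
  qed (auto simp: \<Q>_def good_def)
  have "AE \<omega> in M. \<forall>Q\<in>\<Q>. \<exists>m x C n0. Q = dyadic_cell m x \<and> dyadic_modulus (\<lambda>t. X t \<omega>) m x C a n0"
  proof (subst AE_ball_countable[OF count], safe)
    fix Q assume "Q \<in> \<Q>"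
    then obtain m x where Q: "Q = dyadic_cell m x" "x \<in> I" "good Q" by (auto simp: \<Q>_def)
    then obtain B where B: "0 \<le> B" "\<And>s t. s \<in> Q \<Longrightarrow> t \<in> Q \<Longrightarrow>
      expectation (\<lambda>\<omega>. (coord X i t \<omega> - coord X i s \<omega>)\<^sup>2) \<le> B * norm (t - s) powr (2 * \<alpha>)"
      by (auto simp: good_def)
    have "Q \<subseteq> I" using Q(3) by (simp add: good_def)
    have "AE \<omega> in M. \<exists>C n0. dyadic_modulus (\<lambda>t. X t \<omega>) m x C a n0"
    proof (rule AE_dyadic_modulus[OF X _ _ _ \<open>0 < a\<close> \<open>a < \<alpha>\<close> B(1)])
      show "x \<in> orthant" using Q(2) I_orthant by auto
      show "AE \<omega> in M. continuous_on (dyadic_cell m x) (\<lambda>t. X t \<omega>)"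
        using cont by eventually_elim (use \<open>Q \<subseteq> I\<close> Q(1) in \<open>auto intro: continuous_on_subset\<close>)
    qed (use B(2) Q(1) in auto)
    then show "AE \<omega> in M. \<exists>m x C n0. Q = dyadic_cell m x \<and> dyadic_modulus (\<lambda>t. X t \<omega>) m x C a n0"
      by eventually_elim (use Q(1) in blast)
  qed
  then show ?thesis
  proof eventually_elim
    case (elim \<omega>)
    have un: "hausdorff_measure s (g ` I) = 0" if "\<And>Q. Q \<in> \<Q> \<Longrightarrow> hausdorff_measure s (g ` Q) = 0"
      for s and g :: "real ^ 'n \<Rightarrow> 'c::metric_space"
    proof -
      have "g ` I = (\<Union>Q\<in>\<Q>. g ` Q)" by (subst cover) blast
      then show ?thesis using hausdorff_measure_countable_UN_zero[OF count that] by simp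
    qed
    have un': "hausdorff_measure s (g ` I) = 0"
      if *: "\<And>m x C n0. dyadic_modulus (\<lambda>t. X t \<omega>) m x C a n0 \<Longrightarrow> hausdorff_measure s (g ` dyadic_cell m x) = 0"
      for s and g :: "real ^ 'n \<Rightarrow> 'c::metric_space"
    proof (rule un)
      fix Q assume "Q \<in> \<Q>"
      then obtain m x C n0 where "Q = dyadic_cell m x" "dyadic_modulus (\<lambda>t. X t \<omega>) m x C a n0"
        using bspec[OF elim \<open>Q \<in> \<Q>\<close>] by (elim exE conjE)
      then show "hausdorff_measure s (g ` Q) = 0" using *[of m x C n0] by simp
    qed
    have range: "range_on X \<omega> I = (\<lambda>t. X t \<omega>) ` I" and graph: "graph_on X \<omega> I = (\<lambda>t. (t, X t \<omega>)) ` I"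
      by (auto simp: range_on_def graph_on_def)
    show ?case unfolding range graph
    proof (intro conjI impI)
      show "hausdorff_dim ((\<lambda>t. X t \<omega>) ` I) \<le> ereal (CARD('n) / a)"
        using \<open>0 < a\<close> by (intro hausdorff_dim_le un') (auto intro: dyadic_modulus.range_null)
      assume "a \<le> 1"
      then show "hausdorff_dim ((\<lambda>t. (t, X t \<omega>)) ` I) \<le> ereal (CARD('n) / a)"
        using \<open>0 < a\<close> by (intro hausdorff_dim_le un') (auto intro: dyadic_modulus.graph_null_of_images)
      show "hausdorff_dim ((\<lambda>t. (t, X t \<omega>)) ` I) \<le> ereal (CARD('n) + CARD('d) * (1 - a))"
        using \<open>0 < a\<close> \<open>a \<le> 1\<close> by (intro hausdorff_dim_le un') (auto intro: dyadic_modulus.graph_null_of_boxes)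
    qed
  qed
qed

end

section \<open>Local exponents and the theorem\<close>

lemma Lim_at_right_mono:
  fixes f :: "real \<Rightarrow> ereal"
  assumes "\<And>x y. 0 < x \<Longrightarrow> x \<le> y \<Longrightarrow> f x \<le> f y"
  shows "Lim (at_right 0) f = (INF x\<in>{0<..}. f x)"
proof (rule tendsto_Lim)
  show "(f \<longlongrightarrow> (INF x\<in>{0<..}. f x)) (at_right 0)"
  proof (rule order_tendstoI)
    fix a assume "a < (INF x\<in>{0<..}. f x)"
    then have *: "a < f x" if "0 < x" for x using that by (auto simp: less_INF_D)
    show "\<forall>\<^sub>F x in at_right 0. a < f x"
      by (rule eventually_mono[OF eventually_at_right_less]) (rule *)
  next
    fix a assume "(INF x\<in>{0<..}. f x) < a"
    then obtain b where b: "0 < b" "f b < a" unfolding INF_less_iff by auto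
    then have "f y < a" if "0 < y" "y < b" for y using le_less_trans[OF assms[of y b] b(2)] that by simp
    then show "\<forall>\<^sub>F x in at_right 0. f x < a"
      unfolding eventually_at_right_field using b(1) by (intro exI[of _ b]) auto
  qed
qed simp

lemma Lim_at_right_antimono:
  fixes f :: "real \<Rightarrow> ereal"
  assumes "\<And>x y. 0 < x \<Longrightarrow> x \<le> y \<Longrightarrow> f y \<le> f x"
  shows "Lim (at_right 0) f = (SUP x\<in>{0<..}. f x)"
proof (rule tendsto_Lim)
  show "(f \<longlongrightarrow> (SUP x\<in>{0<..}. f x)) (at_right 0)"
  proof (rule order_tendstoI)
    fix a assume "(SUP x\<in>{0<..}. f x) < a"
    then have *: "f x < a" if "0 < x" for x using that by (auto simp: SUP_lessD)
    show "\<forall>\<^sub>F x in at_right 0. f x < a"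
      by (rule eventually_mono[OF eventually_at_right_less]) (rule *)
  next
    fix a assume "a < (SUP x\<in>{0<..}. f x)"
    then obtain b where b: "0 < b" "a < f b" unfolding less_SUP_iff by auto
    then have "a < f y" if "0 < y" "y < b" for y using less_le_trans[OF b(2) assms[of y b]] that by simp
    then show "\<forall>\<^sub>F x in at_right 0. a < f x"
      unfolding eventually_at_right_field using b(1) by (intro exI[of _ b]) auto
  qed
qed simp

lemma ball_pairs_mono: "x \<le> y \<Longrightarrow> ball_pairs u x \<subseteq> ball_pairs u y"
  by (auto simp: ball_pairs_def)

text \<open>Turns a finite limit into a finite supremum at one radius, the only form in which the
  Hoelder exponent can be exploited.\<close>

lemma Lim_SUP_ball_pairs:
  "Lim (at_right 0) (\<lambda>\<rho>. SUP (s, t)\<in>ball_pairs u \<rho>. g s t :: ereal) = (INF \<rho>\<in>{0<..}. SUP (s, t)\<in>ball_pairs u \<rho>. g s t)"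
  by (intro Lim_at_right_mono SUP_subset_mono ball_pairs_mono) auto

lemma Lim_INF_ball_pairs:
  "Lim (at_right 0) (\<lambda>\<rho>. INF (s, t)\<in>ball_pairs u \<rho>. g s t :: ereal) = (SUP \<rho>\<in>{0<..}. INF (s, t)\<in>ball_pairs u \<rho>. g s t)"
  by (intro Lim_at_right_antimono INF_superset_mono ball_pairs_mono) auto

section \<open>Local exponents as two-point estimates\<close>

context prob_space begin

lemma local_holder_exponent_bound:
  fixes Y :: "real ^ 'n \<Rightarrow> 'a \<Rightarrow> real"
  assumes "ereal a < local_holder_exponent M Y u" "0 < a"
  shows "\<exists>\<rho>>0. \<exists>B\<ge>0. \<forall>s\<in>ball u \<rho> \<inter> orthant. \<forall>t\<in>ball u \<rho> \<inter> orthant.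
    expectation (\<lambda>\<omega>. (Y t \<omega> - Y s \<omega>)\<^sup>2) \<le> B * norm (t - s) powr (2 * a)"
proof -
  have "ereal a < Sup {ereal \<alpha> | \<alpha>. 0 < \<alpha> \<and>
       Lim (at_right 0) (\<lambda>\<rho>. SUP (s, t) \<in> ball_pairs u \<rho>. incr_quotient M Y \<alpha> s t) < \<infinity>}"
    \<comment> \<open>Since a > 0, it lies below the supremum itself and not just above the 0 of the
      \<open>max\<close>.\<close>
    using assms unfolding local_holder_exponent_def by (auto simp: less_max_iff_disj)
  then obtain \<alpha> where \<alpha>: "a < \<alpha>" "Lim (at_right 0) (\<lambda>\<rho>. SUP (s, t) \<in> ball_pairs u \<rho>. incr_quotient M Y \<alpha> s t) < \<infinity>"
    unfolding less_Sup_iff by auto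
  then obtain r where r: "0 < r" "(SUP (s, t) \<in> ball_pairs u r. incr_quotient M Y \<alpha> s t) < \<infinity>"
    unfolding Lim_SUP_ball_pairs INF_less_iff by auto
  have "\<exists>B0. (SUP (s, t) \<in> ball_pairs u r. incr_quotient M Y \<alpha> s t) \<le> ereal B0"
    using r(2) by (cases "SUP (s, t) \<in> ball_pairs u r. incr_quotient M Y \<alpha> s t") auto
  then obtain B0 where B0: "(SUP (s, t) \<in> ball_pairs u r. incr_quotient M Y \<alpha> s t) \<le> ereal B0" by (rule exE)
  \<comment> \<open>Within distance 1/2 of u one has |t - s| \<le> 1, so lowering the exponent from
    \<alpha> to a only enlarges the bound.\<close>
  define \<rho> where "\<rho> = min r (1/2)"
  define B where "B = max B0 0"
  have "expectation (\<lambda>\<omega>. (Y t \<omega> - Y s \<omega>)\<^sup>2) \<le> B * norm (t - s) powr (2 * a)"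
    if s: "s \<in> ball u \<rho> \<inter> orthant" and t: "t \<in> ball u \<rho> \<inter> orthant" for s t
  proof (cases "s = t")
    case False
    then have "(s, t) \<in> ball_pairs u r" using s t by (auto simp: ball_pairs_def \<rho>_def)
    then have "incr_quotient M Y \<alpha> s t \<le> (SUP (s, t) \<in> ball_pairs u r. incr_quotient M Y \<alpha> s t)"
      by (rule SUP_upper2) simp
    then have "incr_quotient M Y \<alpha> s t \<le> ereal B0" using B0 by (rule order_trans)
    then have "expectation (\<lambda>\<omega>. (Y t \<omega> - Y s \<omega>)\<^sup>2) \<le> B0 * norm (t - s) powr (2 * \<alpha>)"
      using False by (simp add: incr_quotient_def pos_divide_le_eq)
    also have "\<dots> \<le> B * norm (t - s) powr (2 * \<alpha>)" by (intro mult_right_mono) (auto simp: B_def)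
    also have "\<dots> \<le> B * norm (t - s) powr (2 * a)"
    proof (intro mult_left_mono powr_mono')
      have "dist s t \<le> dist u s + dist u t" by (rule dist_triangle3)
      then show "norm (t - s) \<le> 1" using s t by (simp add: \<rho>_def dist_norm norm_minus_commute)
    qed (use \<alpha>(1) in \<open>auto simp: B_def\<close>)
    finally show ?thesis .
  qed simp
  then show ?thesis using r(1) by (intro exI[of _ \<rho>]) (auto simp: \<rho>_def B_def intro!: exI[of _ B])
qed

lemma local_sub_exponent_bound:
  fixes Y :: "real ^ 'n \<Rightarrow> 'a \<Rightarrow> real"
  assumes "local_sub_exponent M Y u < ereal a"
  shows "\<exists>\<rho>>0. \<forall>s\<in>ball u \<rho> \<inter> orthant. \<forall>t\<in>ball u \<rho> \<inter> orthant. s \<noteq> t \<longrightarrow>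
    norm (t - s) powr (2 * a) \<le> expectation (\<lambda>\<omega>. (Y t \<omega> - Y s \<omega>)\<^sup>2)"
proof -
  obtain \<alpha> where \<alpha>: "\<alpha> < a" "Lim (at_right 0) (\<lambda>\<rho>. INF (s, t) \<in> ball_pairs u \<rho>. incr_quotient M Y \<alpha> s t) = \<infinity>"
    using assms unfolding local_sub_exponent_def Inf_less_iff by auto
  \<comment> \<open>The infinite limit provides a radius at which the quotients exceed 1, so that
    the lower estimate carries no constant.\<close>
  then have "1 < (SUP \<rho>\<in>{0<..}. INF (s, t) \<in> ball_pairs u \<rho>. incr_quotient M Y \<alpha> s t)"
    unfolding Lim_INF_ball_pairs by simp
  then obtain r where r: "0 < r" "1 < (INF (s, t) \<in> ball_pairs u r. incr_quotient M Y \<alpha> s t)"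
    unfolding less_SUP_iff by auto
  define \<rho> where "\<rho> = min r (1/2)"
  have "norm (t - s) powr (2 * a) \<le> expectation (\<lambda>\<omega>. (Y t \<omega> - Y s \<omega>)\<^sup>2)"
    if s: "s \<in> ball u \<rho> \<inter> orthant" and t: "t \<in> ball u \<rho> \<inter> orthant" and "s \<noteq> t" for s t
  proof -
    have "(s, t) \<in> ball_pairs u r" using s t \<open>s \<noteq> t\<close> by (auto simp: ball_pairs_def \<rho>_def)
    then have "(INF (s, t) \<in> ball_pairs u r. incr_quotient M Y \<alpha> s t) \<le> incr_quotient M Y \<alpha> s t"
      by (rule INF_lower2) simp
    then have "1 < incr_quotient M Y \<alpha> s t" using r(2) by (rule less_le_trans[rotated])
    then have "norm (t - s) powr (2 * \<alpha>) \<le> expectation (\<lambda>\<omega>. (Y t \<omega> - Y s \<omega>)\<^sup>2)"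
      using \<open>s \<noteq> t\<close> by (simp add: incr_quotient_def one_ereal_def pos_less_divide_eq)
    moreover have "norm (t - s) powr (2 * a) \<le> norm (t - s) powr (2 * \<alpha>)"
    proof (intro powr_mono')
      have "dist s t \<le> dist u s + dist u t" by (rule dist_triangle3)
      then show "norm (t - s) \<le> 1" using s t by (simp add: \<rho>_def dist_norm norm_minus_commute)
    qed (use \<alpha>(1) in auto)
    ultimately show ?thesis by linarith
  qed
  then show ?thesis using r(1) by (intro exI[of _ \<rho>]) (auto simp: \<rho>_def)
qed

text \<open>Cutting \<open>[s, t]\<close> into \<open>k\<close> equal pieces bounds the second moment by \<open>B \<bar>t - s\<bar>\<^sup>2\<^sup>\<alpha> k\<^sup>2\<^sup>-\<^sup>2\<^sup>\<alpha>\<close>.\<close>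

lemma increment_zero_of_exponent_gt_1:
  fixes Y :: "real ^ 'n \<Rightarrow> 'a \<Rightarrow> real" and B \<alpha> :: real
  assumes "1 < \<alpha>" and S: "convex S" "s \<in> S" "t \<in> S"
    and sq: "\<And>s t. s \<in> S \<Longrightarrow> t \<in> S \<Longrightarrow> integrable M (\<lambda>\<omega>. (Y t \<omega> - Y s \<omega>)\<^sup>2)"
    and hol: "\<And>s t. s \<in> S \<Longrightarrow> t \<in> S \<Longrightarrow> expectation (\<lambda>\<omega>. (Y t \<omega> - Y s \<omega>)\<^sup>2) \<le> B * norm (t - s) powr (2 * \<alpha>)"
  shows "expectation (\<lambda>\<omega>. (Y t \<omega> - Y s \<omega>)\<^sup>2) = 0"
proof -
  define D where "D = B * norm (t - s) powr (2 * \<alpha>)"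
  have bound: "expectation (\<lambda>\<omega>. (Y t \<omega> - Y s \<omega>)\<^sup>2) \<le> D * real (Suc k) powr (2 - 2 * \<alpha>)" for k
  proof -
    let ?k = "Suc k"
    define p where "p j = s + (real j / real ?k) *\<^sub>R (t - s)" for j :: nat
    have p_S: "p j \<in> S" if "j \<le> ?k" for j
    proof -
      have "p j = (1 - real j / real ?k) *\<^sub>R s + (real j / real ?k) *\<^sub>R t"
        by (simp add: p_def algebra_simps)
      then show ?thesis using that S by (simp only:) (rule convexD, auto)
    qed
    have ends: "p 0 = s" "p ?k = t" by (simp_all add: p_def)
    have diff: "norm (p (Suc j) - p j) = norm (t - s) / real ?k" for j
    proof -
      have "p (Suc j) - p j = (1 / real ?k) *\<^sub>R (t - s)"
        by (simp add: p_def scaleR_left_diff_distrib[symmetric] diff_divide_distrib[symmetric])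
      then show ?thesis by simp
    qed
    \<comment> \<open>Cauchy-Schwarz on the telescoping sum. Its factor k and the k summands give
      k^2, against k^(-2 \<alpha>) from the shorter steps.\<close>
    have "(Y t \<omega> - Y s \<omega>)\<^sup>2 \<le> real ?k * (\<Sum>j<?k. (Y (p (Suc j)) \<omega> - Y (p j) \<omega>)\<^sup>2)" for \<omega>
    proof -
      have "Y t \<omega> - Y s \<omega> = (\<Sum>j<?k. Y (p (Suc j)) \<omega> - Y (p j) \<omega>)"
        by (subst sum_lessThan_telescope) (simp only: ends)
      then show ?thesis using sum_squared_le_sum_of_squares[of "\<lambda>j. Y (p (Suc j)) \<omega> - Y (p j) \<omega>" "{..<?k}"]
        by (simp add: mult.commute)
    qed
    then have "expectation (\<lambda>\<omega>. (Y t \<omega> - Y s \<omega>)\<^sup>2) \<le> expectation (\<lambda>\<omega>. real ?k * (\<Sum>j<?k. (Y (p (Suc j)) \<omega> - Y (p j) \<omega>)\<^sup>2))"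
      using S p_S by (intro integral_mono integrable_mult_right Bochner_Integration.integrable_sum sq) auto
    also have "\<dots> = real ?k * (\<Sum>j<?k. expectation (\<lambda>\<omega>. (Y (p (Suc j)) \<omega> - Y (p j) \<omega>)\<^sup>2))"
      using p_S by (subst integral_mult_right_zero, subst Bochner_Integration.integral_sum) (auto intro!: sq)
    also have "\<dots> \<le> real ?k * (\<Sum>j<?k. B * (norm (t - s) / real ?k) powr (2 * \<alpha>))"
    proof (intro mult_left_mono sum_mono)
      fix j assume "j \<in> {..<?k}"
      then show "expectation (\<lambda>\<omega>. (Y (p (Suc j)) \<omega> - Y (p j) \<omega>)\<^sup>2) \<le> B * (norm (t - s) / real ?k) powr (2 * \<alpha>)"
        using hol[of "p j" "p (Suc j)"] p_S[of j] p_S[of "Suc j"] unfolding diff by simp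
    qed simp
    also have "\<dots> = D * (real ?k ^ 2 * (1 / real ?k) powr (2 * \<alpha>))"
      by (simp add: D_def powr_divide power2_eq_square)
    also have "real ?k ^ 2 * (1 / real ?k) powr (2 * \<alpha>) = real ?k powr (2 - 2 * \<alpha>)"
      by (simp add: powr_divide powr_diff powr_realpow del: of_nat_Suc)
    finally show ?thesis .
  qed
  have "filterlim (\<lambda>k. real (Suc k)) at_top sequentially"
    by (rule filterlim_compose[OF filterlim_real_sequentially filterlim_Suc])
  then have "(\<lambda>k. real (Suc k) powr (2 - 2 * \<alpha>)) \<longlonglongrightarrow> 0"
    using assms(1) by (intro tendsto_neg_powr) auto
  then have "(\<lambda>k. D * real (Suc k) powr (2 - 2 * \<alpha>)) \<longlonglongrightarrow> D * 0" by (intro tendsto_mult tendsto_const)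
  then have "expectation (\<lambda>\<omega>. (Y t \<omega> - Y s \<omega>)\<^sup>2) \<le> D * 0"
    by (rule tendsto_lowerbound) (use bound in auto)
  then show ?thesis by (simp add: antisym integral_nonneg)
qed

text \<open>Above 1, all increments near u vanish in mean square, and then every positive exponent
  is admissible. A finite infimum of the exponents over I is therefore at most 1, the range in which
  the graph covers work.\<close>

lemma local_holder_exponent_gt_1:
  fixes X :: "real ^ 'n \<Rightarrow> 'a \<Rightarrow> real ^ 'd"
  assumes X: "gaussian_field M X" and "1 < local_holder_exponent M (coord X i) u"
  shows "local_holder_exponent M (coord X i) u = \<infinity>"
proof -
  let ?Y = "coord X i"
  obtain \<alpha> where \<alpha>: "1 < ereal \<alpha>" "ereal \<alpha> < local_holder_exponent M ?Y u"
    using ereal_dense2[OF assms(2)] by blast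
  then have "1 < \<alpha>" by simp
  then obtain \<rho> B where \<rho>: "0 < \<rho>" "\<forall>s\<in>ball u \<rho> \<inter> orthant. \<forall>t\<in>ball u \<rho> \<inter> orthant.
    expectation (\<lambda>\<omega>. (?Y t \<omega> - ?Y s \<omega>)\<^sup>2) \<le> B * norm (t - s) powr (2 * \<alpha>)"
    using local_holder_exponent_bound[OF \<alpha>(2)] by auto
  \<comment> \<open>The segment from s to t must stay where the estimate holds; a ball cut with the
    orthant is convex.\<close>
  have "convex (orthant :: (real ^ 'n) set)" by (auto simp: orthant_def convex_def)
  then have conv: "convex (ball u \<rho> \<inter> orthant)" by (intro convex_Int convex_ball)
  have zero: "expectation (\<lambda>\<omega>. (?Y t \<omega> - ?Y s \<omega>)\<^sup>2) = 0" if "s \<in> ball u \<rho> \<inter> orthant" "t \<in> ball u \<rho> \<inter> orthant" for s t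
    by (rule increment_zero_of_exponent_gt_1[OF \<open>1 < \<alpha>\<close> conv that, where B=B])
      (use \<rho>(2) in \<open>auto intro!: gaussian_rv_square_integrable gaussian_field_increment[OF X]\<close>)
  have "Lim (at_right 0) (\<lambda>\<rho>. SUP (s, t) \<in> ball_pairs u \<rho>. incr_quotient M ?Y b s t) < \<infinity>" for b
  proof -
    have "(SUP (s, t) \<in> ball_pairs u \<rho>. incr_quotient M ?Y b s t) \<le> 0"
      by (rule SUP_least) (use zero in \<open>auto simp: ball_pairs_def incr_quotient_def\<close>)
    then have "(INF \<rho>\<in>{0<..}. SUP (s, t) \<in> ball_pairs u \<rho>. incr_quotient M ?Y b s t) \<le> 0"
      using \<rho>(1) by (intro INF_lower2[of \<rho>]) auto
    then show ?thesis unfolding Lim_SUP_ball_pairs by (rule le_less_trans) simp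
  qed
  then have "{ereal b | b. 0 < b \<and>
       Lim (at_right 0) (\<lambda>\<rho>. SUP (s, t) \<in> ball_pairs u \<rho>. incr_quotient M ?Y b s t) < \<infinity>} = {ereal b | b. 0 < b}"
    by blast
  moreover have "Sup {ereal b | b. 0 < b} = \<infinity>"
  proof -
    have up: "ereal b \<le> Sup {ereal b | b. 0 < b}" if "0 < b" for b
      by (rule Sup_upper) (use that in auto)
    show ?thesis
    proof (cases "Sup {ereal b | b. 0 < b}")
      case (real c)
      then have "\<bar>c\<bar> + 1 \<le> c" using up[of "\<bar>c\<bar> + 1"] by simp
      then show ?thesis by linarith
    next
      case MInf
      then show ?thesis using up[of 1] by simp
    qed
  qed
  ultimately show ?thesis unfolding local_holder_exponent_def by simp
qed

text \<open>One cell around u suffices by monotonicity of dimension, so a single point whose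
  sub-exponent is close to the infimum yields the lower bound for all of I.\<close>

lemma AE_dim_ge_local:
  fixes X :: "real ^ 'n \<Rightarrow> 'a \<Rightarrow> real ^ 'd" and a g :: real
  assumes X: "gaussian_field M X" and I: "open_orthant_interval I"
    and cont: "AE \<omega> in M. continuous_on I (\<lambda>t. X t \<omega>)" and "0 < a"
    and u: "u \<in> I" "local_sub_exponent M (coord X i) u < ereal a"
  shows "0 < g \<Longrightarrow> g < CARD('d) \<Longrightarrow> g < CARD('n) / a \<Longrightarrow> AE \<omega> in M. ereal g \<le> hausdorff_dim (range_on X \<omega> I)"
    and "0 < g \<Longrightarrow> CARD('d) * a < CARD('n) \<Longrightarrow> g < CARD('n) + CARD('d) * (1 - a) \<Longrightarrow>
      AE \<omega> in M. ereal g \<le> hausdorff_dim (graph_on X \<omega> I)"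
proof -
  have I_orthant: "I \<subseteq> orthant" and I_open: "openin (top_of_set orthant) I"
    using I by (auto simp: open_orthant_interval_def orthant_interval_def)
  obtain r where r: "0 < r" "ball u r \<inter> orthant \<subseteq> I"
    using I_open u(1) unfolding openin_contains_ball by blast
  obtain \<rho> where \<rho>: "0 < \<rho>" "\<forall>s\<in>ball u \<rho> \<inter> orthant. \<forall>t\<in>ball u \<rho> \<inter> orthant. s \<noteq> t \<longrightarrow>
    norm (t - s) powr (2 * a) \<le> expectation (\<lambda>\<omega>. (coord X i t \<omega> - coord X i s \<omega>)\<^sup>2)"
    using local_sub_exponent_bound[OF u(2)] by blast
  \<comment> \<open>The bound 1/2 puts the cell in a unit ball around each of its points, the domain
    of the singular integral.\<close>
  define e where "e = min (min r \<rho>) (1/2)"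
  have e: "0 < e" "e \<le> r" "e \<le> \<rho>" "e \<le> 1/2" using r \<rho> by (auto simp: e_def)
  obtain m where m: "dyadic_cell m u \<subseteq> ball u e"
    using exists_dyadic_cell_in_ball[OF e(1)] by blast
  have u_orthant: "u \<in> orthant" using u I_orthant by auto
  have Qr: "dyadic_cell m u \<subseteq> ball u r \<inter> orthant" and Q\<rho>: "dyadic_cell m u \<subseteq> ball u \<rho> \<inter> orthant"
    using m dyadic_cell_orthant[OF u_orthant, of m] e by auto
  then have QI: "dyadic_cell m u \<subseteq> I" using r by auto
  have small: "dyadic_cell m u \<subseteq> cball t 1" if "t \<in> dyadic_cell m u" for t
  proof
    fix s assume "s \<in> dyadic_cell m u"
    then have "dist u s < 1/2" "dist u t < 1/2" using m that e by auto
    then show "s \<in> cball t 1" using dist_triangle3[of t s u] by simp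
  qed
  have contQ: "AE \<omega> in M. continuous_on (dyadic_cell m u) (\<lambda>t. X t \<omega>)"
    using cont by eventually_elim (use QI in \<open>auto intro: continuous_on_subset\<close>)
  have sub: "norm (t - s) powr (2 * a) \<le> expectation (\<lambda>\<omega>. (coord X i t \<omega> - coord X i s \<omega>)\<^sup>2)"
    if "s \<in> dyadic_cell m u" "t \<in> dyadic_cell m u" "s \<noteq> t" for s t
    using \<rho>(2) Q\<rho> that by blast
  show "AE \<omega> in M. ereal g \<le> hausdorff_dim (range_on X \<omega> I)"
    if g: "0 < g" "g < CARD('d)" "g < CARD('n) / a"
  proof -
    obtain g1 where g1: "g < g1" "g1 < min (CARD('d)) (CARD('n) / a)" using dense[of g "min (CARD('d)) (CARD('n) / a)"] g by auto
    have "a * g1 < CARD('n)" using g1(2) \<open>0 < a\<close> by (simp add: field_simps)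
    then have "AE \<omega> in M. ereal g \<le> hausdorff_dim ((\<lambda>t. X t \<omega>) ` dyadic_cell m u)"
      using g1 g by (intro AE_range_dim_ge_cell[OF X u_orthant small contQ sub \<open>0 < a\<close>, where g=g1]) auto
    then show ?thesis
    proof eventually_elim
      case (elim \<omega>)
      have "(\<lambda>t. X t \<omega>) ` dyadic_cell m u \<subseteq> range_on X \<omega> I" using QI by (auto simp: range_on_def)
      from order_trans[OF elim hausdorff_dim_mono[OF this]] show ?case .
    qed
  qed
  show "AE \<omega> in M. ereal g \<le> hausdorff_dim (graph_on X \<omega> I)"
    if g: "0 < g" "CARD('d) * a < CARD('n)" "g < CARD('n) + CARD('d) * (1 - a)"
  proof -
    \<comment> \<open>The two lower limits for \<beta> are those of
      \<open>AE_graph_dim_ge_cell\<close>: \<beta> must be at least a d, and g must stay below d +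
      \<beta> - a d.\<close>
    have "max (a * CARD('d)) (g - CARD('d) + a * CARD('d)) < CARD('n)" using g by (simp add: algebra_simps)
    from dense[OF this] obtain \<beta> where \<beta>: "max (a * CARD('d)) (g - CARD('d) + a * CARD('d)) < \<beta>" "\<beta> < CARD('n)"
      by (elim exE conjE)
    then have "AE \<omega> in M. ereal g \<le> hausdorff_dim ((\<lambda>t. (t, X t \<omega>)) ` dyadic_cell m u)"
      using g by (intro AE_graph_dim_ge_cell[OF X u_orthant small contQ sub \<open>0 < a\<close>, where \<beta>=\<beta>]) auto
    then show ?thesis
    proof eventually_elim
      case (elim \<omega>)
      have "(\<lambda>t. (t, X t \<omega>)) ` dyadic_cell m u \<subseteq> graph_on X \<omega> I" using QI by (auto simp: graph_on_def)
      from order_trans[OF elim hausdorff_dim_mono[OF this]] show ?case .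
    qed
  qed
qed

end

text \<open>The null set may depend on g; with g restricted to the rationals below G only countably
  many null sets are united.\<close>

lemma AE_ereal_le_of_less:
  fixes h :: "'w \<Rightarrow> ereal" and G :: real
  assumes "0 < G" "\<And>g. 0 < g \<Longrightarrow> g < G \<Longrightarrow> AE \<omega> in M. ereal g \<le> h \<omega>"
  shows "AE \<omega> in M. ereal G \<le> h \<omega>"
proof -
  have "AE \<omega> in M. \<forall>g\<in>\<rat>. 0 < g \<and> g < G \<longrightarrow> ereal g \<le> h \<omega>"
    unfolding AE_ball_countable[OF countable_rat] using assms(2) by auto
  then show ?thesis
  proof eventually_elim
    case (elim \<omega>)
    show ?case
    proof (rule ccontr)
      assume "\<not> ereal G \<le> h \<omega>"
      then have "max (h \<omega>) 0 < ereal G" using assms(1) by (simp add: not_le)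
      then obtain z where z: "max (h \<omega>) 0 < ereal z" "ereal z < ereal G" using ereal_dense2 by blast
      then obtain g where "g \<in> \<rat>" "z < g" "g < G" using Rats_dense_in_real[of z G] by auto
      with elim z show False by (auto simp: max_less_iff_conj dest!: bspec[of _ _ g])
        (metis ereal_less_le less_ereal.simps(1) not_less order_less_le_trans order_less_trans)
    qed
  qed
qed

text \<open>Path continuity is a hypothesis because \<open>gaussian_field\<close> speaks of laws on
  a product space, which do not determine it. The graph upper bound is guarded by
  \<open>\<alpha>hol < \<infinity>\<close>: for an infinite exponent N + d (1 -
  \<open>\<alpha>hol\<close>) is -\<infinity>, while a dimension is never negative.\<close>

theorem theorem2p4:
  fixes M :: "'w measure"
    and X :: "real ^ 'n \<Rightarrow> 'w \<Rightarrow> real ^ 'd"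
    and I :: "(real ^ 'n) set"
    and i :: 'd
    and N d :: ereal
    and \<alpha>sub \<alpha>hol :: ereal
  assumes "prob_space M"
    and "gaussian_field M X"
    and "open_orthant_interval I"
    and continuous_paths: "AE \<omega> in M. continuous_on I (\<lambda>t. X t \<omega>)"
    and N_def: "N = ereal (real CARD('n))"
    and d_def: "d = ereal (real CARD('d))"
    and sub_def: "\<alpha>sub = (INF t\<in>I. local_sub_exponent M (coord X i) t)"
    and hol_def: "\<alpha>hol = (INF t\<in>I. local_holder_exponent M (coord X i) t)"
    and "0 < \<alpha>hol" and "\<alpha>hol \<le> \<alpha>sub"
  shows "AE \<omega> in M.
      hausdorff_dim (graph_on X \<omega> I) \<ge> (if N \<le> d * \<alpha>sub then N / \<alpha>sub else N + d * (1 - \<alpha>sub)) \<and>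
      (\<alpha>hol < \<infinity> \<longrightarrow> hausdorff_dim (graph_on X \<omega> I) \<le> min (N / \<alpha>hol) (N + d * (1 - \<alpha>hol))) \<and>
      hausdorff_dim (range_on X \<omega> I) \<ge> (if N \<le> d * \<alpha>sub then N / \<alpha>sub else d) \<and>
      hausdorff_dim (range_on X \<omega> I) \<le> min (N / \<alpha>hol) d"
proof -
  interpret prob_space M by fact
  note X = \<open>gaussian_field M X\<close> and I = \<open>open_orthant_interval I\<close>
  define n k :: real where "n = CARD('n)" and "k = CARD('d)"
  have pos: "0 < n" "0 < k" by (auto simp: n_def k_def)
  have N: "N = ereal n" and d: "d = ereal k" by (simp_all add: N_def d_def n_def k_def)
  have graph_ge_range: "hausdorff_dim (range_on X \<omega> I) \<le> hausdorff_dim (graph_on X \<omega> I)" for \<omega>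
  proof -
    have "range_on X \<omega> I = snd ` graph_on X \<omega> I" by (force simp: range_on_def graph_on_def)
    then show ?thesis by (simp add: hausdorff_dim_image_le[OF dist_snd_le])
  qed
  have lower: "AE \<omega> in M.
      hausdorff_dim (graph_on X \<omega> I) \<ge> (if N \<le> d * \<alpha>sub then N / \<alpha>sub else N + d * (1 - \<alpha>sub)) \<and>
      hausdorff_dim (range_on X \<omega> I) \<ge> (if N \<le> d * \<alpha>sub then N / \<alpha>sub else d)"
  proof (cases \<alpha>sub)
    \<comment> \<open>Here N \<le> d \<open>\<alpha>sub\<close> holds and N / \<infinity> = 0, so
      both lower bounds are 0.\<close>
    case PInf
    then show ?thesis using pos by (simp add: N d hausdorff_dim_nonneg)
  next
    case MInf
    then show ?thesis using \<open>0 < \<alpha>hol\<close> \<open>\<alpha>hol \<le> \<alpha>sub\<close> by simp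
  next
    case (real A)
    then have A: "0 < A" using \<open>0 < \<alpha>hol\<close> \<open>\<alpha>hol \<le> \<alpha>sub\<close> by (metis ereal_less(2) less_le_trans)
    have ex: "\<exists>u\<in>I. local_sub_exponent M (coord X i) u < ereal a" if "A < a" for a
    proof -
      have "\<alpha>sub < ereal a" using that real by simp
      then show ?thesis unfolding sub_def INF_less_iff .
    qed
    have range: "AE \<omega> in M. ereal g \<le> hausdorff_dim (range_on X \<omega> I)"
      if g: "0 < g" "g < k" "g * A < n" for g
    proof -
      \<comment> \<open>The slack in g A < n leaves room for an a > A, and some point of I has its
        sub-exponent below that a.\<close>
      have "A < n / g" using g by (simp add: field_simps)
      from dense[OF this] obtain a where a: "A < a" "a < n / g" by (elim exE conjE)
      then have "g < n / a" using g A by (simp add: field_simps)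
      moreover obtain u where "u \<in> I" "local_sub_exponent M (coord X i) u < ereal a" using ex[OF a(1)] by (rule bexE)
      ultimately show ?thesis
        using g a A by (intro AE_dim_ge_local(1)[OF X I continuous_paths, of a u i]) (auto simp: n_def k_def)
    qed
    show ?thesis
    proof (cases "n \<le> k * A")
      case True
      have "AE \<omega> in M. ereal (n / A) \<le> hausdorff_dim (range_on X \<omega> I)"
      proof (rule AE_ereal_le_of_less)
        fix g assume g: "0 < g" "g < n / A"
        then have "g * A < n" using A by (simp add: field_simps)
        moreover have "n / A \<le> k" using True A by (simp add: field_simps)
        ultimately show "AE \<omega> in M. ereal g \<le> hausdorff_dim (range_on X \<omega> I)" using g by (intro range) auto
      qed (use pos A in simp)
      then show ?thesis
      proof eventually_elim
        case (elim \<omega>)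
        then show ?case using True A order_trans[OF elim graph_ge_range] by (simp add: N d real)
      qed
    next
      case False
      have "AE \<omega> in M. ereal k \<le> hausdorff_dim (range_on X \<omega> I)"
      proof (rule AE_ereal_le_of_less)
        fix g assume g: "0 < g" "g < k"
        then have "g * A < k * A" using A by simp
        then show "AE \<omega> in M. ereal g \<le> hausdorff_dim (range_on X \<omega> I)" using g False by (intro range) auto
      qed (use pos in simp)
      moreover have "AE \<omega> in M. ereal (n + k * (1 - A)) \<le> hausdorff_dim (graph_on X \<omega> I)"
      proof (rule AE_ereal_le_of_less)
        show "0 < n + k * (1 - A)" using False pos by (simp add: algebra_simps)
        fix g assume g: "0 < g" "g < n + k * (1 - A)"
        \<comment> \<open>The two upper limits for a express k a < n and g < n + k (1 - a).\<close>
        have "A < min (n / k) ((n + k - g) / k)" using False g pos by (simp add: field_simps)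
        from dense[OF this] obtain a where a: "A < a" "a < min (n / k) ((n + k - g) / k)" by (elim exE conjE)
        then have "k * a < n" "g < n + k * (1 - a)" using pos by (auto simp: field_simps)
        moreover obtain u where "u \<in> I" "local_sub_exponent M (coord X i) u < ereal a" using ex[OF a(1)] by (rule bexE)
        ultimately show "AE \<omega> in M. ereal g \<le> hausdorff_dim (graph_on X \<omega> I)"
          using g a A by (intro AE_dim_ge_local(2)[OF X I continuous_paths, of a u i]) (auto simp: n_def k_def)
      qed
      ultimately show ?thesis
      proof eventually_elim
        case (elim \<omega>)
        then show ?case using False by (simp add: N d real one_ereal_def)
      qed
    qed
  qed
  have "AE \<omega> in M. hausdorff_dim (range_on X \<omega> I) \<le> ereal (n / a) \<and>
    (a \<le> 1 \<longrightarrow> hausdorff_dim (graph_on X \<omega> I) \<le> ereal (n / a) \<and>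
      hausdorff_dim (graph_on X \<omega> I) \<le> ereal (n + k * (1 - a)))" if a: "0 < a" "ereal a < \<alpha>hol" for a
  proof -
    obtain b where b: "ereal a < ereal b" "ereal b < \<alpha>hol" using ereal_dense2[OF a(2)] by (elim exE conjE)
    have "\<exists>\<rho>>0. \<exists>B\<ge>0. \<forall>s\<in>ball u \<rho> \<inter> orthant. \<forall>t\<in>ball u \<rho> \<inter> orthant.
      expectation (\<lambda>\<omega>. (coord X i t \<omega> - coord X i s \<omega>)\<^sup>2) \<le> B * norm (t - s) powr (2 * b)" if "u \<in> I" for u
    proof (rule local_holder_exponent_bound)
      show "ereal b < local_holder_exponent M (coord X i) u"
        using b(2) that unfolding hol_def by (rule less_INF_D)
    qed (use a b in simp)
    then show ?thesis unfolding n_def k_def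
      using a b by (intro AE_dim_le_local[OF X I continuous_paths, of a b i]) auto
  qed
  \<comment> \<open>Rational a only, so that one null set serves all exponents below
    \<open>\<alpha>hol\<close>.\<close>
  then have "AE \<omega> in M. \<forall>a\<in>\<rat>. 0 < a \<and> ereal a < \<alpha>hol \<longrightarrow> hausdorff_dim (range_on X \<omega> I) \<le> ereal (n / a) \<and>
    (a \<le> 1 \<longrightarrow> hausdorff_dim (graph_on X \<omega> I) \<le> ereal (n / a) \<and>
      hausdorff_dim (graph_on X \<omega> I) \<le> ereal (n + k * (1 - a)))"
    unfolding AE_ball_countable[OF countable_rat] by auto
  with lower show ?thesis
  proof eventually_elim
    case (elim \<omega>)
    let ?r = "hausdorff_dim (range_on X \<omega> I)" and ?g = "hausdorff_dim (graph_on X \<omega> I)"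
    have up: "?r \<le> ereal (n / a)" "a \<le> 1 \<Longrightarrow> ?g \<le> ereal (n / a)" "a \<le> 1 \<Longrightarrow> ?g \<le> ereal (n + k * (1 - a))"
      if "a \<in> \<rat>" "0 < a" "ereal a < \<alpha>hol" for a using elim(2) that by auto
    have r_d: "?r \<le> d"
    proof -
      have "hausdorff_dim (UNIV :: (real ^ 'd) set) \<le> ereal k"
      proof (rule hausdorff_dim_le)
        show "hausdorff_measure s (UNIV :: (real ^ 'd) set) = 0" if "k < s" for s
          using that unfolding k_def by (rule hausdorff_measure_UNIV_zero)
      qed (simp add: k_def)
      then show ?thesis using hausdorff_dim_mono[of "range_on X \<omega> I" UNIV] unfolding d by (auto intro: order_trans)
    qed
    have "?r \<le> N / \<alpha>hol \<and> (\<alpha>hol < \<infinity> \<longrightarrow> ?g \<le> min (N / \<alpha>hol) (N + d * (1 - \<alpha>hol)))"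
    proof (cases \<alpha>hol)
      case MInf
      then show ?thesis using \<open>0 < \<alpha>hol\<close> by simp
    next
      case PInf
      \<comment> \<open>Arbitrarily large exponents a are admissible here, and n / a drops below any
        e.\<close>
      have "?r \<le> 0"
      proof (rule ereal_le_epsilon2)
        fix e :: real assume "0 < e"
        have "n / e < n / e + 1" by simp
        then obtain a where a: "a \<in> \<rat>" "n / e < a" using Rats_dense_in_real by blast
        have "0 < n / e" using pos \<open>0 < e\<close> by simp
        then have "0 < a" using a by linarith
        then have "n / a \<le> e" using a \<open>0 < e\<close> by (simp add: field_simps)
        then show "?r \<le> 0 + ereal e" using up(1)[OF a(1) \<open>0 < a\<close>] PInf by (simp add: order_trans)
      qed
      then show ?thesis by (simp add: PInf N)
    next
      case (real A)
      then have A: "0 < A" using \<open>0 < \<alpha>hol\<close> by simp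
      have "A \<le> 1"
      proof (rule ccontr)
        assume "\<not> A \<le> 1"
        have "local_holder_exponent M (coord X i) u = \<infinity>" if "u \<in> I" for u
        proof (rule local_holder_exponent_gt_1[OF X])
          have "\<alpha>hol \<le> local_holder_exponent M (coord X i) u" unfolding hol_def using that by (rule INF_lower)
          moreover have "1 < \<alpha>hol" using \<open>\<not> A \<le> 1\<close> by (simp add: real one_ereal_def)
          ultimately show "1 < local_holder_exponent M (coord X i) u" by (rule less_le_trans[rotated])
        qed
        then have "\<infinity> \<le> \<alpha>hol" unfolding hol_def by (intro INF_greatest) simp
        then show False by (simp add: real)
      qed
      have approx: "\<exists>a\<in>\<rat>. 0 < a \<and> ereal a < \<alpha>hol \<and> a \<le> 1 \<and> c < a" if "c < A" for c
      proof -
        have "max c 0 < A" using that A by simp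
        from Rats_dense_in_real[OF this] obtain a where "a \<in> \<rat>" "max c 0 < a" "a < A" by (elim bexE conjE)
        then show ?thesis using \<open>A \<le> 1\<close> by (intro bexI[of _ a]) (auto simp: real)
      qed
      have 1: "?r \<le> ereal (n / A)" "?g \<le> ereal (n / A)"
      proof -
        have "?r \<le> ereal (n / A) + ereal e \<and> ?g \<le> ereal (n / A) + ereal e" if "0 < e" for e
        proof -
          have ne: "0 < n / A + e" using pos A that by (simp add: add_pos_pos)
          \<comment> \<open>This threshold is the a with n / a = n / A + e; an admissible rational
            above it loses at most e.\<close>
          then have "n / (n / A + e) < A" using A that by (simp add: pos_divide_less_eq distrib_left)
          then obtain a where a: "a \<in> \<rat>" "0 < a" "ereal a < \<alpha>hol" "a \<le> 1" "n / (n / A + e) < a" using approx by blast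
          have "n / a \<le> n / A + e" using ne a(2,5) by (simp add: pos_divide_less_eq pos_divide_le_eq mult.commute)
          then have "ereal (n / a) \<le> ereal (n / A) + ereal e" by simp
          then show ?thesis using up[OF a(1-3)] a(4) order_trans by blast
        qed
        then show "?r \<le> ereal (n / A)" "?g \<le> ereal (n / A)" by (auto intro: ereal_le_epsilon2)
      qed
      have 2: "?g \<le> ereal (n + k * (1 - A))"
      proof (rule ereal_le_epsilon2)
        fix e :: real assume "0 < e"
        \<comment> \<open>The bound is linear in a with slope -k, so an error of e / k in the
          exponent costs e.\<close>
        then have "A - e / k < A" using pos by simp
        then obtain a where a: "a \<in> \<rat>" "0 < a" "ereal a < \<alpha>hol" "a \<le> 1" "A - e / k < a" using approx by blast
        have "n + k * (1 - a) \<le> n + k * (1 - A) + e" using a(5) pos by (simp add: field_simps)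
        then have "ereal (n + k * (1 - a)) \<le> ereal (n + k * (1 - A)) + ereal e" by simp
        then show "?g \<le> ereal (n + k * (1 - A)) + ereal e" using up(3)[OF a(1-4)] order_trans by blast
      qed
      show ?thesis using 1 2 A by (simp add: real N d one_ereal_def)
    qed
    then show ?case using elim(1) r_d by simp
  qed
qed

end
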